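(* Let $\Omega=\mathbb{C}\setminus(-\infty,0]$. For every $z\in\Omega$, \[ \sum_{n=1}^{\infty} \frac{\Lambda(n)z}{\pi \sqrt{n} (z+n)}-\sum_{n=1}^{\infty} \frac{\Lambda(n)}{\pi \sqrt{n} (1+nz)}=\sqrt{z}-\frac{\zeta'(\frac12)}{\pi \zeta (\frac12)}-2\sum_{\gamma>0} \frac{\sin (\alpha \log z) }{\sinh \pi \alpha} + h(z), \] where \[ h(z)=\frac{1}{\sqrt{z}(z^2-1)}-\frac{1}{2z-2}+\frac{\log(8\pi)+C}{\pi} \frac{1}{z+1}-\frac{2}{\pi} \frac{\sqrt{z}}{z+1}\arctan \frac{1}{\sqrt{z}}, \] and at $z=1$ the value $h(1)$ is understood as the limit $\lim_{z\to1}h(z)$ (the singularity at $z=1$ is removable).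
   Context: $\log z$ denotes the principal branch on $\Omega$ (with $|\arg z|<\pi$), and $z^s=\exp(s\log z)$; in particular $\sqrt z=z^{1/2}$ is the principal square root, and $\arctan$ is the principal branch. $\Lambda$ is the von Mangoldt function. $C$ is the Euler–Mascheroni constant. $\rho=\beta+i\gamma$ runs over the non-trivial zeros of the Riemann zeta function $\zeta(s)$ (counted with multiplicity), and for each such zero $\alpha=-i(\rho-\tfrac12)$, so $\rho=\tfrac12+i\alpha$. The sum $\sum_{\gamma>0}$ is over the non-trivial zeros with positive imaginary part. *)

theory Defs
  imports "HOL-Complex_Analysis.Complex_Analysis" "HOL-Number_Theory.Number_Theory"
begin

text \<open>Riemann zeta function: the (unique, by the identity theorem) holomorphic function
  on the plane minus 1 that agrees with the Dirichlet series for Re s > 1.\<close>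
definition riemann_zeta :: "complex \<Rightarrow> complex" where
  "riemann_zeta = (SOME f. f holomorphic_on (UNIV - {1}) \<and>
       (\<forall>s. Re s > 1 \<longrightarrow> f s = (\<Sum>n. of_nat (Suc n) powr (- s))))"

text \<open>Non-trivial zeros with positive imaginary part (trivial zeros are real).\<close>
definition zeta_zeros_upper :: "complex set" where
  "zeta_zeros_upper = {\<rho>. \<rho> \<noteq> 1 \<and> riemann_zeta \<rho> = 0 \<and> Im \<rho> > 0}"

definition h0 :: "complex \<Rightarrow> complex" where
  "h0 z = 1 / (csqrt z * (z\<^sup>2 - 1)) - 1 / (2 * z - 2)
          + (complex_of_real (ln (8 * pi) + euler_mascheroni) / pi) * (1 / (z + 1))
          - (2 / pi) * (csqrt z / (z + 1)) * Arctan (1 / csqrt z)"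

definition hfun :: "complex \<Rightarrow> complex" where
  "hfun z = (if z = 1 then Lim (at 1) h0 else h0 z)"

end

theory Submission
  imports Defs
begin

text \<open>
  Let \<open>\<xi>(s) = (s - 1) \<zeta>(s) \<pi>\<^sup>-\<^sup>s\<^sup>/\<^sup>2 \<Gamma>(s/2 + 1)\<close>. The function \<open>\<xi>'/\<xi>(1/2 + w)\<close> is odd and the kernel
  \<open>(z\<^sup>w - z\<^sup>-\<^sup>w) / sin(\<pi>w)\<close> is even and decays like \<open>exp(-(\<pi> - |arg z|) |Im w|)\<close>, so the residue theorem on
  \<open>|Re w| \<le> 3/4\<close>, truncated at heights where \<open>\<xi>'/\<xi>\<close> is polynomially bounded, turns twice the sum over the zeros into
  \<open>1/(2\<pi>i)\<close> times the integral of the product over \<open>Re w = 3/4\<close>. On this line \<open>\<xi>'/\<xi>(1/2 + w)\<close> is the sum of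
  \<open>- \<Sum>n. \<Lambda>(n) n\<^sup>-\<^sup>1\<^sup>/\<^sup>2\<^sup>-\<^sup>w\<close>, \<open>1/(w - 1/2)\<close>, \<open>- (ln \<pi>)/2\<close> and a digamma term. With \<open>T f y\<close> the integral of
  \<open>f(w) y\<^sup>w / sin(\<pi>w)\<close>, moving the line to the right by one gives \<open>T 1 y = y / (\<pi> (1 + y))\<close>, and rescaling \<open>y\<close> gives
  the two prime sums. The recurrence of the digamma function, with the line moved by two, gives a linear equation for the
  digamma term. The value of \<open>\<zeta>'/\<zeta>(1/2)\<close> follows from \<open>\<xi>'(1/2) = 0\<close>.
\<close>

section \<open>The zeta function to the right of \<open>Re s = -1\<close>\<close>

text \<open>\<open>riemann_zeta\<close> is given only by a choice operator, so nothing is known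
  about it until a continuation to the whole punctured plane has been built; this is why the
  functional equation precedes any statement about zeros. The abscissa 3/4 meets two demands: 1/2 +
  w must lie to the right of 1, where the Dirichlet series converges absolutely, and w must stay to
  the left of the kernel's pole at 1. On this line cos(2 pi Re w) = 0, which bounds the sine from
  below. The numerator of the kernel vanishes at w = 0, so inside the strip only zeros of zeta give
  residues. The decay rate pi - |arg z| is positive exactly on the slit plane; because the decay is
  exponential, crude linear and quadratic growth bounds suffice where logarithmic ones hold. The
  equation for the digamma term carries the factor y^2 - 1, so it does not determine the integral at
  y = 1. The point z = 1 is therefore treated separately: there the prime series cancel, every sine
  vanishes, and an identity between constants is left.\<close>

lemma of_real_powr_bound_norm:
  fixes s :: complex assumes "u > 0"
  shows "norm (of_real u powr s) = u powr Re s"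
  using assms by (simp add: norm_powr_real_powr)

text \<open>Integrating (u - A)(A + 1 - u) u^(-s-2) by parts twice produces this antiderivative.
  \<open>p1\<close>, \<open>p2\<close>, \<open>p3\<close> stand for u^(-s-1), u^(-s) and
  u^(1-s)/(1-s); keeping them abstract reduces the check to a polynomial identity.\<close>

lemma trap_deriv_aux:
  fixes p1 p2 p3 :: "complex \<Rightarrow> complex"
  assumes "(p1 has_field_derivative (- s - 1) * W) (at U)"
    "(p2 has_field_derivative - s * p1 U) (at U)" "(p3 has_field_derivative p2 U) (at U)"
  shows "((\<lambda>u. (u - A) * (A + 1 - u) / 2 * (- s * p1 u) - (2 * A + 1 - 2 * u) / 2 * p2 u - p3 u)
     has_field_derivative s * (s + 1) / 2 * ((U - A) * (A + 1 - U) * W)) (at U)"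
proof -
  have "((\<lambda>u. (u - A) * (A + 1 - u) / 2 * (- s * p1 u) - (2 * A + 1 - 2 * u) / 2 * p2 u - p3 u)
     has_field_derivative ((1 * (A + 1 - U) + (0 - 1) * (U - A)) / 2 * (- s * p1 U)
         + (- s * ((- s - 1) * W)) * ((U - A) * (A + 1 - U) / 2))
       - ((0 - 2) / 2 * p2 U + (- s * p1 U) * ((2 * A + 1 - 2 * U) / 2)) - p2 U) (at U)"
    by (intro DERIV_diff DERIV_mult DERIV_cdivide DERIV_cmult assms DERIV_ident DERIV_const)
       (auto intro!: derivative_eq_intros)
  thus ?thesis by (rule DERIV_cong) (simp add: field_simps)
qed

text \<open>This is the Peano form of the error of the trapezoidal rule on [a, a+1] applied to
  u^(-s). The second derivative is s (s + 1) u^(-s-2); the factor s (s + 1) / 2 is kept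
  outside.\<close>

definition trap_kernel :: "real \<Rightarrow> complex \<Rightarrow> complex" where
  "trap_kernel a s = integral {a..a+1} (\<lambda>u. of_real ((u - a) * (a + 1 - u)) * of_real u powr (- s - 2))"

lemma trap_kernel_eq:
  assumes "a > 0" "s \<noteq> 1"
  shows "s * (s + 1) / 2 * trap_kernel a s =
    (of_real a powr (-s) + of_real (a + 1) powr (-s)) / 2
    - (of_real (a + 1) powr (1 - s) - of_real a powr (1 - s)) / (1 - s)"
proof -
  define A where "A = complex_of_real a"
  define F where "F = (\<lambda>u. (u - A) * (A + 1 - u) / 2 * (- s * u powr (- s - 1))
      - (2 * A + 1 - 2 * u) / 2 * u powr (- s) - u powr (1 - s) / (1 - s))"
  have "((\<lambda>u. F (of_real u)) has_vector_derivative
           s * (s + 1) / 2 * (of_real ((u - a) * (a + 1 - u)) * of_real u powr (- s - 2))) (at u within {a..a+1})"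
    if "u \<in> {a..a+1}" for u
  proof -
    define U where "U = complex_of_real u"
    have U: "U \<notin> \<real>\<^sub>\<le>\<^sub>0" "U \<noteq> 0" using that assms unfolding U_def by auto
    have d1: "((\<lambda>u. u powr (-s-1)) has_field_derivative (-s-1) * U powr (-s-2)) (at U)"
      and d2: "((\<lambda>u. u powr (-s)) has_field_derivative -s * U powr (-s-1)) (at U)"
      using has_field_derivative_powr[OF U(1), of "-s-1"] has_field_derivative_powr[OF U(1), of "-s"]
      by (simp_all add: algebra_simps)
    have d3: "((\<lambda>u. u powr (1-s) / (1-s)) has_field_derivative U powr (-s)) (at U)"
      using DERIV_cdivide[OF has_field_derivative_powr[OF U(1), of "1-s"], of "1-s"] assms(2) by simp
    have "(F has_field_derivative s * (s + 1) / 2 * ((U - A) * (A + 1 - U) * U powr (- s - 2))) (at U)"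
      using trap_deriv_aux[OF d1 d2 d3, of A] unfolding F_def by (simp add: algebra_simps)
    from has_vector_derivative_real_field[OF this[unfolded U_def]] show ?thesis
      unfolding A_def by simp
  qed
  hence "((\<lambda>u. s * (s + 1) / 2 * (of_real ((u - a) * (a + 1 - u)) * of_real u powr (- s - 2)))
            has_integral F (of_real (a+1)) - F (of_real a)) {a..a+1}"
    by (intro fundamental_theorem_of_calculus) auto
  hence "integral {a..a+1} (\<lambda>u. s * (s + 1) / 2 * (of_real ((u - a) * (a + 1 - u)) * of_real u powr (- s - 2)))
       = F (of_real (a+1)) - F (of_real a)" by (rule integral_unique)
  also have "integral {a..a+1} (\<lambda>u. s * (s + 1) / 2 * (of_real ((u - a) * (a + 1 - u)) * of_real u powr (- s - 2)))
     = s * (s + 1) / 2 * trap_kernel a s"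
    unfolding trap_kernel_def by (rule integral_mult_right)
  also have "F (of_real (a+1)) - F (of_real a) =
     (of_real a powr (-s) + of_real (a + 1) powr (-s)) / 2
    - (of_real (a + 1) powr (1 - s) - of_real a powr (1 - s)) / (1 - s)"
    unfolding F_def A_def by (simp add: diff_divide_distrib)
  finally show ?thesis .
qed

lemma trap_kernel_integrable:
  "a > 0 \<Longrightarrow> (\<lambda>u. complex_of_real ((u - a) * (a + 1 - u)) * of_real u powr (- s - 2)) integrable_on {a..a+1}"
  unfolding cbox_interval[symmetric] by (intro integrable_continuous continuous_intros) auto

lemma trap_kernel_holomorphic:
  assumes "a > 0" shows "trap_kernel a holomorphic_on A"
proof -
  have "(\<lambda>s. integral (cbox a (a+1)) (\<lambda>u. of_real ((u - a) * (a + 1 - u)) * of_real u powr (- s - 2))) holomorphic_on UNIV"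
  proof (rule leibniz_rule_holomorphic)
    show "((\<lambda>s. of_real ((u - a) * (a + 1 - u)) * of_real u powr (- s - 2)) has_field_derivative
             of_real ((u - a) * (a + 1 - u)) * (- of_real (ln u) * of_real u powr (- s - 2))) (at s within UNIV)"
      if "u \<in> cbox a (a+1)" for s :: complex and u
    proof (rule DERIV_cmult)
      have "((\<lambda>s. exp ((- s - 2) * Ln (of_real u))) has_field_derivative
             exp ((- s - 2) * Ln (of_real u)) * (- Ln (of_real u))) (at s)"
        by (auto intro!: derivative_eq_intros)
      thus "((\<lambda>s. of_real u powr (- s - 2)) has_field_derivative
             - of_real (ln u) * of_real u powr (- s - 2)) (at s within UNIV)"
        using that assms by (simp add: powr_def Ln_of_real mult.commute)
    qed
    show "(\<lambda>u. complex_of_real ((u - a) * (a + 1 - u)) * of_real u powr (- s - 2)) integrable_on cbox a (a+1)" for s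
      using trap_kernel_integrable[OF assms] by simp
    show "continuous_on (UNIV \<times> cbox a (a + 1)) (\<lambda>(s, u). complex_of_real ((u - a) * (a + 1 - u)) * (- of_real (ln u) * of_real u powr (- s - 2)))"
      unfolding split_def by (intro continuous_intros) (use assms in \<open>auto simp: complex_nonpos_Reals_iff\<close>)
  qed auto
  thus ?thesis unfolding trap_kernel_def [abs_def] by (auto intro: holomorphic_on_subset)
qed

lemma trap_kernel_norm_le:
  assumes "a > 0" "Re s \<ge> -2"
  shows "norm (trap_kernel a s) \<le> a powr (- Re s - 2) / 4"
proof -
  have "norm (integral {a..a+1} (\<lambda>u. of_real ((u - a) * (a + 1 - u)) * of_real u powr (- s - 2)))
     \<le> (a powr (- Re s - 2) / 4) * (a + 1 - a)"
  proof (rule integral_bound)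
    fix u assume u: "u \<in> {a..a+1}"
    have "norm (complex_of_real ((u - a) * (a + 1 - u)) * of_real u powr (- s - 2))
       = (u - a) * (a + 1 - u) * u powr (- Re s - 2)"
      using u assms by (simp add: norm_mult of_real_powr_bound_norm del: of_real_mult of_real_diff)
    also have "\<dots> \<le> 1 / 4 * a powr (- Re s - 2)"
    proof (rule mult_mono)
      have "0 \<le> (u - a - 1/2)\<^sup>2" by simp
      thus "(u - a) * (a + 1 - u) \<le> 1 / 4" by (simp add: power2_eq_square algebra_simps)
      show "u powr (- Re s - 2) \<le> a powr (- Re s - 2)"
        using u assms by (intro powr_mono2') auto
    qed auto
    finally show "norm (complex_of_real ((u - a) * (a + 1 - u)) * of_real u powr (- s - 2)) \<le> a powr (- Re s - 2) / 4" by simp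
  next
    show "continuous_on {a..a+1} (\<lambda>u. complex_of_real ((u - a) * (a + 1 - u)) * of_real u powr (- s - 2))"
      using assms by (intro continuous_intros) auto
  qed (use assms in auto)
  thus ?thesis unfolding trap_kernel_def by simp
qed

text \<open>The kernels are O(n^(-Re s - 2)), two powers smaller than the terms n^(-s), so the sum
  converges for Re s > -1. This gain is what continues zeta to the left of Re s = 1.\<close>

definition zeta_tail :: "complex \<Rightarrow> complex" where
  "zeta_tail s = (\<Sum>n. trap_kernel (real (Suc n)) s)"

lemma summable_Suc_powr: "c > 1 \<Longrightarrow> summable (\<lambda>n. real (Suc n) powr (- c))"
  using summable_real_powr_iff[of "-c"] by (subst summable_Suc_iff) auto

lemma trap_kernel_summable:
  assumes "Re s > -1"
  shows "summable (\<lambda>n. norm (trap_kernel (real (Suc n)) s))"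
proof (rule summable_comparison_test')
  show "summable (\<lambda>n. real (Suc n) powr (- (Re s + 2)) / 4)"
    by (intro summable_divide summable_Suc_powr) (use assms in auto)
  show "norm (norm (trap_kernel (real (Suc n)) s)) \<le> real (Suc n) powr (- (Re s + 2)) / 4" if "n \<ge> 0" for n
    using trap_kernel_norm_le[of "real (Suc n)" s] assms by (simp add: algebra_simps)
qed

lemma zeta_tail_holomorphic: "zeta_tail holomorphic_on {s. Re s > -1}"
proof (rule holomorphic_uniform_sequence[where f = "\<lambda>N s. \<Sum>n<N. trap_kernel (real (Suc n)) s"])
  show "open {s. Re s > -1}" by (rule open_halfspace_Re_gt)
  show "(\<lambda>s. \<Sum>n<N. trap_kernel (real (Suc n)) s) holomorphic_on {s. Re s > -1}" for N
    by (intro holomorphic_intros trap_kernel_holomorphic) auto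
  fix x assume x: "x \<in> {s. Re s > -1}"
  \<comment> \<open>Half the distance to the edge Re s = -1: on the closed disc of this radius the
    terms are dominated uniformly by (n + 1)^(-(1 + d)).\<close>
  define d where "d = (Re x + 1) / 2"
  have d: "d > 0" using x by (simp add: d_def)
  have re: "Re y \<ge> -1 + d" if "y \<in> cball x d" for y
  proof -
    have "Re x - Re y \<le> d" using that abs_Re_le_cmod[of "x - y"] by (simp add: dist_norm)
    thus ?thesis by (simp add: d_def field_simps)
  qed
  have "uniform_limit (cball x d) (\<lambda>N s. \<Sum>n<N. trap_kernel (real (Suc n)) s) zeta_tail sequentially"
    unfolding zeta_tail_def [abs_def]
  proof (rule Weierstrass_m_test)
    show "summable (\<lambda>n. real (Suc n) powr (- (1 + d)))" using d by (intro summable_Suc_powr) auto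
    show "norm (trap_kernel (real (Suc n)) y) \<le> real (Suc n) powr (- (1 + d))" if "y \<in> cball x d" for n y
    proof -
      have "norm (trap_kernel (real (Suc n)) y) \<le> real (Suc n) powr (- Re y - 2) / 4"
        using re[OF that] d by (intro trap_kernel_norm_le) auto
      also have "\<dots> \<le> real (Suc n) powr (- Re y - 2)" by simp
      also have "\<dots> \<le> real (Suc n) powr (- (1 + d))" using re[OF that] by (intro powr_mono) auto
      finally show ?thesis .
    qed
  qed
  moreover have "cball x d \<subseteq> {s. Re s > -1}" using re d by force
  ultimately show "\<exists>d>0. cball x d \<subseteq> {s. Re s > -1} \<and> uniform_limit (cball x d) (\<lambda>N s. \<Sum>n<N. trap_kernel (real (Suc n)) s) zeta_tail sequentially"
    using d by blast
qed

text \<open>\<open>zeta_aux s\<close> is \<open>(s - 1) \<zeta>(s)\<close>, by the trapezoidal rule for \<open>\<Sum>n. n powr (-s)\<close>.\<close>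

definition zeta_aux :: "complex \<Rightarrow> complex" where
  "zeta_aux s = 1 + (s - 1) / 2 + (s - 1) * (s * (s + 1) / 2 * zeta_tail s)"

lemma zeta_aux_holomorphic: "zeta_aux holomorphic_on {s. Re s > -1}"
  unfolding zeta_aux_def [abs_def] by (intro holomorphic_intros zeta_tail_holomorphic) auto

lemma zeta_tail_norm_le: "Re s \<ge> 0 \<Longrightarrow> norm (zeta_tail s) \<le> (\<Sum>n. real (Suc n) powr (-2)) / 4"
  for s
proof -
  assume s: "Re s \<ge> 0"
  have "norm (zeta_tail s) \<le> (\<Sum>n. norm (trap_kernel (real (Suc n)) s))"
    unfolding zeta_tail_def using s by (intro summable_norm trap_kernel_summable) auto
  also have "\<dots> \<le> (\<Sum>n. real (Suc n) powr (-2) / 4)"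
  proof (intro suminf_le)
    show "norm (trap_kernel (real (Suc n)) s) \<le> real (Suc n) powr (-2) / 4" for n
    proof -
      have "norm (trap_kernel (real (Suc n)) s) \<le> real (Suc n) powr (- Re s - 2) / 4"
        using s by (intro trap_kernel_norm_le) auto
      also have "\<dots> \<le> real (Suc n) powr (- 2) / 4" using s by (intro divide_right_mono powr_mono) auto
      finally show ?thesis .
    qed
    show "summable (\<lambda>n. real (Suc n) powr (-2) / 4)" by (intro summable_divide summable_Suc_powr) auto
    show "summable (\<lambda>n. norm (trap_kernel (real (Suc n)) s))" using s by (intro trap_kernel_summable) auto
  qed
  also have "\<dots> = (\<Sum>n. real (Suc n) powr (-2)) / 4"
    using summable_Suc_powr[of 2] by (simp add: suminf_divide)
  finally show ?thesis .
qed

text \<open>The sum is pi^2/6, about 1.645. The rational bound 7/4 feeds three later constants: 7/16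
  for \<open>zeta_tail\<close>, 3/4 for |zeta(s) - 1| when Re s \<ge> 2, and 14, which is 8 times
  7/4, for the digamma function.\<close>

lemma sum_inverse_squares_le: "(\<Sum>n. real (Suc n) powr (-2)) < 7 / 4"
proof -
  have "(\<lambda>n. 1 / (real n + 1)\<^sup>2) sums (pi\<^sup>2 / 6)" using inverse_squares_sums by (simp add: add.commute)
  hence "(\<lambda>n. real (Suc n) powr (-2)) sums (pi\<^sup>2 / 6)"
    by (rule sums_cong[THEN iffD1, rotated]) (auto simp: powr_minus powr_numeral field_simps)
  hence eq: "(\<Sum>n. real (Suc n) powr (-2)) = pi\<^sup>2 / 6" by (simp add: sums_iff)
  have "pi < 3.2" using pi_approx by simp
  hence "pi * pi < 3.2 * 3.2" using pi_gt_zero by (intro mult_strict_mono) auto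
  thus ?thesis unfolding eq by (simp add: power2_eq_square)
qed

lemma zeta_tail_norm_less: "Re s \<ge> 0 \<Longrightarrow> norm (zeta_tail s) < 7 / 16"
  using zeta_tail_norm_le[of s] sum_inverse_squares_le by simp

lemma zeta_aux_1 [simp]: "zeta_aux 1 = 1"
  by (simp add: zeta_aux_def)

text \<open>The elementary part of \<open>zeta_aux\<close> is (1 + x)/2 and the tail contributes at
  most 7x/16, so the real part stays positive. Hence no zero in the critical strip is real, and the
  zeros split into upper and lower ones.\<close>

lemma zeta_aux_nonzero_real:
  assumes "0 \<le> x" "x \<le> 1"
  shows "zeta_aux (of_real x) \<noteq> 0"
proof -
  define s where "s = complex_of_real x"
  define E where "E = (s - 1) * (s * (s + 1) / 2 * zeta_tail s)"
  have m: "\<bar>x - 1\<bar> * (x * (x + 1) / 2 * norm (zeta_tail s)) \<le> 1 * (x / 1 * (7/16))"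
  proof (intro mult_mono)
    have "x * (x + 1) \<le> x * 2" using assms by (intro mult_left_mono) auto
    thus "x * (x + 1) / 2 \<le> x / 1" by simp
    show "norm (zeta_tail s) \<le> 7/16" using zeta_tail_norm_less[of s] assms by (simp add: s_def)
  qed (use assms in auto)
  have "norm E = norm (complex_of_real (x-1)) * (norm (complex_of_real x) * norm (complex_of_real (x + 1)) / 2 * norm (zeta_tail s))"
    unfolding E_def s_def by (simp add: norm_mult norm_divide)
  also have "\<dots> = \<bar>x - 1\<bar> * (x * (x + 1) / 2 * norm (zeta_tail s))"
    using assms unfolding norm_of_real by simp
  also have "\<dots> \<le> 7 / 16 * x" using m by simp
  finally have 1: "\<bar>Re E\<bar> \<le> 7 / 16 * x" using abs_Re_le_cmod[of E] by linarith
  have "Re (zeta_aux s) = 1 + (x - 1) / 2 + Re E"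
    unfolding zeta_aux_def E_def[symmetric] by (simp add: s_def)
  hence "Re (zeta_aux s) > 0" using 1 assms by (simp add: field_simps abs_le_iff)
  thus ?thesis unfolding s_def by force
qed

lemma of_nat_powr_tendsto_0:
  assumes "Re s < 0"
  shows "(\<lambda>N. complex_of_real (real (Suc N)) powr s) \<longlonglongrightarrow> 0"
proof (rule tendsto_norm_zero_cancel)
  have "(\<lambda>N. real N powr Re s) \<longlonglongrightarrow> 0" using assms by (intro tendsto_neg_powr filterlim_real_sequentially)
  hence "(\<lambda>N. real (Suc N) powr Re s) \<longlonglongrightarrow> 0" by (rule LIMSEQ_Suc)
  thus "(\<lambda>N. norm (complex_of_real (real (Suc N)) powr s)) \<longlonglongrightarrow> 0"
    by (subst of_real_powr_bound_norm) auto
qed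

lemma summable_norm_dirichlet:
  assumes "Re s > 1"
  shows "summable (\<lambda>n. norm (of_nat (Suc n) powr (- s) :: complex))"
proof -
  have "norm (of_nat (Suc n) powr (- s) :: complex) = real (Suc n) powr (- Re s)" for n
    using of_real_powr_bound_norm[of "real (Suc n)" "-s"] by simp
  thus ?thesis using summable_Suc_powr[of "Re s"] assms by simp
qed

text \<open>Summed over n, the trapezoidal values give the Dirichlet series minus half its first
  term, and the exact integrals telescope to 1/(s - 1).\<close>

lemma zeta_aux_dirichlet:
  assumes "Re s > 1"
  shows "zeta_aux s = (s - 1) * (\<Sum>n. of_nat (Suc n) powr (- s))"
proof -
  have s1: "s \<noteq> 1" using assms by auto
  define f where "f = (\<lambda>n. complex_of_real (real (Suc n)) powr (- s))"
  define g where "g = (\<lambda>n. complex_of_real (real (Suc n)) powr (1 - s))"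
  have f: "f sums (\<Sum>n. f n)"
    using summable_norm_cancel[OF summable_norm_dirichlet[OF assms]] unfolding f_def
    by (simp add: summable_sums)
  have f1: "(\<lambda>n. f (Suc n)) sums ((\<Sum>n. f n) - f 0)" using f by (subst sums_Suc_iff) simp
  have g: "(\<lambda>n. g (Suc n) - g n) sums (0 - g 0)"
    unfolding g_def by (intro telescope_sums of_nat_powr_tendsto_0) (use assms in auto)
  have 1: "(\<lambda>n. (f n + f (Suc n)) / 2 - (g (Suc n) - g n) / (1 - s)) sums
      (((\<Sum>n. f n) + ((\<Sum>n. f n) - f 0)) / 2 - (0 - g 0) / (1 - s))"
    by (intro sums_diff sums_divide sums_add f f1 g)
  have "trap_kernel (real (Suc n)) s * (s * (s + 1) / 2) = (f n + f (Suc n)) / 2 - (g (Suc n) - g n) / (1 - s)" for n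
    using trap_kernel_eq[of "real (Suc n)" s] s1 by (simp add: f_def g_def add_ac mult.commute)
  with 1 have 2: "(\<lambda>n. trap_kernel (real (Suc n)) s * (s * (s + 1) / 2)) sums
      (((\<Sum>n. f n) + ((\<Sum>n. f n) - f 0)) / 2 - (0 - g 0) / (1 - s))" by (simp only:)
  have "(\<lambda>n. trap_kernel (real (Suc n)) s) sums zeta_tail s" unfolding zeta_tail_def
    using summable_norm_cancel[OF trap_kernel_summable[of s]] assms by (simp add: summable_sums)
  hence "(\<lambda>n. trap_kernel (real (Suc n)) s * (s * (s + 1) / 2)) sums (zeta_tail s * (s * (s + 1) / 2))"
    by (rule sums_mult2)
  from sums_unique2[OF this 2] have 3: "s * (s + 1) / 2 * zeta_tail s = ((\<Sum>n. f n) + ((\<Sum>n. f n) - f 0)) / 2 - (0 - g 0) / (1 - s)"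
    by (simp only: mult.commute)
  have 4: "(s - 1) * (1 / (1 - s)) = -1" using s1 by (simp add: divide_simps)
  have "((\<Sum>n. f n) + ((\<Sum>n. f n) - f 0)) / 2 - (0 - g 0) / (1 - s) = (\<Sum>n. f n) - 1 / 2 + 1 / (1 - s)"
    by (simp add: f_def g_def add_divide_distrib diff_divide_distrib)
  hence "zeta_aux s = 1 + (s - 1) / 2 + (s - 1) * ((\<Sum>n. f n) - 1 / 2 + 1 / (1 - s))"
    unfolding zeta_aux_def 3 by simp
  also have "\<dots> = 1 + (s - 1) / 2 + ((s - 1) * (\<Sum>n. f n) - (s - 1) / 2 + (s - 1) * (1 / (1 - s)))"
    by (simp add: algebra_simps)
  also have "\<dots> = (s - 1) * (\<Sum>n. f n)" unfolding 4 by simp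
  finally have "zeta_aux s = (s - 1) * (\<Sum>n. f n)" .
  thus ?thesis by (simp add: f_def)
qed

section \<open>The functional equation\<close>

text \<open>Logarithmic differentiation of Gamma(z) Gamma(1 - z) sin(pi z) = pi: the product is
  constant off the integers, so the derivative given by the product rule must be zero.\<close>

lemma Digamma_reflection:
  fixes z :: complex assumes "z \<notin> \<int>"
  shows "Digamma (1 - z) - Digamma z = of_real pi * cot (of_real pi * z)"
proof -
  define f where "f = (\<lambda>z::complex. Gamma z * Gamma (1 - z) * sin (of_real pi * z))"
  have z': "1 - z \<notin> \<int>" using assms by (metis Ints_1 Ints_diff diff_diff_eq2 add_diff_cancel_left')
  have nz: "sin (of_real pi * u) \<noteq> 0" if "u \<notin> \<int>" for u :: complex
    using that by (auto simp: sin_eq_0 Ints_def)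
  have "(f has_field_derivative
     ((Gamma z * Digamma z) * Gamma (1 - z) - Gamma z * (Gamma (1 - z) * Digamma (1 - z))) * sin (of_real pi * z)
       + Gamma z * Gamma (1 - z) * (of_real pi * cos (of_real pi * z))) (at z)"
    unfolding f_def using assms z'
    by (auto intro!: derivative_eq_intros dest: not_in_Ints_imp_not_in_nonpos_Ints simp: algebra_simps)
  moreover have "(f has_field_derivative 0) (at z)"
  proof (rule has_field_derivative_transform_within_open)
    show "((\<lambda>_. of_real pi) has_field_derivative 0) (at z)" by simp
    show "open (- \<int> :: complex set)" by (simp add: closed_Ints open_Compl)
    show "of_real pi = f u" if "u \<in> - \<int>" for u
      using that nz[of u] Gamma_reflection_complex[of u] by (simp add: f_def)
  qed (use assms in auto)
  ultimately have *: "((Gamma z * Digamma z) * Gamma (1 - z) - Gamma z * (Gamma (1 - z) * Digamma (1 - z))) * sin (of_real pi * z)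
       + Gamma z * Gamma (1 - z) * (of_real pi * cos (of_real pi * z)) = 0"
    by (rule DERIV_unique)
  define G where "G = Gamma z * Gamma (1 - z)"
  have "G \<noteq> 0" using assms z' unfolding G_def
    by (auto simp: Gamma_eq_zero_iff dest: not_in_Ints_imp_not_in_nonpos_Ints)
  moreover have "G * ((Digamma z - Digamma (1 - z)) * sin (of_real pi * z) + of_real pi * cos (of_real pi * z)) = 0"
    using * by (simp add: G_def algebra_simps)
  ultimately have "(Digamma z - Digamma (1 - z)) * sin (of_real pi * z) + of_real pi * cos (of_real pi * z) = 0" by simp
  thus ?thesis using nz[OF assms] by (simp add: cot_def field_simps)
qed

lemma cot_imag:
  assumes "x > (0::real)"
  shows "cot (\<i> * of_real x / 2) = - \<i> * of_real ((1 + exp (-x)) / (1 - exp (-x)))"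
proof -
  define p where "p = exp (- x / 2)"
  have p: "p > 0" "p < 1" using assms by (auto simp: p_def)
  have q: "exp (-x) = p\<^sup>2" by (simp add: p_def power2_eq_square flip: exp_add)
  have e: "exp (\<i> * (\<i> * of_real x / 2)) = of_real p" "exp (- (\<i> * (\<i> * of_real x / 2))) = of_real (inverse p)"
  proof -
    have a: "\<i> * (\<i> * of_real x / 2) = complex_of_real (- x / 2)" by simp
    show "exp (\<i> * (\<i> * of_real x / 2)) = of_real p" unfolding a p_def by (rule exp_of_real)
    thus "exp (- (\<i> * (\<i> * of_real x / 2))) = of_real (inverse p)" by (simp only: exp_minus of_real_inverse)
  qed
  have "p\<^sup>2 < 1" using p by (simp add: power_less_one_iff)
  have "sin (\<i> * of_real x / 2) = (of_real p - of_real (inverse p)) / (2 * \<i>)"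
       "cos (\<i> * of_real x / 2) = (of_real p + of_real (inverse p)) / 2"
    unfolding sin_exp_eq cos_exp_eq e by simp_all
  hence "cot (\<i> * of_real x / 2) = ((of_real p + of_real (inverse p)) / 2) / ((of_real p - of_real (inverse p)) / (2 * \<i>))"
    by (simp only: cot_def)
  also have "\<dots> = \<i> * ((of_real p + of_real (inverse p)) / (of_real p - of_real (inverse p)))"
    by (simp only: divide_divide_eq_right divide_divide_eq_left) simp
  also have "\<dots> = \<i> * of_real ((p + inverse p) / (p - inverse p))"
    by (simp only: of_real_divide of_real_add of_real_diff)
  also have "(p + inverse p) / (p - inverse p) = - ((1 + p\<^sup>2) / (1 - p\<^sup>2))"
    using p \<open>p\<^sup>2 < 1\<close> by (auto simp: divide_simps power2_eq_square) (auto simp: algebra_simps)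
  finally show ?thesis by (simp add: q)
qed

text \<open>Digamma reflection at w = i x / (2 pi) turns a difference of two digamma series into
  coth(x/2). The right-hand side is the Laplace transform on the positive axis of the 1-periodic
  extension of u (1 - u): the integral over one period divided by 1 - exp(-x).\<close>

lemma coth_partial_fractions:
  assumes x: "x > (0::real)"
  shows "(\<lambda>k. 4 / (x * ((2 * pi * real (Suc k))\<^sup>2 + x\<^sup>2))) sums
           ((x - 2 + (x + 2) * exp (-x)) / (x ^ 3 * (1 - exp (-x))))"
proof -
  define w where "w = \<i> * complex_of_real (x / (2 * pi))"
  have w: "w \<notin> \<int>" using x by (auto simp: w_def elim!: Ints_cases simp: complex_eq_iff)
  have w0: "w \<noteq> 0" using w by auto
  have w1: "1 + w \<noteq> 0" "1 - w \<noteq> 0" using x by (auto simp: w_def complex_eq_iff)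
  have "(\<lambda>k. (inverse (of_nat (Suc k)) - inverse (1 + w + of_nat k)) - (inverse (of_nat (Suc k)) - inverse (1 - w + of_nat k)))
          sums ((Digamma (1 + w) + euler_mascheroni) - (Digamma (1 - w) + euler_mascheroni))"
    using summable_Digamma[OF w1(1)] summable_Digamma[OF w1(2)]
    by (intro sums_diff) (simp_all add: Digamma_def summable_sums)
  also have "(Digamma (1 + w) + euler_mascheroni) - (Digamma (1 - w) + euler_mascheroni) = 1 / w - of_real pi * cot (of_real pi * w)"
    using Digamma_reflection[OF w] Digamma_plus1[OF w0] by (simp add: add.commute algebra_simps)
  also have "of_real pi * w = \<i> * of_real x / 2" by (simp add: w_def)
  also have "1 / w - of_real pi * cot (\<i> * of_real x / 2) =
       \<i> * of_real (pi * (1 + exp (-x)) / (1 - exp (-x)) - 2 * pi / x)"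
    unfolding cot_imag[OF x] w_def using x by (simp add: field_simps)
  also have "(\<lambda>k. (inverse (of_nat (Suc k)) - inverse (1 + w + of_nat k)) - (inverse (of_nat (Suc k)) - inverse (1 - w + of_nat k)))
       = (\<lambda>k. \<i> * of_real (4 * pi * x / ((2 * pi * real (Suc k))\<^sup>2 + x\<^sup>2)))"
  proof
    fix k
    define N where "N = complex_of_nat (Suc k)"
    define D where "D = (2 * pi * real (Suc k))\<^sup>2 + x\<^sup>2"
    have D: "D > 0" unfolding D_def using x by (intro add_nonneg_pos) auto
    have n1: "N + w \<noteq> 0" "N - w \<noteq> 0" using x by (auto simp: w_def N_def complex_eq_iff)
    have p: "(N + w) * (N - w) = of_real (D / (2 * pi)\<^sup>2)"
    proof -
      have "(N + w) * (N - w) = N\<^sup>2 - w\<^sup>2" by (simp add: power2_eq_square algebra_simps)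
      also have "\<dots> = of_real ((real (Suc k))\<^sup>2 + (x / (2 * pi))\<^sup>2)"
      proof -
        have "w\<^sup>2 = - of_real ((x / (2 * pi))\<^sup>2)" by (simp only: w_def power_mult_distrib) simp
        thus ?thesis by (simp add: N_def)
      qed
      also have "(real (Suc k))\<^sup>2 + (x / (2 * pi))\<^sup>2 = D / (2 * pi)\<^sup>2" unfolding D_def
        by (simp add: add_divide_distrib power_divide power_mult_distrib)
      finally show ?thesis .
    qed
    have "(inverse (of_nat (Suc k)) - inverse (1 + w + of_nat k)) - (inverse (of_nat (Suc k)) - inverse (1 - w + of_nat k))
       = inverse (N - w) - inverse (N + w)" by (simp add: N_def algebra_simps)
    also have "\<dots> = 2 * w / ((N + w) * (N - w))" using n1 by (simp add: field_simps)
    also have "\<dots> = \<i> * of_real (4 * pi * x / D)" unfolding p using D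
      by (simp add: w_def field_simps power2_eq_square)
    finally show "(inverse (of_nat (Suc k)) - inverse (1 + w + of_nat k)) - (inverse (of_nat (Suc k)) - inverse (1 - w + of_nat k))
       = \<i> * of_real (4 * pi * x / ((2 * pi * real (Suc k))\<^sup>2 + x\<^sup>2))" by (simp add: D_def)
  qed
  finally have "(\<lambda>k. Im (\<i> * of_real (4 * pi * x / ((2 * pi * real (Suc k))\<^sup>2 + x\<^sup>2)))) sums
     Im (\<i> * of_real (pi * (1 + exp (-x)) / (1 - exp (-x)) - 2 * pi / x))" by (rule sums_Im)
  hence "(\<lambda>k. 4 * pi * x / ((2 * pi * real (Suc k))\<^sup>2 + x\<^sup>2)) sums (pi * (1 + exp (-x)) / (1 - exp (-x)) - 2 * pi / x)"
    by (simp only: Im_i_times Re_complex_of_real)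
  hence "(\<lambda>k. 4 * pi * x / ((2 * pi * real (Suc k))\<^sup>2 + x\<^sup>2) * (1 / (pi * x\<^sup>2))) sums ((pi * (1 + exp (-x)) / (1 - exp (-x)) - 2 * pi / x) * (1 / (pi * x\<^sup>2)))"
    by (rule sums_mult2)
  also have "(\<lambda>k. 4 * pi * x / ((2 * pi * real (Suc k))\<^sup>2 + x\<^sup>2) * (1 / (pi * x\<^sup>2))) = (\<lambda>k. 4 / (x * ((2 * pi * real (Suc k))\<^sup>2 + x\<^sup>2)))"
  proof
    fix k
    define D where "D = (2 * pi * real (Suc k))\<^sup>2 + x\<^sup>2"
    have D: "D > 0" unfolding D_def using x by (intro add_nonneg_pos) auto
    have "4 * pi * x / D * (1 / (pi * x\<^sup>2)) = 4 / (x * D)" using D x by (simp add: field_simps power2_eq_square)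
    thus "4 * pi * x / ((2 * pi * real (Suc k))\<^sup>2 + x\<^sup>2) * (1 / (pi * x\<^sup>2)) = 4 / (x * ((2 * pi * real (Suc k))\<^sup>2 + x\<^sup>2))"
      by (simp add: D_def)
  qed
  also have "(pi * (1 + exp (-x)) / (1 - exp (-x)) - 2 * pi / x) * (1 / (pi * x\<^sup>2)) =
     (x - 2 + (x + 2) * exp (-x)) / (x ^ 3 * (1 - exp (-x)))"
  proof -
    define q where "q = exp (-x)"
    have q: "q < 1" using x by (simp add: q_def)
    have "(pi * (1 + q) / (1 - q) - 2 * pi / x) * (1 / (pi * x\<^sup>2)) = (x - 2 + (x + 2) * q) / (x ^ 3 * (1 - q))"
      using q x by (simp add: divide_simps power2_eq_square power3_eq_cube) (simp add: algebra_simps)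
    thus ?thesis by (simp add: q_def)
  qed
  finally show ?thesis .
qed

section \<open>Gamma integrals and the Mellin transform of 1/(a^2 + x^2)\<close>

lemma nn_integral_Gamma:
  fixes r p :: real assumes "r > 0" "p > 0"
  shows "(\<integral>\<^sup>+x. ennreal (indicator {0<..} x * (x powr (r - 1) * exp (- p * x))) \<partial>lborel) = ennreal (Gamma r * p powr (- r))"
proof -
  have "ennreal (Gamma r) = \<integral>\<^sup>+t. ennreal (indicator {0..} t * t powr (r - 1) / exp t) \<partial>lborel"
    using Gamma_conv_nn_integral_real[OF assms(1)] .
  also have "\<dots> = ennreal \<bar>p\<bar> * (\<integral>\<^sup>+x. ennreal (indicator {0..} (0 + p * x) * (0 + p * x) powr (r - 1) / exp (0 + p * x)) \<partial>lborel)"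
    using assms by (intro nn_integral_real_affine) auto
  also have "(\<integral>\<^sup>+x. ennreal (indicator {0..} (0 + p * x) * (0 + p * x) powr (r - 1) / exp (0 + p * x)) \<partial>lborel)
     = (\<integral>\<^sup>+x. ennreal (p powr (r - 1)) * ennreal (indicator {0<..} x * (x powr (r - 1) * exp (- p * x))) \<partial>lborel)"
    using assms by (intro nn_integral_cong)
      (auto simp: indicator_def powr_mult exp_minus field_simps zero_le_mult_iff simp flip: ennreal_mult)
  also have "\<dots> = ennreal (p powr (r - 1)) * (\<integral>\<^sup>+x. ennreal (indicator {0<..} x * (x powr (r - 1) * exp (- p * x))) \<partial>lborel)"
    by (rule nn_integral_cmult) auto
  also have "ennreal \<bar>p\<bar> * \<dots> = ennreal (p powr r) * (\<integral>\<^sup>+x. ennreal (indicator {0<..} x * (x powr (r - 1) * exp (- p * x))) \<partial>lborel)"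
  proof -
    have "ennreal \<bar>p\<bar> * ennreal (p powr (r - 1)) = ennreal (p powr r)"
      using assms by (simp add: powr_diff flip: ennreal_mult)
    thus ?thesis by (simp flip: mult.assoc)
  qed
  finally have *: "ennreal (Gamma r) = ennreal (p powr r) * (\<integral>\<^sup>+x. ennreal (indicator {0<..} x * (x powr (r - 1) * exp (- p * x))) \<partial>lborel)" .
  have "ennreal (Gamma r * p powr (- r)) = ennreal (p powr (-r)) * ennreal (Gamma r)"
    using Gamma_real_pos[OF assms(1)] by (simp add: mult.commute flip: ennreal_mult)
  also have "\<dots> = ennreal (p powr (-r)) * ennreal (p powr r) * (\<integral>\<^sup>+x. ennreal (indicator {0<..} x * (x powr (r - 1) * exp (- p * x))) \<partial>lborel)"
    unfolding * by (simp add: mult.assoc)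
  also have "ennreal (p powr (-r)) * ennreal (p powr r) = 1"
    using assms by (simp flip: ennreal_mult powr_add)
  finally show ?thesis by simp
qed

lemma has_integral_Gamma_scaled:
  fixes r p :: real assumes "r > 0" "p > 0"
  shows "((\<lambda>x. x powr (r - 1) * exp (- p * x)) has_integral (Gamma r * p powr (- r))) {0<..}"
proof -
  have "((\<lambda>x. indicator {0<..} x * (x powr (r - 1) * exp (- p * x))) has_integral (Gamma r * p powr (- r))) UNIV"
    using assms Gamma_real_pos[OF assms(1)] by (intro nn_integral_has_integral nn_integral_Gamma) auto
  also have "(\<lambda>x. indicator {0<..} x * (x powr (r - 1) * exp (- p * x))) = (\<lambda>x. if x \<in> {0<..} then x powr (r - 1) * exp (- p * x) else 0)"
    by (auto simp: indicator_def)
  finally show ?thesis by (simp only: has_integral_restrict_UNIV)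
qed

text \<open>The substitution u = x^2 in the Gamma integral: u^(r-1) du = 2 x^(2r-1) dx, whence the
  exponent and the factor 1/2.\<close>

lemma nn_integral_Gamma_square:
  fixes r p :: real assumes "r > 0" "p > 0"
  shows "(\<integral>\<^sup>+x. ennreal (indicator {0<..} x * (x powr (2 * r - 1) * exp (- p * x\<^sup>2))) \<partial>lborel) = ennreal (Gamma r * p powr (- r) / 2)"
proof -
  define f where "f = (\<lambda>x. x powr (r - 1) * exp (- p * x))"
  have img: "(\<lambda>x. x\<^sup>2) ` {0<..} = {0::real<..}"
  proof (intro equalityI subsetI)
    fix x :: real assume "x \<in> {0<..}"
    thus "x \<in> (\<lambda>x. x\<^sup>2) ` {0<..}" by (intro image_eqI[of _ _ "sqrt x"]) auto
  qed auto
  have 1: "f absolutely_integrable_on {0<..} \<and> integral {0<..} f = Gamma r * p powr (- r)"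
    using has_integral_Gamma_scaled[OF assms] unfolding f_def
    by (auto intro!: nonnegative_absolutely_integrable_1 simp: has_integral_iff)
  have "((\<lambda>x. \<bar>2 * x\<bar> * f (x\<^sup>2)) absolutely_integrable_on {0<..} \<and> integral {0<..} (\<lambda>x. \<bar>2 * x\<bar> * f (x\<^sup>2)) = Gamma r * p powr (- r))
     \<longleftrightarrow> f absolutely_integrable_on ((\<lambda>x. x\<^sup>2) ` {0<..}) \<and> integral ((\<lambda>x. x\<^sup>2) ` {0<..}) f = Gamma r * p powr (- r)"
    by (intro has_absolute_integral_change_of_variables_1')
       (auto intro!: derivative_eq_intros inj_onI simp: power2_eq_iff)
  with 1 have "(\<lambda>x. \<bar>2 * x\<bar> * f (x\<^sup>2)) absolutely_integrable_on {0<..} \<and> integral {0<..} (\<lambda>x. \<bar>2 * x\<bar> * f (x\<^sup>2)) = Gamma r * p powr (- r)"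
    unfolding img by blast
  hence "((\<lambda>x. \<bar>2 * x\<bar> * f (x\<^sup>2)) has_integral Gamma r * p powr (- r)) {0<..}"
    by (auto simp: has_integral_iff set_lebesgue_integral_eq_integral(1))
  hence "((\<lambda>x. \<bar>2 * x\<bar> * f (x\<^sup>2) / 2) has_integral Gamma r * p powr (- r) / 2) {0<..}"
    by (rule has_integral_divide)
  moreover have "\<bar>2 * x\<bar> * f (x\<^sup>2) / 2 = x powr (2 * r - 1) * exp (- p * x\<^sup>2)" if "x \<in> {0<..}" for x
  proof -
    have "x powr (2 * r - 1) = x powr (1 + 2 * (r - 1))" by (simp add: algebra_simps)
    also have "\<dots> = x * (x powr 2) powr (r - 1)" using that by (simp only: powr_add powr_powr) simp
    also have "x powr 2 = x\<^sup>2" using that by (simp add: powr_numeral)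
    finally show ?thesis using that by (simp add: f_def)
  qed
  ultimately have "((\<lambda>x. x powr (2 * r - 1) * exp (- p * x\<^sup>2)) has_integral Gamma r * p powr (- r) / 2) {0<..}"
    by (rule has_integral_eq[rotated])
  from nn_integral_has_integral_lebesgue[OF _ this] show ?thesis by simp
qed

text \<open>Writing 1/(a^2 + x^2) as the integral of exp(-(a^2 + x^2) y) over y > 0 and exchanging
  the integrals leaves two Gamma integrals. Their product is left unreduced: in the functional
  equation one factor cancels and the other belongs to the reflected side.\<close>

lemma nn_integral_powr_div_squares:
  fixes a s :: real assumes "a > 0" "-1 < s" "s < 1"
  shows "(\<integral>\<^sup>+x. ennreal (indicator {0<..} x * (x powr s / (a\<^sup>2 + x\<^sup>2))) \<partial>lborel) =
           ennreal (Gamma ((1 + s) / 2) * Gamma ((1 - s) / 2) * a powr (s - 1) / 2)"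
proof -
  define f where "f = (\<lambda>x y. ennreal (indicator {0<..} x * (indicator {0<..} y * (x powr s * exp (- (a\<^sup>2 + x\<^sup>2) * y)))))"
  have [measurable]: "case_prod f \<in> borel_measurable (lborel \<Otimes>\<^sub>M lborel)" unfolding f_def by measurable
  have "(\<integral>\<^sup>+x. ennreal (indicator {0<..} x * (x powr s / (a\<^sup>2 + x\<^sup>2))) \<partial>lborel) = (\<integral>\<^sup>+x. \<integral>\<^sup>+y. f x y \<partial>lborel \<partial>lborel)"
  proof (intro nn_integral_cong)
    fix x :: real
    have pos: "a\<^sup>2 + x\<^sup>2 > 0" using assms by (intro add_pos_nonneg) auto
    have "(\<integral>\<^sup>+y. f x y \<partial>lborel) = (\<integral>\<^sup>+y. ennreal (indicator {0<..} x * x powr s) *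
            ennreal (indicator {0<..} y * (y powr (1 - 1) * exp (- (a\<^sup>2 + x\<^sup>2) * y))) \<partial>lborel)"
      unfolding f_def by (intro nn_integral_cong) (auto simp: indicator_def simp flip: ennreal_mult)
    also have "\<dots> = ennreal (indicator {0<..} x * x powr s) * ennreal (Gamma 1 * (a\<^sup>2 + x\<^sup>2) powr (-1))"
      by (subst nn_integral_cmult) (use nn_integral_Gamma[OF _ pos, of 1] in auto)
    also have "\<dots> = ennreal (indicator {0<..} x * (x powr s / (a\<^sup>2 + x\<^sup>2)))"
      using pos by (simp add: powr_minus_divide flip: ennreal_mult)
    finally show "ennreal (indicator {0<..} x * (x powr s / (a\<^sup>2 + x\<^sup>2))) = (\<integral>\<^sup>+y. f x y \<partial>lborel)" by simp
  qed
  also have "\<dots> = (\<integral>\<^sup>+y. \<integral>\<^sup>+x. f x y \<partial>lborel \<partial>lborel)"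
    by (rule lborel_pair.Fubini'[symmetric]) simp
  also have "\<dots> = (\<integral>\<^sup>+y. ennreal (Gamma ((1 + s) / 2) / 2) * ennreal (indicator {0<..} y * (y powr ((1 - s) / 2 - 1) * exp (- a\<^sup>2 * y))) \<partial>lborel)"
  proof (intro nn_integral_cong)
    fix y :: real
    show "(\<integral>\<^sup>+x. f x y \<partial>lborel) = ennreal (Gamma ((1 + s) / 2) / 2) * ennreal (indicator {0<..} y * (y powr ((1 - s) / 2 - 1) * exp (- a\<^sup>2 * y)))"
    proof (cases "y > 0")
      case True
      have G: "Gamma ((1 + s) / 2) > 0" using assms by (intro Gamma_real_pos) auto
      have "(\<integral>\<^sup>+x. f x y \<partial>lborel) = (\<integral>\<^sup>+x. ennreal (exp (- a\<^sup>2 * y)) *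
            ennreal (indicator {0<..} x * (x powr (2 * ((1 + s) / 2) - 1) * exp (- y * x\<^sup>2))) \<partial>lborel)"
        unfolding f_def using True
      proof (intro nn_integral_cong)
        fix x :: real
        have a: "2 * ((1 + s) / 2) - 1 = s" by (simp add: field_simps)
        have b: "exp (- (a\<^sup>2 + x\<^sup>2) * y) = exp (- a\<^sup>2 * y) * exp (- y * x\<^sup>2)"
          by (simp add: algebra_simps flip: exp_add)
        show "ennreal (indicator {0<..} x * (indicator {0<..} y * (x powr s * exp (- (a\<^sup>2 + x\<^sup>2) * y)))) =
          ennreal (exp (- a\<^sup>2 * y)) * ennreal (indicator {0<..} x * (x powr (2 * ((1 + s) / 2) - 1) * exp (- y * x\<^sup>2)))"
          unfolding a b using True by (simp add: indicator_def mult_ac flip: ennreal_mult)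
      qed
      also have "\<dots> = ennreal (exp (- a\<^sup>2 * y)) * ennreal (Gamma ((1 + s) / 2) * y powr (- ((1 + s) / 2)) / 2)"
        by (subst nn_integral_cmult) (use nn_integral_Gamma_square[OF _ True, of "(1+s)/2"] assms in auto)
      also have "- ((1 + s) / 2) = (1 - s) / 2 - 1" by (simp add: field_simps)
      finally show ?thesis using True G by (simp add: mult_ac flip: ennreal_mult)
    qed (simp add: f_def)
  qed
  also have "\<dots> = ennreal (Gamma ((1 + s) / 2) / 2) * ennreal (Gamma ((1 - s) / 2) * (a\<^sup>2) powr (- ((1 - s) / 2)))"
    by (subst nn_integral_cmult) (use nn_integral_Gamma[of "(1-s)/2" "a\<^sup>2"] assms in auto)
  also have "(a\<^sup>2) powr (- ((1 - s) / 2)) = a powr (s - 1)"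
  proof -
    have "a\<^sup>2 = a powr 2" using assms by (simp add: powr_numeral)
    moreover have "2 * (- ((1 - s) / 2)) = s - 1" by (simp add: field_simps)
    ultimately show ?thesis by (simp only: powr_powr)
  qed
  finally show ?thesis
    using assms Gamma_real_pos[of "(1+s)/2"] Gamma_real_pos[of "(1-s)/2"] by (simp add: mult_ac flip: ennreal_mult)
qed

text \<open>Translation by a only multiplies the Laplace integral over a unit interval by exp(-x a),
  so the later sum over the intervals is geometric.\<close>

lemma nn_integral_trap_exp:
  fixes x a :: real assumes x: "x > 0"
  shows "(\<integral>\<^sup>+u. ennreal (indicator {a..a+1} u * ((u - a) * (a + 1 - u) * exp (- x * u))) \<partial>lborel)
     = ennreal (exp (- x * a) * ((x - 2 + (x + 2) * exp (- x)) / x ^ 3))"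
proof -
  define G where "G = (\<lambda>u. - exp (- x * u) * ((u - a) * (a + 1 - u) / x + (1 - 2 * (u - a)) / x\<^sup>2 - 2 / x ^ 3))"
  have "(G has_vector_derivative (u - a) * (a + 1 - u) * exp (- x * u)) (at u within {a..a+1})" for u
  proof -
    have "(G has_real_derivative (u - a) * (a + 1 - u) * exp (- x * u)) (at u within {a..a+1})"
      unfolding G_def using x
      by (auto intro!: derivative_eq_intros simp: divide_simps)
         (auto simp: algebra_simps power2_eq_square power3_eq_cube)
    thus ?thesis by (simp add: has_real_derivative_iff_has_vector_derivative)
  qed
  hence "((\<lambda>u. (u - a) * (a + 1 - u) * exp (- x * u)) has_integral G (a+1) - G a) {a..a+1}"
    by (intro fundamental_theorem_of_calculus) auto
  also have "G (a+1) - G a = exp (- x * a) * ((x - 2 + (x + 2) * exp (- x)) / x ^ 3)"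
  proof -
    have e: "exp (- x * (a + 1)) = exp (- x * a) * exp (- x)" by (simp add: algebra_simps flip: exp_add)
    show ?thesis unfolding G_def e using x by (simp add: divide_simps power2_eq_square power3_eq_cube) (simp add: algebra_simps)
  qed
  finally show ?thesis by (intro nn_integral_has_integral_lebesgue) auto
qed

section \<open>The functional equation on the real segment -1 < s < 0\<close>

lemma has_integral_trap_powr_0:
  fixes s :: real assumes "-1 < s" "s < 0"
  shows "((\<lambda>u. (u - 0) * (0 + 1 - u) * u powr (- s - 2)) has_integral (1 / (-s) - 1 / (1 - s))) {0..0+1}"
proof -
  have "((\<lambda>u. u powr (- s - 1) - u powr (- s)) has_integral
      (1 powr (- s - 1 + 1) / (- s - 1 + 1) - 1 powr (- s + 1) / (- s + 1))) {0..1}"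
    using assms by (intro has_integral_diff has_integral_powr_from_0) auto
  moreover have "u powr (- s - 1) - u powr (- s) = u * (1 - u) * u powr (- s - 2)" if "u \<in> {0..1}" for u
  proof (cases "u = 0")
    case False
    have e: "- s - 2 + 1 = - s - 1" "- s - 2 + 2 = - s" by simp_all
    have "u powr (- s - 1) = u powr (- s - 2) * u" "u powr (- s) = u powr (- s - 2) * u powr 2"
      using that False powr_add[of u "-s-2" 1] powr_add[of u "-s-2" 2] unfolding e by auto
    thus ?thesis using that False by (simp add: powr_numeral power2_eq_square algebra_simps)
  qed simp
  ultimately have "((\<lambda>u. u * (1 - u) * u powr (- s - 2)) has_integral
      (1 powr (- s - 1 + 1) / (- s - 1 + 1) - 1 powr (- s + 1) / (- s + 1))) {0..1}"
    by (rule has_integral_eq[rotated])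
  thus ?thesis by simp
qed

text \<open>Unlike the sum defining \<open>zeta_tail\<close>, this one is used from n = 0 on. Near 0
  the integrand behaves like u^(-s-1), so the interval [0, 1] can be included only for s <
  0.\<close>

definition trap_powr :: "real \<Rightarrow> nat \<Rightarrow> real" where
  "trap_powr s n = integral {real n..real n+1} (\<lambda>u. (u - real n) * (real n + 1 - u) * u powr (- s - 2))"

lemma has_integral_trap_powr:
  fixes s :: real assumes "-1 < s" "s < 0"
  shows "((\<lambda>u. (u - real n) * (real n + 1 - u) * u powr (- s - 2)) has_integral trap_powr s n) {real n..real n+1}"
proof (cases n)
  case 0
  thus ?thesis using has_integral_trap_powr_0[OF assms] unfolding trap_powr_def
    by (auto simp: has_integral_iff)
next
  case (Suc m)
  have "(\<lambda>u. (u - real n) * (real n + 1 - u) * u powr (- s - 2)) integrable_on {real n..real n+1}"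
    unfolding cbox_interval[symmetric] by (intro integrable_continuous continuous_intros) (auto simp: Suc)
  thus ?thesis unfolding trap_powr_def by (rule integrable_integral)
qed

lemma trap_powr_0:
  fixes s :: real assumes "-1 < s" "s < 0"
  shows "trap_powr s 0 = 1 / (-s) - 1 / (1 - s)"
  using has_integral_trap_powr[OF assms, of 0] has_integral_trap_powr_0[OF assms]
  by (auto intro: has_integral_unique)

lemma trap_powr_nonneg: "trap_powr s n \<ge> 0"
proof (cases "(\<lambda>u. (u - real n) * (real n + 1 - u) * u powr (- s - 2)) integrable_on {real n..real n+1}")
  case True
  thus ?thesis unfolding trap_powr_def by (intro integral_nonneg) auto
qed (simp add: trap_powr_def not_integrable_integral)

lemma trap_kernel_of_real:
  fixes s :: real assumes "-1 < s" "s < 0"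
  shows "trap_kernel (real n) (of_real s) = of_real (trap_powr s n)"
proof -
  have "((\<lambda>u. complex_of_real ((u - real n) * (real n + 1 - u) * u powr (- s - 2))) has_integral of_real (trap_powr s n)) {real n..real n+1}"
    using has_integral_linear[OF has_integral_trap_powr[OF assms] bounded_linear_of_real] by (simp add: o_def)
  moreover have "complex_of_real ((u - real n) * (real n + 1 - u) * u powr (- s - 2)) =
      of_real ((u - real n) * (real n + 1 - u)) * of_real u powr (- of_real s - 2)" if "u \<in> {real n..real n+1}" for u
  proof -
    have "u \<ge> 0" using that by (auto intro: order_trans[of _ "real n"])
    hence "complex_of_real (u powr (- s - 2)) = of_real u powr (- of_real s - 2)"
      by (simp add: powr_of_real[symmetric])
    thus ?thesis by simp
  qed
  ultimately have "((\<lambda>u. of_real ((u - real n) * (real n + 1 - u)) * of_real u powr (- of_real s - 2)) has_integral complex_of_real (trap_powr s n)) {real n..real n+1}"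
    by (rule has_integral_eq[rotated])
  thus ?thesis unfolding trap_kernel_def by (rule integral_unique)
qed

lemma trap_powr_summable:
  assumes "-1 < s" "s < (0::real)"
  shows "summable (trap_powr s)"
proof (subst summable_Suc_iff[symmetric])
  have "summable (\<lambda>n. norm (trap_kernel (real (Suc n)) (of_real s)))"
    using assms by (intro trap_kernel_summable) auto
  thus "summable (\<lambda>n. trap_powr s (Suc n))"
    using trap_powr_nonneg[of s] by (simp add: trap_kernel_of_real[OF assms] del: of_nat_Suc)
qed

text \<open>The interval [0, 1] contributes 1/(-s) - 1/(1 - s) = -1/(s (1 - s)), which cancels the
  elementary part (s + 1)/2 of \<open>zeta_aux\<close> exactly. What remains is one sum over all
  unit intervals, in effect a single integral over the positive axis.\<close>

lemma zeta_aux_trap_powr: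
  assumes "-1 < s" "s < (0::real)"
  shows "zeta_aux (of_real s) = of_real ((s - 1) * (s * (s + 1) / 2) * (\<Sum>n. trap_powr s n))"
proof -
  have "zeta_tail (of_real s) = (\<Sum>n. complex_of_real (trap_powr s (Suc n)))"
    unfolding zeta_tail_def by (simp only: trap_kernel_of_real[OF assms])
  also have "\<dots> = of_real (\<Sum>n. trap_powr s (Suc n))"
    using trap_powr_summable[OF assms] by (subst suminf_of_real[symmetric]) (auto simp: summable_Suc_iff)
  also have "(\<Sum>n. trap_powr s (Suc n)) = (\<Sum>n. trap_powr s n) - (1 / (-s) - 1 / (1 - s))"
    using suminf_split_head[OF trap_powr_summable[OF assms]] trap_powr_0[OF assms] by simp
  finally have 1: "zeta_tail (of_real s) = of_real ((\<Sum>n. trap_powr s n) - (1 / (-s) - 1 / (1 - s)))" .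
  define Z where "Z = (\<Sum>n. trap_powr s n)"
  have "zeta_aux (of_real s) = of_real (1 + (s - 1) / 2 + (s - 1) * (s * (s + 1) / 2 * (Z - (1 / (-s) - 1 / (1 - s)))))"
    unfolding zeta_aux_def 1 Z_def by simp
  also have "1 + (s - 1) / 2 + (s - 1) * (s * (s + 1) / 2 * (Z - (1 / (-s) - 1 / (1 - s)))) = (s - 1) * (s * (s + 1) / 2) * Z"
    using assms by (simp add: divide_simps) (simp add: algebra_simps)
  finally show ?thesis by (simp add: Z_def)
qed

text \<open>The functional equation for real \<open>-1 < s < 0\<close> is Tonelli applied to the double integral of
  \<open>x powr (s + 1) * b u * exp (- x * u)\<close>, where \<open>b\<close> is the 1-periodic extension of \<open>u (1 - u)\<close> on \<open>[0, 1]\<close>: integrating over \<open>x\<close>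
  first gives \<open>\<zeta>(s)\<close>, integrating over \<open>u\<close> first and expanding \<open>coth\<close> into partial fractions gives \<open>\<zeta>(1 - s)\<close>.\<close>

lemma nn_integral_trap_Mellin:
  assumes "-1 < s" "s < (0::real)"
  shows "(\<integral>\<^sup>+x. \<integral>\<^sup>+u. ennreal (indicator {0<..} x * (indicator {real n..real n+1} u *
            (x powr (s + 1) / 2 * ((u - real n) * (real n + 1 - u) * exp (- x * u))))) \<partial>lborel \<partial>lborel)
       = ennreal (Gamma (s + 2) / 2 * trap_powr s n)"
    (is "(\<integral>\<^sup>+x. \<integral>\<^sup>+u. ?f x u \<partial>lborel \<partial>lborel) = _")
proof -
  have G: "Gamma (s + 2) > 0" using assms by (intro Gamma_real_pos) auto
  have "(\<integral>\<^sup>+x. \<integral>\<^sup>+u. ?f x u \<partial>lborel \<partial>lborel) = (\<integral>\<^sup>+u. \<integral>\<^sup>+x. ?f x u \<partial>lborel \<partial>lborel)"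
    by (rule lborel_pair.Fubini'[symmetric]) measurable
  also have "\<dots> = (\<integral>\<^sup>+u. ennreal (Gamma (s + 2) / 2) * ennreal (indicator {real n..real n+1} u * ((u - real n) * (real n + 1 - u) * u powr (- s - 2))) \<partial>lborel)"
  proof (intro nn_integral_cong)
    fix u :: real
    show "(\<integral>\<^sup>+x. ?f x u \<partial>lborel) = ennreal (Gamma (s + 2) / 2) * ennreal (indicator {real n..real n+1} u * ((u - real n) * (real n + 1 - u) * u powr (- s - 2)))"
    proof (cases "u \<in> {real n..real n+1} \<and> u \<noteq> 0")
      case True
      hence u: "u > 0" "u \<in> {real n..real n+1}" by (auto intro: le_neq_trans order_trans[of _ "real n"])
      define c where "c = (u - real n) * (real n + 1 - u)"
      have c: "c \<ge> 0" using u by (auto simp: c_def)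
      have "(\<integral>\<^sup>+x. ?f x u \<partial>lborel) = (\<integral>\<^sup>+x. ennreal (c / 2) * ennreal (indicator {0<..} x * (x powr (s + 2 - 1) * exp (- u * x))) \<partial>lborel)"
        unfolding c_def[symmetric]
        using u c by (intro nn_integral_cong) (auto simp: indicator_def mult_ac add.commute simp flip: ennreal_mult)
      also have "\<dots> = ennreal (c / 2) * ennreal (Gamma (s + 2) * u powr (- (s + 2)))"
        by (subst nn_integral_cmult) (use nn_integral_Gamma[of "s + 2" u] assms u in auto)
      also have "\<dots> = ennreal (Gamma (s + 2) / 2) * ennreal (c * u powr (- s - 2))"
        using c G by (simp add: mult_ac algebra_simps flip: ennreal_mult)
      finally show ?thesis using u by (simp add: c_def)
    next
      case False
      hence "?f x u = 0" for x by (auto simp: indicator_def)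
      moreover have "indicator {real n..real n+1} u * ((u - real n) * (real n + 1 - u) * u powr (- s - 2)) = 0"
        using False by (auto simp: indicator_def)
      ultimately show ?thesis by (simp only:) simp
    qed
  qed
  also have "\<dots> = ennreal (Gamma (s + 2) / 2) * (\<integral>\<^sup>+u. ennreal (indicator {real n..real n+1} u * ((u - real n) * (real n + 1 - u) * u powr (- s - 2))) \<partial>lborel)"
    by (rule nn_integral_cmult) auto
  also have "(\<integral>\<^sup>+u. ennreal (indicator {real n..real n+1} u * ((u - real n) * (real n + 1 - u) * u powr (- s - 2))) \<partial>lborel) = ennreal (trap_powr s n)"
    by (rule nn_integral_has_integral_lebesgue[OF _ has_integral_trap_powr[OF assms]]) auto
  finally show ?thesis using G trap_powr_nonneg[of s n] by (simp flip: ennreal_mult)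
qed

text \<open>The geometric series over the unit intervals produces the factor 1/(1 - exp(-x)), and
  the result is then expanded by \<open>coth_partial_fractions\<close>. Multiplying by x^(s+1)/2
  turns the k-th fraction into a multiple of the integrand of
  \<open>nn_integral_powr_div_squares\<close> with a = 2 pi (k + 1).\<close>

lemma suminf_trap_exp:
  fixes x s :: real assumes x: "x > 0"
  shows "(\<Sum>n. ennreal (x powr (s + 1) / 2) * ennreal (exp (- x * real n) * ((x - 2 + (x + 2) * exp (- x)) / x ^ 3)))
     = (\<Sum>k. ennreal (2 * (x powr s / ((2 * pi * real (Suc k))\<^sup>2 + x\<^sup>2))))"
proof -
  define J where "J = (x - 2 + (x + 2) * exp (- x)) / x ^ 3"
  have q: "exp (-x) < 1" using x by simp
  have pf: "(\<lambda>k. 4 / (x * ((2 * pi * real (Suc k))\<^sup>2 + x\<^sup>2))) sums (J / (1 - exp (-x)))"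
    using coth_partial_fractions[OF x] by (simp add: J_def)
  have D: "(2 * pi * real (Suc k))\<^sup>2 + x\<^sup>2 > 0" for k using x by (intro add_nonneg_pos) auto
  \<comment> \<open>The sign of J is read off from the partial fractions, all of whose terms are
    positive.\<close>
  have "J / (1 - exp (-x)) \<ge> 0"
    using x by (intro sums_le[OF _ sums_zero pf]) (auto intro!: divide_nonneg_nonneg mult_nonneg_nonneg)
  hence J: "J \<ge> 0" using q by (simp add: zero_le_divide_iff)
  have "(\<lambda>n. exp (- x * real n)) sums (1 / (1 - exp (-x)))"
    using geometric_sums[of "exp (-x)"] q by (simp add: mult.commute exp_of_nat_mult[symmetric])
  hence "(\<lambda>n. exp (- x * real n) * (x powr (s + 1) / 2 * J)) sums (1 / (1 - exp (-x)) * (x powr (s + 1) / 2 * J))"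
    by (rule sums_mult2)
  hence s1: "(\<lambda>n. x powr (s + 1) / 2 * (exp (- x * real n) * J)) sums (x powr (s + 1) / 2 * (J / (1 - exp (-x))))"
    by (simp add: mult_ac)
  have "(\<lambda>k. x powr (s + 1) / 2 * (4 / (x * ((2 * pi * real (Suc k))\<^sup>2 + x\<^sup>2)))) sums (x powr (s + 1) / 2 * (J / (1 - exp (-x))))"
    by (rule sums_mult[OF pf])
  moreover have "x powr (s + 1) / 2 * (4 / (x * ((2 * pi * real (Suc k))\<^sup>2 + x\<^sup>2))) = 2 * (x powr s / ((2 * pi * real (Suc k))\<^sup>2 + x\<^sup>2))" for k
  proof -
    define E where "E = (2 * pi * real (Suc k))\<^sup>2 + x\<^sup>2"
    have "E > 0" using D[of k] by (simp add: E_def)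
    thus ?thesis unfolding E_def[symmetric] using x by (simp add: powr_add field_simps)
  qed
  ultimately have s2: "(\<lambda>k. 2 * (x powr s / ((2 * pi * real (Suc k))\<^sup>2 + x\<^sup>2))) sums (x powr (s + 1) / 2 * (J / (1 - exp (-x))))"
    by simp
  have N: "0 \<le> x powr (s + 1) / 2 * (J / (1 - exp (-x)))"
    using J q by (intro mult_nonneg_nonneg divide_nonneg_nonneg) auto
  have "(\<Sum>n. ennreal (x powr (s + 1) / 2) * ennreal (exp (- x * real n) * J)) = (\<Sum>n. ennreal (x powr (s + 1) / 2 * (exp (- x * real n) * J)))"
    using J by (intro suminf_cong) (simp flip: ennreal_mult)
  also have "\<dots> = ennreal (x powr (s + 1) / 2 * (J / (1 - exp (-x))))"
    by (intro sums_unique[symmetric] sums_ennreal[THEN iffD2] N s1) (use J in auto)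
  also have "\<dots> = (\<Sum>k. ennreal (2 * (x powr s / ((2 * pi * real (Suc k))\<^sup>2 + x\<^sup>2))))"
    by (intro sums_unique sums_ennreal[THEN iffD2] N s2) (use D in \<open>auto simp: less_imp_le\<close>)
  finally show ?thesis by (simp add: J_def)
qed

text \<open>For real s every integrand is nonnegative, so in the extended nonnegative reals all
  exchanges of sums and integrals are free of integrability conditions. The convergence of the two
  outer sums then allows the return to real numbers.\<close>

lemma functional_equation_sums:
  assumes s: "-1 < s" "s < (0::real)"
  shows "Gamma (s + 2) / 2 * (\<Sum>n. trap_powr s n) =
           Gamma ((1 + s) / 2) * Gamma ((1 - s) / 2) * (2 * pi) powr (s - 1) * (\<Sum>k. real (Suc k) powr (s - 1))"
proof -
  define c where "c = Gamma ((1 + s) / 2) * Gamma ((1 - s) / 2) * (2 * pi) powr (s - 1)"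
  have G: "Gamma (s + 2) > 0" using s by (intro Gamma_real_pos) auto
  have c: "c \<ge> 0" using s unfolding c_def by (intro mult_nonneg_nonneg less_imp_le Gamma_real_pos) auto
  define f where "f = (\<lambda>n x u. ennreal (indicator {0<..} x * (indicator {real n..real n+1} u *
            (x powr (s + 1) / 2 * ((u - real n) * (real n + 1 - u) * exp (- x * u))))))"
  have [measurable]: "(\<lambda>x. \<integral>\<^sup>+u. f n x u \<partial>lborel) \<in> borel_measurable lborel" for n
    unfolding f_def by measurable
  have "ennreal (Gamma (s + 2) / 2 * (\<Sum>n. trap_powr s n)) = ennreal (\<Sum>n. Gamma (s + 2) / 2 * trap_powr s n)"
    by (subst suminf_mult[OF trap_powr_summable[OF s]]) (rule refl)
  also have "\<dots> = (\<Sum>n. ennreal (Gamma (s + 2) / 2 * trap_powr s n))"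
    using G trap_powr_nonneg[of s] trap_powr_summable[OF s]
    by (intro suminf_ennreal2[symmetric] summable_mult) auto
  also have "\<dots> = (\<Sum>n. \<integral>\<^sup>+x. \<integral>\<^sup>+u. f n x u \<partial>lborel \<partial>lborel)"
    unfolding f_def by (simp only: nn_integral_trap_Mellin[OF s])
  also have "\<dots> = (\<integral>\<^sup>+x. (\<Sum>n. \<integral>\<^sup>+u. f n x u \<partial>lborel) \<partial>lborel)"
    by (rule nn_integral_suminf[symmetric]) simp
  also have "\<dots> = (\<integral>\<^sup>+x. (\<Sum>k. ennreal 2 * ennreal (indicator {0<..} x * (x powr s / ((2 * pi * real (Suc k))\<^sup>2 + x\<^sup>2)))) \<partial>lborel)"
  proof (intro nn_integral_cong)
    fix x :: real
    show "(\<Sum>n. \<integral>\<^sup>+u. f n x u \<partial>lborel) = (\<Sum>k. ennreal 2 * ennreal (indicator {0<..} x * (x powr s / ((2 * pi * real (Suc k))\<^sup>2 + x\<^sup>2))))"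
    proof (cases "x > 0")
      case True
      have "(\<integral>\<^sup>+u. f n x u \<partial>lborel) = ennreal (x powr (s + 1) / 2) * ennreal (exp (- x * real n) * ((x - 2 + (x + 2) * exp (- x)) / x ^ 3))" for n
      proof -
        have "(\<integral>\<^sup>+u. f n x u \<partial>lborel) = (\<integral>\<^sup>+u. ennreal (x powr (s + 1) / 2) * ennreal (indicator {real n..real n+1} u * ((u - real n) * (real n + 1 - u) * exp (- x * u))) \<partial>lborel)"
          unfolding f_def using True by (intro nn_integral_cong) (auto simp: indicator_def simp flip: ennreal_mult)
        also have "\<dots> = ennreal (x powr (s + 1) / 2) * ennreal (exp (- x * real n) * ((x - 2 + (x + 2) * exp (- x)) / x ^ 3))"
          by (subst nn_integral_cmult) (use nn_integral_trap_exp[OF True, of "real n"] in auto)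
        finally show ?thesis .
      qed
      hence "(\<Sum>n. \<integral>\<^sup>+u. f n x u \<partial>lborel) = (\<Sum>k. ennreal (2 * (x powr s / ((2 * pi * real (Suc k))\<^sup>2 + x\<^sup>2))))"
        using suminf_trap_exp[OF True, of s] by simp
      also have "\<dots> = (\<Sum>k. ennreal 2 * ennreal (indicator {0<..} x * (x powr s / ((2 * pi * real (Suc k))\<^sup>2 + x\<^sup>2))))"
        by (intro suminf_cong, subst ennreal_mult'[symmetric]) (use True in auto)
      finally show ?thesis .
    qed (simp add: f_def)
  qed
  also have "\<dots> = (\<Sum>k. \<integral>\<^sup>+x. ennreal 2 * ennreal (indicator {0<..} x * (x powr s / ((2 * pi * real (Suc k))\<^sup>2 + x\<^sup>2))) \<partial>lborel)"
    by (rule nn_integral_suminf) measurable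
  also have "\<dots> = (\<Sum>k. ennreal (c * real (Suc k) powr (s - 1)))"
  proof (intro suminf_cong)
    fix k
    have "(\<integral>\<^sup>+x. ennreal 2 * ennreal (indicator {0<..} x * (x powr s / ((2 * pi * real (Suc k))\<^sup>2 + x\<^sup>2))) \<partial>lborel)
       = ennreal 2 * (\<integral>\<^sup>+x. ennreal (indicator {0<..} x * (x powr s / ((2 * pi * real (Suc k))\<^sup>2 + x\<^sup>2))) \<partial>lborel)"
      by (rule nn_integral_cmult) measurable
    also have "\<dots> = ennreal 2 * ennreal (Gamma ((1 + s) / 2) * Gamma ((1 - s) / 2) * (2 * pi * real (Suc k)) powr (s - 1) / 2)"
      using s by (subst nn_integral_powr_div_squares) auto
    also have "\<dots> = ennreal (c * real (Suc k) powr (s - 1))"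
      by (subst ennreal_mult'[symmetric], simp, subst powr_mult) (auto simp: c_def mult_ac simp del: of_nat_Suc)
    finally show "(\<integral>\<^sup>+x. ennreal 2 * ennreal (indicator {0<..} x * (x powr s / ((2 * pi * real (Suc k))\<^sup>2 + x\<^sup>2))) \<partial>lborel)
       = ennreal (c * real (Suc k) powr (s - 1))" .
  qed
  also have "\<dots> = ennreal (\<Sum>k. c * real (Suc k) powr (s - 1))"
    using c summable_Suc_powr[of "1 - s"] s by (intro suminf_ennreal2 summable_mult) auto
  also have "(\<Sum>k. c * real (Suc k) powr (s - 1)) = c * (\<Sum>k. real (Suc k) powr (s - 1))"
    using summable_Suc_powr[of "1 - s"] s by (intro suminf_mult) auto
  finally show ?thesis
    unfolding c_def[symmetric] using G c summable_Suc_powr[of "1 - s"] s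
    by (subst (asm) ennreal_inj) (auto intro!: mult_nonneg_nonneg suminf_nonneg trap_powr_summable trap_powr_nonneg)
qed

section \<open>The completed zeta function, its reflection, and the continuation of zeta\<close>

lemma Re_pos_not_nonpos_Ints: "Re z > 0 \<Longrightarrow> z \<notin> \<int>\<^sub>\<le>\<^sub>0"
  by (auto elim!: nonpos_Ints_cases)

lemma Gamma_legendre_duplication_real:
  fixes x :: real assumes "x > 0"
  shows "Gamma x * Gamma (x + 1/2) = 2 powr (1 - 2 * x) * sqrt pi * Gamma (2 * x)"
proof -
  have n: "complex_of_real x \<notin> \<int>\<^sub>\<le>\<^sub>0" "complex_of_real x + 1/2 \<notin> \<int>\<^sub>\<le>\<^sub>0"
    using assms by (auto elim!: nonpos_Ints_cases simp: complex_eq_iff)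
  have "complex_of_real (Gamma x * Gamma (x + 1/2)) = Gamma (of_real x) * Gamma (of_real x + 1/2)"
    using Gamma_complex_of_real[of x] Gamma_complex_of_real[of "x + 1/2"] by simp
  also have "\<dots> = exp ((1 - 2 * of_real x) * of_real (ln 2)) * of_real (sqrt pi) * Gamma (2 * of_real x)"
    by (rule Gamma_legendre_duplication[OF n])
  also have "(1 - 2 * complex_of_real x) * of_real (ln 2) = of_real ((1 - 2 * x) * ln 2)" by simp
  also have "2 * complex_of_real x = of_real (2 * x)" by simp
  also have "exp (of_real ((1 - 2 * x) * ln 2)) = complex_of_real (2 powr (1 - 2 * x))"
    unfolding exp_of_real by (simp add: powr_def)
  finally have "complex_of_real (Gamma x * Gamma (x + 1/2)) = of_real (2 powr (1 - 2 * x) * sqrt pi * Gamma (2 * x))"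
    by (simp only: Gamma_complex_of_real flip: of_real_mult)
  thus ?thesis by (simp only: of_real_eq_iff)
qed

text \<open>As (s/2) Gamma(s/2) = Gamma(s/2 + 1), this is Riemann's function s (s - 1)/2 pi^(-s/2)
  Gamma(s/2) zeta(s), written so that no pole at 0 or 1 has to be removed. It is used only for Re s
  > -1, where \<open>zeta_aux\<close> represents (s - 1) zeta(s).\<close>

definition xi_fun :: "complex \<Rightarrow> complex" where
  "xi_fun s = zeta_aux s * of_real pi powr (- s / 2) * Gamma (s / 2 + 1)"

lemma xi_fun_holomorphic: "xi_fun holomorphic_on {s. Re s > -1}"
proof -
  have "Gamma \<circ> (\<lambda>s. s / 2 + 1) holomorphic_on {s. Re s > -1}"
  proof (rule holomorphic_on_compose)
    show "Gamma holomorphic_on (\<lambda>s. s / 2 + 1) ` {s. Re s > -1}"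
    proof (rule holomorphic_Gamma)
      have "s / 2 + 1 \<notin> \<int>\<^sub>\<le>\<^sub>0" if "Re s > -1" for s
        using Re_pos_not_nonpos_Ints[of "s / 2 + 1"] that by simp
      thus "(\<lambda>s. s / 2 + 1) ` {s. Re s > -1} \<inter> \<int>\<^sub>\<le>\<^sub>0 = {}" by blast
    qed
  qed (intro holomorphic_intros, auto)
  hence "(\<lambda>s. Gamma (s / 2 + 1)) holomorphic_on {s. Re s > -1}" by (simp add: o_def)
  moreover have "(\<lambda>s. of_real pi powr (- s / 2)) holomorphic_on {s. Re s > -1}"
    by (intro holomorphic_intros) auto
  ultimately show ?thesis unfolding xi_fun_def [abs_def] by (intro holomorphic_on_mult zeta_aux_holomorphic)
qed

text \<open>Legendre duplication splits Gamma(s + 2), which comes from the integral over x, into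
  Gamma(s/2 + 1), the factor belonging to the left side, and Gamma((1 + s)/2), which cancels against
  the same factor in \<open>functional_equation_sums\<close>.\<close>

lemma xi_fun_real:
  assumes s: "-1 < s" "s < (0::real)"
  shows "xi_fun (of_real s) = xi_fun (1 - of_real s)"
proof -
  define S where "S = (\<Sum>n. trap_powr s n)"
  define Z where "Z = (\<Sum>k. real (Suc k) powr (s - 1))"
  define g1 g2 g3 g4 where "g1 = Gamma ((1 + s) / 2)" and "g2 = Gamma ((1 - s) / 2)"
    and "g3 = Gamma (s + 2)" and "g4 = Gamma (s / 2 + 1)"
  have g1: "g1 > 0" unfolding g1_def using s by (intro Gamma_real_pos) auto
  have FE: "g3 * S = 2 * (g1 * g2 * (2 * pi) powr (s - 1) * Z)"
    using functional_equation_sums[OF s] by (simp add: g1_def g2_def g3_def S_def Z_def)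
  have dup: "g4 * ((1 + s) / 2 * g1) = 2 powr (- 1 - s) * sqrt pi * g3"
  proof -
    have "Gamma ((1 + s) / 2 + 1) = (1 + s) / 2 * Gamma ((1 + s) / 2)"
      by (intro Gamma_plus1) (use s in \<open>auto elim!: nonpos_Ints_cases\<close>)
    moreover have "(1 + s) / 2 + 1 = s / 2 + 1 + 1 / 2" by (simp add: field_simps)
    ultimately have "(1 + s) / 2 * g1 = Gamma (s / 2 + 1 + 1 / 2)" by (simp add: g1_def)
    moreover have "1 - 2 * (s / 2 + 1) = -1 - s" "2 * (s / 2 + 1) = s + 2" by simp_all
    ultimately show ?thesis using Gamma_legendre_duplication_real[of "s / 2 + 1"] s
      unfolding g3_def g4_def by (simp only:)
  qed
  have z1: "zeta_aux (of_real s) = of_real ((s - 1) * (s * (s + 1) / 2) * S)"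
    unfolding S_def by (rule zeta_aux_trap_powr[OF s])
  have z2: "zeta_aux (1 - of_real s) = of_real (- s * Z)"
  proof -
    have "of_nat (Suc n) powr (- (1 - of_real s)) = complex_of_real (real (Suc n) powr (s - 1))" for n
      by (simp add: powr_of_real[symmetric] del: of_nat_Suc)
    hence "(\<Sum>n. of_nat (Suc n) powr (- (1 - complex_of_real s))) = of_real Z"
      unfolding Z_def using summable_Suc_powr[of "1 - s"] s by (subst suminf_of_real) (auto simp del: of_nat_Suc)
    thus ?thesis using zeta_aux_dirichlet[of "1 - of_real s"] s by simp
  qed
  have p1: "of_real pi powr (- of_real s / 2) = complex_of_real (pi powr (- s / 2))"
           "of_real pi powr (- (1 - of_real s) / 2) = complex_of_real (pi powr ((s - 1) / 2))"
    by (simp_all add: powr_of_real[symmetric])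
  have G1: "Gamma (of_real s / 2 + 1) = complex_of_real g4"
    using Gamma_complex_of_real[of "s / 2 + 1"] by (simp add: g4_def)
  have G2: "Gamma ((1 - of_real s) / 2 + 1) = complex_of_real ((1 - s) / 2 * g2)"
  proof -
    have "Gamma ((1 - s) / 2 + 1) = (1 - s) / 2 * g2" unfolding g2_def
      by (intro Gamma_plus1) (use s in \<open>auto elim!: nonpos_Ints_cases\<close>)
    moreover have "(1 - of_real s) / 2 + 1 = complex_of_real ((1 - s) / 2 + 1)" by simp
    ultimately show ?thesis using Gamma_complex_of_real[of "(1 - s) / 2 + 1"] by (simp only:)
  qed
  \<comment> \<open>The exponents of 2 add up to 0 and those of pi to (s - 1)/2.\<close>
  have pw: "2 powr (- 1 - s) * (sqrt pi * (2 * pi) powr (s - 1) * pi powr (- s / 2)) * 4 = pi powr ((s - 1) / 2)"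
  proof -
    have a: "sqrt pi = pi powr (1/2)" by (simp add: powr_half_sqrt)
    have b: "4 = (2::real) powr 2" by (simp add: powr_numeral)
    have "2 powr (- 1 - s) * (sqrt pi * (2 * pi) powr (s - 1) * pi powr (- s / 2)) * 4
       = (2 powr (- 1 - s) * 2 powr (s - 1) * 2 powr 2) * (pi powr (1/2) * pi powr (s - 1) * pi powr (- s / 2))"
      unfolding a b by (subst powr_mult) (auto simp: mult_ac)
    also have "\<dots> = pi powr ((s - 1) / 2)"
      unfolding powr_add[symmetric] by (simp add: add_divide_distrib diff_divide_distrib)
    finally show ?thesis .
  qed
  have "(s + 1) * S * pi powr (- s / 2) * g4 * g1 = 2 * (g4 * ((1 + s) / 2 * g1)) * S * pi powr (- s / 2)"
    by (simp add: field_simps)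
  also have "\<dots> = 2 powr (- 1 - s) * sqrt pi * 2 * (g3 * S) * pi powr (- s / 2)"
    unfolding dup by (simp add: field_simps)
  also have "\<dots> = (2 powr (- 1 - s) * (sqrt pi * (2 * pi) powr (s - 1) * pi powr (- s / 2)) * 4) * Z * g2 * g1"
    unfolding FE by (simp add: field_simps)
  also have "\<dots> = pi powr ((s - 1) / 2) * Z * g2 * g1" unfolding pw ..
  finally have "(s + 1) * S * pi powr (- s / 2) * g4 = pi powr ((s - 1) / 2) * Z * g2" using g1 by simp
  hence "(s - 1) * s / 2 * ((s + 1) * S * pi powr (- s / 2) * g4) = (s - 1) * s / 2 * (pi powr ((s - 1) / 2) * Z * g2)" by simp
  hence "(s - 1) * (s * (s + 1) / 2) * S * pi powr (- s / 2) * g4 = - s * Z * pi powr ((s - 1) / 2) * ((1 - s) / 2 * g2)"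
    by (simp add: field_simps)
  thus ?thesis unfolding xi_fun_def z1 z2 p1 G1 G2 of_real_mult[symmetric] by (simp only:)
qed

text \<open>Both sides are holomorphic on the strip, which is the intersection of Re s > -1 with its
  mirror image, and they agree on the real segment (-1, 0); the identity theorem does the
  rest.\<close>

lemma xi_fun_reflection:
  assumes "-1 < Re s" "Re s < 2"
  shows "xi_fun s = xi_fun (1 - s)"
proof -
  define S where "S = {s. Re s > -1} \<inter> {s. Re s < 2}"
  have hol: "(\<lambda>s. xi_fun s - xi_fun (1 - s)) holomorphic_on S"
  proof (intro holomorphic_on_diff)
    show "xi_fun holomorphic_on S" using xi_fun_holomorphic by (rule holomorphic_on_subset) (auto simp: S_def)
    have "xi_fun \<circ> (\<lambda>s. 1 - s) holomorphic_on S"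
      by (intro holomorphic_on_compose holomorphic_intros holomorphic_on_subset[OF xi_fun_holomorphic]) (auto simp: S_def)
    thus "(\<lambda>s. xi_fun (1 - s)) holomorphic_on S" by (simp add: o_def)
  qed
  have lim: "complex_of_real (-1/2) islimpt (of_real ` {-1<..<0})"
  proof -
    have "(-1/2 :: real) islimpt {-1<..<0}" by (intro interior_limit_point) (simp add: interior_open)
    hence "\<exists>f. (\<forall>n. f n \<in> {-1<..<0::real} - {-1/2}) \<and> f \<longlonglongrightarrow> -1/2"
      unfolding islimpt_sequential by auto
    then obtain f where f: "\<And>n. f n \<in> {-1<..<0::real} - {-1/2}" "f \<longlonglongrightarrow> -1/2" by blast
    have "(\<lambda>n. complex_of_real (f n)) \<longlonglongrightarrow> of_real (-1/2)" by (intro tendsto_of_real f)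
    moreover have "complex_of_real (f n) \<in> of_real ` {-1<..<0} - {of_real (-1/2)}" for n using f(1)[of n]
      by (auto simp del: of_real_divide of_real_minus)
    ultimately show ?thesis unfolding islimpt_sequential
      by (intro exI[of _ "\<lambda>n. complex_of_real (f n)"] conjI allI)
  qed
  have "xi_fun s - xi_fun (1 - s) = 0"
  proof (rule analytic_continuation[OF hol _ _ _ _ lim])
    show "open S" unfolding S_def by (intro open_Int open_halfspace_Re_gt open_halfspace_Re_lt)
    show "connected S" unfolding S_def
      by (intro convex_connected convex_Int convex_halfspace_Re_gt convex_halfspace_Re_lt)
    show "of_real ` {-1<..<0} \<subseteq> S" by (auto simp: S_def)
    show "xi_fun z - xi_fun (1 - z) = 0" if "z \<in> of_real ` {-1<..<0}" for z
      using that xi_fun_real by auto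
  qed (use assms in \<open>auto simp: S_def\<close>)
  thus ?thesis by simp
qed

text \<open>Two formulas are glued: \<open>zeta_aux s / (s - 1)\<close> for Re s > -1 and the
  reflected completed function for Re s < 0, which agree on the overlap by reflection.
  \<open>rGamma\<close> stands for 1/Gamma because it is entire, so the second formula needs no
  exception at the trivial zeros.\<close>

lemma zeta_continuation_exists:
  "\<exists>f. f holomorphic_on (UNIV - {1}) \<and> (\<forall>s. Re s > 1 \<longrightarrow> f s = (\<Sum>n. of_nat (Suc n) powr (- s)))"
proof -
  define f1 where "f1 = (\<lambda>s. zeta_aux s / (s - 1))"
  define f2 where "f2 = (\<lambda>s. xi_fun (1 - s) * rGamma (s / 2 + 1) * of_real pi powr (s / 2) / (s - 1))"
  define A B where "A = {s. Re s > -1} \<inter> - {1}" and "B = {s. Re s < 0}"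
  have h1: "f1 holomorphic_on A" unfolding f1_def A_def
    by (intro holomorphic_intros holomorphic_on_subset[OF zeta_aux_holomorphic]) auto
  have "xi_fun \<circ> (\<lambda>s. 1 - s) holomorphic_on B"
    by (intro holomorphic_on_compose holomorphic_intros holomorphic_on_subset[OF xi_fun_holomorphic]) (auto simp: B_def)
  hence h2: "f2 holomorphic_on B" unfolding f2_def o_def
    by (intro holomorphic_intros) (auto simp: B_def)
  have eq: "f1 s = f2 s" if "s \<in> A \<inter> B" for s
  proof -
    have "xi_fun s = xi_fun (1 - s)" using that by (intro xi_fun_reflection) (auto simp: A_def B_def)
    moreover have "Gamma (s / 2 + 1) * rGamma (s / 2 + 1) = 1"
      using that Re_pos_not_nonpos_Ints[of "s / 2 + 1"] by (simp add: A_def rGamma_inverse_Gamma Gamma_eq_zero_iff)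
    moreover have "complex_of_real pi powr (- s / 2) * of_real pi powr (s / 2) = 1"
      by (simp flip: powr_add)
    moreover have "xi_fun s * rGamma (s / 2 + 1) * of_real pi powr (s / 2) =
        zeta_aux s * (Gamma (s / 2 + 1) * rGamma (s / 2 + 1)) * (of_real pi powr (- s / 2) * of_real pi powr (s / 2))"
      by (simp only: xi_fun_def mult_ac)
    ultimately have "xi_fun (1 - s) * rGamma (s / 2 + 1) * of_real pi powr (s / 2) = zeta_aux s"
      by (simp only: mult_1_right)
    thus ?thesis by (simp add: f1_def f2_def)
  qed
  have hol: "(\<lambda>s. if s \<in> A then f1 s else f2 s) holomorphic_on A \<union> B"
  proof (rule holomorphic_on_If_Un)
    show "open A" unfolding A_def by (intro open_Int open_halfspace_Re_gt) auto
    show "open B" unfolding B_def by (rule open_halfspace_Re_lt)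
  qed (use h1 h2 eq in auto)
  have AB: "A \<union> B = UNIV - {1}" by (auto simp: A_def B_def)
  have dir: "(if s \<in> A then f1 s else f2 s) = (\<Sum>n. of_nat (Suc n) powr (- s))" if "Re s > 1" for s
  proof -
    have "s \<in> A" using that by (auto simp: A_def)
    moreover have "s \<noteq> 1" using that by auto
    ultimately show ?thesis using zeta_aux_dirichlet[OF that] by (simp add: f1_def)
  qed
  show ?thesis by (rule exI, rule conjI, rule hol[unfolded AB]) (use dir in blast)
qed

lemma riemann_zeta_holomorphic: "riemann_zeta holomorphic_on (UNIV - {1})"
  and riemann_zeta_dirichlet: "Re s > 1 \<Longrightarrow> riemann_zeta s = (\<Sum>n. of_nat (Suc n) powr (- s))"
  using someI_ex[OF zeta_continuation_exists, folded riemann_zeta_def] by auto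

text \<open>Identifies the chosen function with the explicit one. The identity theorem applies since
  a half-plane with one point removed is still connected.\<close>

lemma riemann_zeta_eq:
  assumes "Re s > -1" "s \<noteq> 1"
  shows "riemann_zeta s = zeta_aux s / (s - 1)"
proof -
  define S where "S = {s. Re s > -1} - {1::complex}"
  have hol: "(\<lambda>s. riemann_zeta s - zeta_aux s / (s - 1)) holomorphic_on S" unfolding S_def
    by (intro holomorphic_intros holomorphic_on_subset[OF zeta_aux_holomorphic] holomorphic_on_subset[OF riemann_zeta_holomorphic]) auto
  have "riemann_zeta s - zeta_aux s / (s - 1) = 0"
  proof (rule analytic_continuation[OF hol, of "{s. Re s > 1}" 2])
    show "open S" unfolding S_def by (intro open_Diff open_halfspace_Re_gt) auto
    show "connected S" unfolding S_def
      by (intro connected_open_delete open_halfspace_Re_gt convex_connected convex_halfspace_Re_gt) auto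
    have "open {s. Re s > 1}" by (rule open_halfspace_Re_gt)
    thus "2 islimpt {s. Re s > 1}" by (intro interior_limit_point) (simp add: interior_open)
    show "riemann_zeta z - zeta_aux z / (z - 1) = 0" if "z \<in> {s. Re s > 1}" for z
    proof -
      have "z \<noteq> 1" using that by auto
      thus ?thesis using that riemann_zeta_dirichlet[of z] zeta_aux_dirichlet[of z] by simp
    qed
  qed (use assms in \<open>auto simp: S_def\<close>)
  thus ?thesis by simp
qed

section \<open>The Dirichlet series of the von Mangoldt function\<close>

lemma norm_of_nat_Suc_powr: "norm (of_nat (Suc n) powr s :: complex) = real (Suc n) powr Re s"
  using of_real_powr_bound_norm[of "real (Suc n)" s] by simp

text \<open>Of the excess 2d over exponent 1, one d absorbs the logarithm through ln n \<le> n^d / d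
  and the other keeps the series convergent. The coefficient bound ln n + 1 covers 1, ln n and
  \<Lambda>(n) alike.\<close>

lemma log_powr_bound:
  assumes "d > 0" "b \<ge> 1 + 2 * d" "norm (c :: complex) \<le> ln (real (Suc n)) + 1" "Re s \<ge> b"
  shows "norm (c * of_nat (Suc n) powr (- s)) \<le> (1 / d + 1) * real (Suc n) powr (- (1 + d))"
proof -
  have "norm (c * of_nat (Suc n) powr (- s)) = norm c * real (Suc n) powr (- Re s)"
    unfolding norm_mult norm_of_nat_Suc_powr by simp
  also have "\<dots> \<le> (real (Suc n) powr d * (1 / d + 1)) * real (Suc n) powr (- (1 + 2 * d))"
  proof (rule mult_mono)
    have "ln (real (Suc n)) \<le> real (Suc n) powr d / d" by (rule ln_powr_bound) (use assms in auto)
    moreover have "1 \<le> real (Suc n) powr d" using assms by (intro ge_one_powr_ge_zero) auto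
    ultimately show "norm c \<le> real (Suc n) powr d * (1 / d + 1)" using assms(3) by (simp add: algebra_simps)
    show "real (Suc n) powr (- Re s) \<le> real (Suc n) powr (- (1 + 2 * d))"
      using assms by (intro powr_mono) auto
  qed (use assms in auto)
  also have "\<dots> = (1 / d + 1) * (real (Suc n) powr d * real (Suc n) powr (- (1 + 2 * d)))" by simp
  also have "real (Suc n) powr d * real (Suc n) powr (- (1 + 2 * d)) = real (Suc n) powr (- (1 + d))"
  proof -
    have "d + - (1 + 2 * d) = - (1 + d)" by simp
    thus ?thesis by (simp only: powr_add[symmetric])
  qed
  finally show ?thesis .
qed

lemma dirichlet_series_summable:
  assumes "\<And>n. norm (c n :: complex) \<le> ln (real (Suc n)) + 1" "Re s > 1"
  shows "summable (\<lambda>n. norm (c n * of_nat (Suc n) powr (- s)))"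
proof (rule summable_comparison_test')
  define d where "d = (Re s - 1) / 2"
  have d: "d > 0" using assms by (simp add: d_def)
  show "summable (\<lambda>n. (1 / d + 1) * real (Suc n) powr (- (1 + d)))"
    using d by (intro summable_mult summable_Suc_powr) auto
  show "norm (norm (c n * of_nat (Suc n) powr (- s))) \<le> (1 / d + 1) * real (Suc n) powr (- (1 + d))" if "n \<ge> 0" for n
  proof -
    have "1 + 2 * d \<le> Re s" by (simp add: d_def field_simps)
    from log_powr_bound[OF d this assms(1) order_refl] show ?thesis by simp
  qed
qed

lemma dirichlet_series_has_field_derivative:
  assumes "\<And>n. norm (c n :: complex) \<le> ln (real (Suc n)) + 1" "Re s > 1"
  shows "((\<lambda>s. \<Sum>n. c n * of_nat (Suc n) powr (- s)) has_field_derivative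
            (\<Sum>n. - (c n * of_real (ln (real (Suc n))) * of_nat (Suc n) powr (- s)))) (at s)"
proof -
  define S where "S = {s. Re s > 1}"
  have S: "open S" unfolding S_def by (rule open_halfspace_Re_gt)
  have "\<exists>g g'. \<forall>x \<in> S. ((\<lambda>n. c n * of_nat (Suc n) powr (- x)) sums g x) \<and> ((\<lambda>n. - (c n * of_real (ln (real (Suc n))) * of_nat (Suc n) powr (- x))) sums g' x) \<and> (g has_field_derivative g' x) (at x)"
  proof (rule series_and_derivative_comparison_local[OF S])
    show "((\<lambda>x. c n * of_nat (Suc n) powr (- x)) has_field_derivative - (c n * of_real (ln (real (Suc n))) * of_nat (Suc n) powr (- x))) (at x)" for n x
    proof -
      have "((\<lambda>x. c n * exp (- x * Ln (of_nat (Suc n)))) has_field_derivative c n * (exp (- x * Ln (of_nat (Suc n))) * (- Ln (of_nat (Suc n))))) (at x)"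
        by (auto intro!: derivative_eq_intros)
      moreover have "Ln (of_nat (Suc n)) = of_real (ln (real (Suc n)))" by (metis Ln_of_nat of_real_of_nat_eq Suc_neq_Zero neq0_conv)
      ultimately show ?thesis by (simp add: powr_def mult_ac)
    qed
    fix x assume x: "x \<in> S"
    \<comment> \<open>A third of the distance to Re s = 1: after a displacement of at most d an
      excess of 2d remains, as \<open>log_powr_bound\<close> requires.\<close>
    define d where "d = (Re x - 1) / 3"
    have d: "d > 0" using x by (simp add: d_def S_def)
    have "norm (c n * of_nat (Suc n) powr (- y)) \<le> (1 / d + 1) * real (Suc n) powr (- (1 + d))" if "y \<in> ball x d" for n y
    proof (rule log_powr_bound[OF d order_refl assms(1)])
      have "Re x - Re y \<le> d" using that abs_Re_le_cmod[of "x - y"] by (simp add: dist_norm)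
      thus "Re y \<ge> 1 + 2 * d" by (simp add: d_def field_simps)
    qed
    moreover have "summable (\<lambda>n. (1 / d + 1) * real (Suc n) powr (- (1 + d)))"
      using d by (intro summable_mult summable_Suc_powr) auto
    ultimately show "\<exists>d h. 0 < d \<and> summable h \<and> (\<forall>\<^sub>F n in sequentially. \<forall>y\<in>ball x d \<inter> S. norm (c n * of_nat (Suc n) powr (- y)) \<le> h n)"
      using d by (intro exI[of _ d] exI[of _ "\<lambda>n. (1 / d + 1) * real (Suc n) powr (- (1 + d))"] conjI always_eventually allI ballI) auto
  qed
  then obtain g g' where g: "\<And>x. x \<in> S \<Longrightarrow> (\<lambda>n. c n * of_nat (Suc n) powr (- x)) sums g x"
    "\<And>x. x \<in> S \<Longrightarrow> (\<lambda>n. - (c n * of_real (ln (real (Suc n))) * of_nat (Suc n) powr (- x))) sums g' x"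
    "\<And>x. x \<in> S \<Longrightarrow> (g has_field_derivative g' x) (at x)" by blast
  have s: "s \<in> S" using assms by (simp add: S_def)
  have "((\<lambda>s. \<Sum>n. c n * of_nat (Suc n) powr (- s)) has_field_derivative g' s) (at s)"
    using g(3)[OF s] S s by (rule has_field_derivative_transform_within_open) (use g(1) in \<open>simp add: sums_iff\<close>)
  also have "g' s = (\<Sum>n. - (c n * of_real (ln (real (Suc n))) * of_nat (Suc n) powr (- s)))"
    using g(2)[OF s] by (simp add: sums_iff)
  finally show ?thesis .
qed

definition mangoldt_series :: "complex \<Rightarrow> complex" where
  "mangoldt_series s = (\<Sum>n. mangoldt (Suc n) * of_nat (Suc n) powr (- s))"

lemma norm_mangoldt_le: "norm (mangoldt (Suc n) :: complex) \<le> ln (real (Suc n)) + 1"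
proof -
  have "norm (mangoldt (Suc n) :: complex) = (mangoldt (Suc n) :: real)"
    using mangoldt_nonneg[of "Suc n"] by (metis abs_of_nonneg norm_of_real of_real_mangoldt)
  thus ?thesis using mangoldt_le[of "Suc n"] by simp
qed

lemma mangoldt_series_summable:
  "Re s > 1 \<Longrightarrow> summable (\<lambda>n. norm (mangoldt (Suc n) * of_nat (Suc n) powr (- s) :: complex))"
  by (rule dirichlet_series_summable[OF norm_mangoldt_le])

lemma mangoldt_series_holomorphic: "mangoldt_series holomorphic_on {s. Re s > 1}"
  unfolding mangoldt_series_def [abs_def]
  by (rule holomorphic_onI, rule field_differentiable_at_within, unfold field_differentiable_def)
     (use dirichlet_series_has_field_derivative[OF norm_mangoldt_le] in auto)

lemma has_sum_Suc_iff: "((\<lambda>n. f (Suc n)) has_sum S) UNIV \<longleftrightarrow> (f has_sum S) {0<..}"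
  by (rule has_sum_reindex_bij_witness[of _ "\<lambda>n. n - 1" Suc]) auto

text \<open>The convolution identity: \<Lambda> summed over the divisors of n is ln n. Both series
  converge absolutely, so their product is a sum over pairs, which may be regrouped by the product
  of the two indices.\<close>

lemma zeta_mult_mangoldt_series:
  assumes "Re s > 1"
  shows "(\<Sum>n. of_real (ln (real (Suc n))) * of_nat (Suc n) powr (- s)) = riemann_zeta s * mangoldt_series s"
proof -
  define f where "f = (\<lambda>n::nat. of_nat n powr (- s) :: complex)"
  define g where "g = (\<lambda>n::nat. mangoldt n * of_nat n powr (- s) :: complex)"
  have absf: "summable (\<lambda>n. norm (f (Suc n)))" unfolding f_def by (rule summable_norm_dirichlet[OF assms])
  have absg: "summable (\<lambda>n. norm (g (Suc n)))" unfolding g_def by (rule mangoldt_series_summable[OF assms])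
  have f: "(f has_sum riemann_zeta s) {0<..}" unfolding has_sum_Suc_iff[symmetric]
    by (rule norm_summable_imp_has_sum[OF absf])
       (use summable_norm_cancel[OF absf] riemann_zeta_dirichlet[OF assms] in \<open>simp add: f_def summable_sums\<close>)
  have g: "(g has_sum mangoldt_series s) {0<..}" unfolding has_sum_Suc_iff[symmetric]
    by (rule norm_summable_imp_has_sum[OF absg])
       (use summable_norm_cancel[OF absg] in \<open>simp add: g_def mangoldt_series_def summable_sums\<close>)
  have nf: "((\<lambda>n. norm (f n)) has_sum (\<Sum>n. norm (f (Suc n)))) {0<..}" unfolding has_sum_Suc_iff[symmetric]
    using absf by (intro norm_summable_imp_has_sum) (auto simp: summable_sums)
  have ng: "((\<lambda>n. norm (g n)) has_sum (\<Sum>n. norm (g (Suc n)))) {0<..}" unfolding has_sum_Suc_iff[symmetric]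
    using absg by (intro norm_summable_imp_has_sum) (auto simp: summable_sums)
  have "(\<lambda>x. norm (case x of (a, d) \<Rightarrow> f a * g d)) summable_on {0<..} \<times> {0<..}"
  proof (rule summable_on_SigmaI)
    show "((\<lambda>y. norm (case (x, y) of (a, d) \<Rightarrow> f a * g d)) has_sum norm (f x) * (\<Sum>n. norm (g (Suc n)))) {0<..}" for x
      using has_sum_cmult_right[OF ng, of "norm (f x)"] by (simp add: norm_mult)
    show "(\<lambda>x. norm (f x) * (\<Sum>n. norm (g (Suc n)))) summable_on {0<..}"
      using has_sum_cmult_left[OF nf] by (auto simp: summable_on_def)
  qed auto
  hence sm: "(\<lambda>(a, d). f a * g d) summable_on {0<..} \<times> {0<..}" by (rule abs_summable_summable)
  have "((\<lambda>(a, d). f a * g d) has_sum (riemann_zeta s * mangoldt_series s)) ({0<..} \<times> {0<..})"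
  proof (rule has_sum_SigmaI[OF _ _ sm])
    show "((\<lambda>y. case (x, y) of (a, d) \<Rightarrow> f a * g d) has_sum f x * mangoldt_series s) {0<..}" for x
      using has_sum_cmult_right[OF g, of "f x"] by simp
    show "((\<lambda>x. f x * mangoldt_series s) has_sum riemann_zeta s * mangoldt_series s) {0<..}"
      by (rule has_sum_cmult_left[OF f])
  qed
  \<comment> \<open>The pair (a, d) is encoded as the number n = a d together with its divisor
    d.\<close>
  also have "?this \<longleftrightarrow> ((\<lambda>(n, d). mangoldt d * of_nat n powr (- s)) has_sum (riemann_zeta s * mangoldt_series s)) (Sigma {0<..} (\<lambda>n. {d. d dvd n}))"
    by (rule has_sum_reindex_bij_witness[of _ "\<lambda>(n, d). (n div d, d)" "\<lambda>(a, d). (a * d, d)"])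
       (auto simp: f_def g_def powr_times_real intro!: Nat.gr0I)
  finally have "((\<lambda>(n, d). mangoldt d * of_nat n powr (- s)) has_sum (riemann_zeta s * mangoldt_series s)) (Sigma {0<..} (\<lambda>n. {d. d dvd n}))" .
  hence "((\<lambda>n. of_real (ln (real n)) * of_nat n powr (- s)) has_sum (riemann_zeta s * mangoldt_series s)) {0<..}"
  proof (rule has_sum_SigmaD)
    fix n :: nat assume n: "n \<in> {0<..}"
    have "((\<lambda>y. case (n, y) of (n, d) \<Rightarrow> mangoldt d * of_nat n powr (- s)) has_sum (\<Sum>d | d dvd n. mangoldt d * of_nat n powr (- s))) {d. d dvd n}"
      using has_sum_finite[of "{d. d dvd n}" "\<lambda>d. mangoldt d * of_nat n powr (- s)"] n by simp
    also have "(\<Sum>d | d dvd n. mangoldt d * of_nat n powr (- s)) = of_real (ln (real n)) * of_nat n powr (- s)"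
      using mangoldt_sum[of n, where 'a = complex] n by (simp flip: sum_distrib_right)
    finally show "((\<lambda>y. case (n, y) of (n, d) \<Rightarrow> mangoldt d * of_nat n powr (- s)) has_sum of_real (ln (real n)) * of_nat n powr (- s)) {d. d dvd n}" .
  qed
  hence "(\<lambda>n. of_real (ln (real (Suc n))) * of_nat (Suc n) powr (- s)) sums (riemann_zeta s * mangoldt_series s)"
    unfolding has_sum_Suc_iff[symmetric] by (rule has_sum_imp_sums)
  thus ?thesis by (rule sums_unique[symmetric])
qed

lemma riemann_zeta_has_field_derivative:
  assumes "Re s > 1"
  shows "(riemann_zeta has_field_derivative - (riemann_zeta s * mangoldt_series s)) (at s)"
proof -
  have "((\<lambda>s. \<Sum>n. 1 * of_nat (Suc n) powr (- s)) has_field_derivative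
            (\<Sum>n. - (1 * of_real (ln (real (Suc n))) * of_nat (Suc n) powr (- s)))) (at s)"
    by (rule dirichlet_series_has_field_derivative) (use assms in auto)
  hence "((\<lambda>s. \<Sum>n. of_nat (Suc n) powr (- s)) has_field_derivative
            (\<Sum>n. - (of_real (ln (real (Suc n))) * of_nat (Suc n) powr (- s)))) (at s)" by (simp only: mult_1_left)
  also have "(\<Sum>n. - (of_real (ln (real (Suc n))) * of_nat (Suc n) powr (- s))) = - (\<Sum>n. of_real (ln (real (Suc n))) * of_nat (Suc n) powr (- s))"
  proof (rule suminf_minus)
    show "summable (\<lambda>n. of_real (ln (real (Suc n))) * of_nat (Suc n) powr (- s) :: complex)"
      by (rule summable_norm_cancel, rule dirichlet_series_summable) (use assms in auto)
  qed
  also have "\<dots> = - (riemann_zeta s * mangoldt_series s)" using zeta_mult_mangoldt_series[OF assms] by simp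
  finally show ?thesis
    by (rule has_field_derivative_transform_within_open[of _ _ _ "{s. Re s > 1}"])
       (use assms riemann_zeta_dirichlet in \<open>auto simp: open_halfspace_Re_gt\<close>)
qed

text \<open>The terms after the first add up to at most zeta(2) - 1 < 3/4. The bound is wanted at
  the points 2 + it, the centres of the discs on which the logarithmic derivative is
  estimated.\<close>

lemma riemann_zeta_norm_ge:
  assumes "Re s \<ge> 2"
  shows "norm (riemann_zeta s) \<ge> 1 / 4"
proof -
  define f where "f = (\<lambda>n. of_nat (Suc n) powr (- s) :: complex)"
  have s: "summable (\<lambda>n. norm (f n))" unfolding f_def using assms by (intro summable_norm_dirichlet) auto
  have p: "summable (\<lambda>n. real (Suc n) powr (-2))" using summable_Suc_powr[of 2] by simp
  have "riemann_zeta s = (\<Sum>n. f n)" unfolding f_def using assms by (intro riemann_zeta_dirichlet) auto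
  also have "\<dots> = (\<Sum>n. f (Suc n)) + f 0" using suminf_split_head[OF summable_norm_cancel[OF s]] by simp
  also have "f 0 = 1" by (simp add: f_def)
  finally have 1: "riemann_zeta s = (\<Sum>n. f (Suc n)) + 1" .
  have "norm (\<Sum>n. f (Suc n)) \<le> (\<Sum>n. norm (f (Suc n)))"
    using s by (intro summable_norm) (simp add: summable_Suc_iff[where f = "\<lambda>n. norm (f n)"])
  also have "\<dots> \<le> (\<Sum>n. real (Suc (Suc n)) powr (-2))"
  proof (rule suminf_le)
    show "norm (f (Suc n)) \<le> real (Suc (Suc n)) powr (-2)" for n
      unfolding f_def norm_of_nat_Suc_powr using assms by (intro powr_mono) auto
    show "summable (\<lambda>n. norm (f (Suc n)))" using s by (simp add: summable_Suc_iff[where f = "\<lambda>n. norm (f n)"])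
    show "summable (\<lambda>n. real (Suc (Suc n)) powr (-2))"
      using p summable_Suc_iff[where f = "\<lambda>n. real (Suc n) powr (-2)"] by simp
  qed
  also have "(\<Sum>n. real (Suc (Suc n)) powr (-2)) = (\<Sum>n. real (Suc n) powr (-2)) - 1"
    using suminf_split_head[OF p] by simp
  finally have "norm (\<Sum>n. f (Suc n)) \<le> 3 / 4" using sum_inverse_squares_le by simp
  moreover have "norm (1::complex) \<le> norm (riemann_zeta s) + norm (\<Sum>n. f (Suc n))"
    unfolding 1 using norm_triangle_ineq4[of "(\<Sum>n. f (Suc n)) + 1" "\<Sum>n. f (Suc n)"] by simp
  ultimately show ?thesis by simp
qed

text \<open>Since zeta' = -zeta times \<open>mangoldt_series\<close>, multiplying zeta by the
  exponential of a primitive of that series gives a function with derivative zero. It is constant,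
  and nonzero at s = 2. The differential equation thus takes the place of the Euler product.\<close>

lemma riemann_zeta_nonzero:
  assumes "Re s > 1"
  shows "riemann_zeta s \<noteq> 0"
proof -
  define S where "S = {s. Re s > 1}"
  have S: "open S" "convex S" unfolding S_def by (simp_all add: open_halfspace_Re_gt convex_halfspace_Re_gt)
  obtain E where E: "\<And>x. x \<in> S \<Longrightarrow> (E has_field_derivative mangoldt_series x) (at x)"
    using holomorphic_convex_primitive'[OF S(2) S(1) mangoldt_series_holomorphic[folded S_def]] S(1)
    by (metis at_within_open)
  have "((\<lambda>s. riemann_zeta s * exp (E s)) has_field_derivative 0) (at x)" if "x \<in> S" for x
  proof -
    have "((\<lambda>s. riemann_zeta s * exp (E s)) has_field_derivative
      (- (riemann_zeta x * mangoldt_series x)) * exp (E x) + (exp (E x) * mangoldt_series x) * riemann_zeta x) (at x)"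
      using that by (intro DERIV_mult DERIV_fun_exp E riemann_zeta_has_field_derivative) (auto simp: S_def)
    thus ?thesis by (simp add: mult_ac)
  qed
  hence "\<exists>c. \<forall>x\<in>S. riemann_zeta x * exp (E x) = c"
    using S has_field_derivative_at_within by (intro has_field_derivative_zero_constant) blast+
  then obtain c where c: "\<And>x. x \<in> S \<Longrightarrow> riemann_zeta x * exp (E x) = c" by blast
  have "riemann_zeta 2 * exp (E 2) \<noteq> 0" using riemann_zeta_norm_ge[of 2] by force
  hence "riemann_zeta s * exp (E s) \<noteq> 0" using c[of 2] c[of s] assms by (auto simp: S_def)
  thus ?thesis by auto
qed

section \<open>Bounds for logarithmic derivatives\<close>

text \<open>The factors \<open>u p\<close> stay general because the rule is applied twice: to s - p
  and to the Blaschke factors that replace it.\<close>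

lemma log_derivative_prod_mult:
  fixes u :: "'a \<Rightarrow> complex \<Rightarrow> complex"
  assumes "finite Z" "\<And>p. p \<in> Z \<Longrightarrow> (u p has_field_derivative u' p) (at s)" "\<And>p. p \<in> Z \<Longrightarrow> u p s \<noteq> 0"
    "(g has_field_derivative g') (at s)" "g s \<noteq> 0"
  shows "((\<lambda>s. (\<Prod>p\<in>Z. u p s ^ m p) * g s) has_field_derivative
     ((\<Prod>p\<in>Z. u p s ^ m p) * g s) * ((\<Sum>p\<in>Z. of_nat (m p) * u' p / u p s) + g' / g s)) (at s)"
  using assms(1-3)
proof (induction Z rule: finite_induct)
  case empty
  thus ?case using assms(4,5) by simp
next
  case (insert p Z)
  have "((\<lambda>s. u p s ^ m p) has_field_derivative of_nat (m p) * (u' p * u p s ^ (m p - Suc 0))) (at s)"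
    using insert.prems(1)[of p] by (auto intro!: derivative_eq_intros)
  also have "of_nat (m p) * (u' p * u p s ^ (m p - Suc 0)) = u p s ^ m p * (of_nat (m p) * u' p / u p s)"
    using insert.prems(2)[of p] by (cases "m p") auto
  finally have 1: "((\<lambda>s. u p s ^ m p) has_field_derivative u p s ^ m p * (of_nat (m p) * u' p / u p s)) (at s)" .
  have D: "((\<lambda>s. u p s ^ m p * ((\<Prod>p\<in>Z. u p s ^ m p) * g s)) has_field_derivative
      (u p s ^ m p * (of_nat (m p) * u' p / u p s)) * ((\<Prod>p\<in>Z. u p s ^ m p) * g s) +
      (((\<Prod>p\<in>Z. u p s ^ m p) * g s) * ((\<Sum>p\<in>Z. of_nat (m p) * u' p / u p s) + g' / g s)) * u p s ^ m p) (at s)"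
    using insert by (intro DERIV_mult 1 insert.IH) auto
  have fe: "(\<lambda>s. (\<Prod>p\<in>insert p Z. u p s ^ m p) * g s) = (\<lambda>s. u p s ^ m p * ((\<Prod>p\<in>Z. u p s ^ m p) * g s))"
    using insert.hyps by (simp add: mult.assoc)
  have al: "A * x * Q + Q * (S + y) * A = A * Q * (x + S + y)" for A x Q S y :: complex
    by (simp add: algebra_simps)
  show ?case unfolding fe
    by (rule DERIV_cong[OF D], subst al, simp only: prod.insert[OF insert.hyps] sum.insert[OF insert.hyps] mult.assoc)
qed

lemma zorder_prod_powers:
  assumes "finite Z" "q \<in> Z"
  shows "zorder (\<lambda>s. \<Prod>p\<in>Z. (s - p) ^ m p) q = int (m q)"
proof (rule zorder_eqI[of UNIV q "\<lambda>s. \<Prod>p\<in>Z - {q}. (s - p) ^ m p"])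
  show "(\<lambda>s. \<Prod>p\<in>Z - {q}. (s - p) ^ m p) holomorphic_on UNIV" by (intro holomorphic_intros)
  show "(\<Prod>p\<in>Z - {q}. (q - p) ^ m p) \<noteq> 0" using assms by auto
  show "(\<Prod>p\<in>Z. (w - p) ^ m p) = (\<Prod>p\<in>Z - {q}. (w - p) ^ m p) * (w - q) powi int (m q)" for w
    using prod.remove[OF assms, of "\<lambda>p. (w - p) ^ m p"] by (simp add: mult.commute)
qed auto

text \<open>A polynomial with the same zeros and orders as f in A is divided out, leaving a
  zero-free quotient; the factors for the zeros outside Z are then multiplied back into g.\<close>

lemma holomorphic_factor_finite_zeros:
  assumes holf: "f holomorphic_on A" and A: "open A" "connected A" and w: "w \<in> A" "f w \<noteq> 0"
    and fin: "finite {s\<in>A. f s = 0}" and Z: "Z \<subseteq> {s\<in>A. f s = 0}"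
  obtains g where "g holomorphic_on A" "\<And>s. s \<in> A \<Longrightarrow> f s = (\<Prod>p\<in>Z. (s - p) ^ nat (zorder f p)) * g s"
    "\<And>s. s \<in> A \<Longrightarrow> g s = 0 \<longleftrightarrow> f s = 0 \<and> s \<notin> Z" "\<And>p. p \<in> Z \<Longrightarrow> zorder f p > 0"
proof -
  define Z1 where "Z1 = {s\<in>A. f s = 0}"
  define m where "m = (\<lambda>p. nat (zorder f p))"
  define F where "F = (\<lambda>s. \<Prod>p\<in>Z1. (s - p) ^ m p)"
  have ana: "f analytic_on {z}" if "z \<in> A" for z using that A holf analytic_at by blast
  have freq: "\<exists>\<^sub>F u in at z. f u \<noteq> 0" if "z \<in> A" for z
    by (rule eventually_frequently) (use non_zero_neighbour_alt[OF holf A that w] in \<open>auto elim: eventually_mono\<close>)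
  have pos: "zorder f z > 0" if "z \<in> Z1" for z
    using that zorder_pos_iff'[OF ana freq, of z] by (auto simp: Z1_def)
  have F0: "F s = 0 \<longleftrightarrow> s \<in> Z1" for s
    using fin pos by (auto simp: F_def Z1_def m_def)
  have holF: "F holomorphic_on A" unfolding F_def by (intro holomorphic_intros)
  have zo: "zorder F z = zorder f z" if "z \<in> A" for z
  proof (cases "z \<in> Z1")
    case True
    have "zorder F z = int (m z)" unfolding F_def using fin True by (intro zorder_prod_powers) (auto simp: Z1_def)
    thus ?thesis using pos[OF True] by (simp add: m_def)
  next
    case False
    have "F analytic_on {z}" using that A holF analytic_at by blast
    hence "zorder F z = 0" using F0[of z] False by (intro zorder_eq_0I) auto
    moreover have "zorder f z = 0" using False that by (intro zorder_eq_0I ana) (auto simp: Z1_def)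
    ultimately show ?thesis by simp
  qed
  have zeq: "F z = 0 \<longleftrightarrow> f z = 0" if "z \<in> A" for z using F0[of z] that by (simp add: Z1_def)
  obtain h where h: "h holomorphic_on A" "\<And>z. z \<in> A \<Longrightarrow> h z \<noteq> 0" "\<And>z. z \<in> A \<Longrightarrow> f z = h z * F z"
    using holomorphic_zorder_factorization[OF holf A holF zeq zo] by metis
  show ?thesis
  proof (rule that[of "\<lambda>s. (\<Prod>p\<in>Z1 - Z. (s - p) ^ m p) * h s"])
    show "(\<lambda>s. (\<Prod>p\<in>Z1 - Z. (s - p) ^ m p) * h s) holomorphic_on A" using h by (intro holomorphic_intros)
    have sp: "F s = (\<Prod>p\<in>Z. (s - p) ^ m p) * (\<Prod>p\<in>Z1 - Z. (s - p) ^ m p)" for s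
      unfolding F_def using fin Z by (subst prod.subset_diff[of Z Z1]) (auto simp: Z1_def mult.commute)
    show "f s = (\<Prod>p\<in>Z. (s - p) ^ nat (zorder f p)) * ((\<Prod>p\<in>Z1 - Z. (s - p) ^ m p) * h s)" if "s \<in> A" for s
      using h(3)[OF that] sp[of s] by (simp add: m_def mult_ac)
    show "(\<Prod>p\<in>Z1 - Z. (s - p) ^ m p) * h s = 0 \<longleftrightarrow> f s = 0 \<and> s \<notin> Z" if "s \<in> A" for s
      using that h(2)[OF that] fin pos by (auto simp: Z1_def m_def)
    show "zorder f p > 0" if "p \<in> Z" for p using pos[of p] that Z by (auto simp: Z1_def)
  qed
qed

text \<open>The map y -> y / (2M - y) fixes 0 and sends the half-plane Re y < M into the unit disc,
  so the Schwarz lemma applies to its composition with \<phi>, rescaled to the unit disc.\<close>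

lemma Borel_Caratheodory_zero:
  assumes hol: "\<phi> holomorphic_on ball c r" and r: "r > 0" and 0: "\<phi> c = 0" and M: "M > 0"
    and le: "\<And>s. s \<in> ball c r \<Longrightarrow> Re (\<phi> s) < M" and s: "s \<in> ball c r" and t: "norm (s - c) \<le> t" "t < r"
  shows "norm (\<phi> s) \<le> 2 * M * t / (r - t)"
proof -
  define \<psi> where "\<psi> = (\<lambda>x. \<phi> (c + of_real r * x) / (2 * of_real M - \<phi> (c + of_real r * x)))"
  have img: "c + of_real r * x \<in> ball c r" if "norm x < 1" for x
    using that r by (simp add: dist_norm norm_mult)
  have nz: "2 * of_real M - \<phi> y \<noteq> 0" if "y \<in> ball c r" for y
  proof
    assume "2 * of_real M - \<phi> y = 0"
    hence "Re (2 * of_real M - \<phi> y) = 0" by simp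
    thus False using le[OF that] M by simp
  qed
  have "\<phi> \<circ> (\<lambda>x. c + of_real r * x) holomorphic_on ball 0 1"
    by (intro holomorphic_on_compose holomorphic_intros holomorphic_on_subset[OF hol]) (use img in auto)
  hence "\<psi> holomorphic_on ball 0 1" unfolding \<psi>_def o_def using nz img by (intro holomorphic_intros) auto
  moreover have "\<psi> 0 = 0" by (simp add: \<psi>_def 0)
  moreover have "norm (\<psi> x) < 1" if "norm x < 1" for x
  proof -
    define y where "y = \<phi> (c + of_real r * x)"
    have y: "Re y < M" "2 * of_real M - y \<noteq> 0" using le[OF img[OF that]] nz[OF img[OF that]] by (simp_all add: y_def)
    have "(norm y)\<^sup>2 < (norm (2 * of_real M - y))\<^sup>2"
    proof -
      have "(norm (2 * of_real M - y))\<^sup>2 - (norm y)\<^sup>2 = 4 * M * (M - Re y)"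
        unfolding cmod_power2 by (simp add: power2_eq_square algebra_simps)
      moreover have "4 * M * (M - Re y) > 0" using M y by simp
      ultimately show ?thesis by linarith
    qed
    hence "norm y < norm (2 * of_real M - y)" by (rule power2_less_imp_less) simp
    thus ?thesis using y by (simp add: \<psi>_def y_def[symmetric] norm_divide)
  qed
  ultimately have SL: "norm (\<psi> x) \<le> norm x" if "norm x < 1" for x
    using Schwarz_Lemma(1)[of \<psi> x] that by blast
  define x where "x = (s - c) / of_real r"
  have x: "norm x < 1" "c + of_real r * x = s" "norm x \<le> t / r"
    using s r t by (auto simp: x_def norm_divide dist_norm norm_minus_commute divide_simps)
  have "norm (\<phi> s / (2 * of_real M - \<phi> s)) \<le> t / r" using SL[OF x(1)] x by (simp add: \<psi>_def)
  hence "norm (\<phi> s) * r \<le> t * norm (2 * of_real M - \<phi> s)"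
    using nz[OF s] r by (simp add: norm_divide divide_simps)
  also have "\<dots> \<le> t * (2 * M + norm (\<phi> s))"
    using norm_triangle_ineq4[of "2 * of_real M" "\<phi> s"] M t norm_ge_zero[of "s - c"]
    by (intro mult_left_mono) (auto simp: norm_mult intro: order_trans[OF norm_ge_zero t(1)])
  finally have "norm (\<phi> s) * (r - t) \<le> 2 * M * t" by (simp add: algebra_simps)
  thus ?thesis using t by (simp add: divide_simps)
qed

text \<open>Cauchy's inequality on the circle of radius (r - r')/2 about s. That circle stays within
  (r + r')/2 of c, where the previous bound is available with denominator (r - r')/2.\<close>

lemma Borel_Caratheodory_deriv_zero:
  assumes hol: "\<phi> holomorphic_on ball c r" and 0: "\<phi> c = 0" and M: "M > 0"
    and le: "\<And>s. s \<in> ball c r \<Longrightarrow> Re (\<phi> s) < M" and s: "norm (s - c) \<le> r'" "r' < r"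
  shows "norm (deriv \<phi> s) \<le> 8 * M * r / (r - r')\<^sup>2"
proof -
  define e where "e = (r - r') / 2"
  have e: "e > 0" "r' + e < r" "r' + e = r - e" "r' \<ge> 0" "r > 0" using s norm_ge_zero[of "s - c"] by (auto simp: e_def field_simps intro: order_trans[OF norm_ge_zero s(1)] simp del: norm_ge_zero)
  have sub: "norm (x - c) \<le> r' + e" if "x \<in> cball s e" for x
    using that s norm_triangle_ineq[of "x - s" "s - c"] by (auto simp: dist_norm norm_minus_commute)
  have in': "x \<in> ball c r" if "x \<in> cball s e" for x
    using sub[OF that] e by (simp add: dist_norm norm_minus_commute)
  have "norm ((deriv ^^ 1) \<phi> s) \<le> fact 1 * (2 * M * (r' + e) / (r - (r' + e))) / e ^ 1"
  proof (rule Cauchy_inequality)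
    show "\<phi> holomorphic_on ball s e" by (rule holomorphic_on_subset[OF hol]) (use in' in auto)
    show "continuous_on (cball s e) \<phi>"
      by (rule holomorphic_on_imp_continuous_on, rule holomorphic_on_subset[OF hol]) (use in' in auto)
    show "norm (\<phi> x) \<le> 2 * M * (r' + e) / (r - (r' + e))" if "norm (s - x) = e" for x
      using that sub[of x] in'[of x] e
      by (intro Borel_Caratheodory_zero[OF hol _ 0 M le]) (auto simp: dist_norm)
  qed (use e in auto)
  also have "\<dots> = 2 * M * (r' + e) / e\<^sup>2" unfolding e(3) by (simp add: power2_eq_square)
  also have "\<dots> \<le> 2 * M * r / e\<^sup>2" using e M by (intro divide_right_mono mult_left_mono) auto
  also have "\<dots> = 8 * M * r / (r - r')\<^sup>2" by (simp add: e_def power_divide)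
  finally show ?thesis by simp
qed

lemma holomorphic_ball_finite_zeros:
  assumes "f holomorphic_on ball c R1" "R < R1" "f c \<noteq> 0"
  shows "finite {s\<in>cball c R. f s = 0}"
proof (cases "f constant_on ball c R1 \<or> R < 0")
  case True
  thus ?thesis
  proof
    assume "f constant_on ball c R1"
    then obtain y where y: "\<And>s. s \<in> ball c R1 \<Longrightarrow> f s = y" by (auto simp: constant_on_def)
    show ?thesis
    proof (cases "R < 0")
      case False
      hence "y \<noteq> 0" using y[of c] assms by auto
      hence "{s\<in>cball c R. f s = 0} = {}" using y assms(2) by fastforce
      thus ?thesis by (simp only: finite.emptyI)
    qed auto
  qed auto
next
  case False
  thus ?thesis using assms by (intro holomorphic_compact_finite_zeros[of f "ball c R1"]) auto
qed

text \<open>On the circle R^2 = (s - c) cnj (s - c), so the numerator factors as (s - c) cnj (s -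
  p). Replacing s - p by this quotient therefore leaves moduli on the circle unchanged.\<close>

lemma Blaschke_norm_sphere:
  assumes "norm (s - c) = R" "R > 0"
  shows "norm ((of_real (R\<^sup>2) - cnj (p - c) * (s - c)) / of_real R) = norm (s - p)"
proof -
  have "of_real (R\<^sup>2) - cnj (p - c) * (s - c) = (s - c) * cnj (s - p)"
    using complex_norm_square[of "s - c"] assms(1) by (simp add: algebra_simps)
  thus ?thesis using assms by (simp add: norm_mult norm_divide del: complex_cnj_diff)
qed

text \<open>Landau: divide out the zeros in \<open>Z\<close> by Blaschke factors, then apply Borel--Caratheodory
  to the logarithm of the quotient.\<close>

lemma log_derivative_bound:
  fixes f :: "complex \<Rightarrow> complex"
  assumes rr: "0 < r'" "r' < r" "r < R" "R < R1"
    and hol: "f holomorphic_on ball c R1" and B: "\<And>s. s \<in> ball c R1 \<Longrightarrow> norm (f s) \<le> B"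
    and fc: "f c \<noteq> 0" and M: "ln (B / norm (f c)) < M"
  defines "Z \<equiv> {s\<in>cball c r. f s = 0}"
  shows "finite Z" and "(\<Sum>p\<in>Z. real_of_int (zorder f p)) \<le> M / ln (R / r)"
    and "\<And>p. p \<in> Z \<Longrightarrow> zorder f p > 0"
    and "\<And>s \<delta>. norm (s - c) \<le> r' \<Longrightarrow> \<delta> > 0 \<Longrightarrow> (\<And>p. p \<in> Z \<Longrightarrow> norm (s - p) \<ge> \<delta>) \<Longrightarrow>
       norm (deriv f s / f s) \<le> 8 * M * r / (r - r')\<^sup>2 + M / ln (R / r) * (1 / \<delta> + r / (R\<^sup>2 - r\<^sup>2))"
proof -
  show finZ: "finite Z" unfolding Z_def using rr by (intro holomorphic_ball_finite_zeros[OF hol _ fc]) auto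
  \<comment> \<open>A radius strictly between R and R1: the open disc A contains the closed disc of
    radius R, and its closure lies where f is holomorphic, so f has finitely many zeros in
    A.\<close>
  define R2 where "R2 = (R + R1) / 2"
  have R2: "R < R2" "R2 < R1" using rr by (auto simp: R2_def)
  define A where "A = ball c R2"
  have A: "open A" "connected A" by (simp_all add: A_def)
  have cA: "c \<in> A" using rr R2 by (simp add: A_def)
  have holA: "f holomorphic_on A" by (rule holomorphic_on_subset[OF hol]) (use R2 in \<open>auto simp: A_def\<close>)
  have "finite {s\<in>cball c R2. f s = 0}" using R2 by (intro holomorphic_ball_finite_zeros[OF hol _ fc]) auto
  hence fin: "finite {s\<in>A. f s = 0}" by (rule finite_subset[rotated]) (auto simp: A_def)
  have ZA: "Z \<subseteq> {s\<in>A. f s = 0}" using rr R2 by (auto simp: Z_def A_def)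
  define m where "m = (\<lambda>p. nat (zorder f p))"
  obtain g where g1: "g holomorphic_on A" "\<And>s. s \<in> A \<Longrightarrow> f s = (\<Prod>p\<in>Z. (s - p) ^ nat (zorder f p)) * g s"
    "\<And>s. s \<in> A \<Longrightarrow> g s = 0 \<longleftrightarrow> f s = 0 \<and> s \<notin> Z" and pos: "\<And>p. p \<in> Z \<Longrightarrow> zorder f p > 0"
    by (fact holomorphic_factor_finite_zeros[OF holA A cA fc fin ZA])
  have m': "m p = nat (zorder f p)" for p by (simp add: m_def)
  note g = g1[folded m']
  show "zorder f p > 0" if "p \<in> Z" for p using pos[OF that] .
  define N where "N = (\<Sum>p\<in>Z. m p)"
  have N: "(\<Sum>p\<in>Z. real_of_int (zorder f p)) = real N"
    unfolding N_def of_nat_sum using pos by (intro sum.cong) (auto simp: m_def less_imp_le)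
  \<comment> \<open>Each factor s - p of f is replaced by this quotient, which has the same modulus
    on the circle of radius R but no zero in the disc of radius r. Hence G inherits the bound B by
    the maximum principle.\<close>
  define u where "u = (\<lambda>p s. (of_real (R\<^sup>2) - cnj (p - c) * (s - c)) / of_real R)"
  define G where "G = (\<lambda>s. (\<Prod>p\<in>Z. u p s ^ m p) * g s)"
  have holG: "G holomorphic_on A" unfolding G_def u_def using rr by (intro holomorphic_intros g) auto
  have Zr: "norm (p - c) \<le> r" if "p \<in> Z" for p using that by (simp add: Z_def dist_norm norm_minus_commute)
  have Gs: "norm (G s) \<le> B" if "s \<in> cball c R" for s
  proof (rule maximum_modulus_frontier[of G "cball c R"])
    show "G holomorphic_on interior (cball c R)"
      by (rule holomorphic_on_subset[OF holG]) (use R2 in \<open>auto simp: A_def\<close>)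
    show "continuous_on (closure (cball c R)) G"
      by (rule holomorphic_on_imp_continuous_on, rule holomorphic_on_subset[OF holG]) (use R2 in \<open>auto simp: A_def\<close>)
    show "norm (G z) \<le> B" if "z \<in> frontier (cball c R)" for z
    proof -
      have z: "norm (z - c) = R" using that rr by (simp add: frontier_cball dist_norm norm_minus_commute)
      have zA: "z \<in> A" using z R2 by (simp add: A_def dist_norm norm_minus_commute)
      have "norm (G z) = norm (f z)"
        unfolding G_def g(2)[OF zA] u_def norm_mult prod_norm[symmetric] norm_power
        using Blaschke_norm_sphere[OF z] rr by simp
      thus ?thesis using B[of z] zA R2 by (simp add: A_def)
    qed
  qed (use that in auto)
  have gc: "g c \<noteq> 0" using g(3)[OF cA] fc by simp
  \<comment> \<open>At the centre each Blaschke factor has modulus R, whereas |c - p| \<le> r. The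
    resulting gain (R/r)^N bounds the number N of zeros, as in Jensen's formula.\<close>
  have "norm (G c) = R ^ N * norm (g c)"
    unfolding G_def u_def N_def norm_mult prod_norm[symmetric] norm_power using rr
    by (simp add: power_sum norm_divide power2_eq_square)
  moreover have fr: "norm (f c) \<le> r ^ N * norm (g c)"
  proof -
    have "(\<Prod>p\<in>Z. norm (c - p) ^ m p) \<le> (\<Prod>p\<in>Z. r ^ m p)"
      using Zr by (intro prod_mono) (auto intro!: power_mono simp: norm_minus_commute)
    thus ?thesis unfolding g(2)[OF cA] norm_mult prod_norm[symmetric] norm_power N_def power_sum
      by (intro mult_right_mono) auto
  qed
  ultimately have Gc: "norm (f c) * (R / r) ^ N \<le> norm (G c)"
  proof -
    have "norm (f c) * (R / r) ^ N \<le> r ^ N * norm (g c) * (R / r) ^ N"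
      using fr rr by (intro mult_right_mono) auto
    also have "\<dots> = R ^ N * norm (g c)" using rr by (simp add: power_divide)
    finally show ?thesis using \<open>norm (G c) = R ^ N * norm (g c)\<close> by simp
  qed
  have lR: "ln (R / r) > 0" using rr by simp
  have fc0: "norm (f c) > 0" using fc by simp
  have q1: "(R / r) ^ N \<ge> 1" using rr by (intro one_le_power) auto
  have Gc_ge: "norm (f c) \<le> norm (G c)"
    using Gc mult_left_mono[OF q1, of "norm (f c)"] by simp
  have GcB: "norm (G c) \<le> B" using Gs[of c] rr by simp
  have Bpos: "B > 0" using GcB Gc_ge fc0 by linarith
  have "(R / r) ^ N \<le> B / norm (f c)" using Gc GcB fc0 by (simp add: field_simps)
  hence "ln ((R / r) ^ N) \<le> ln (B / norm (f c))" using rr fc0 Bpos by (subst ln_le_cancel_iff) auto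
  hence NM0: "real N * ln (R / r) \<le> ln (B / norm (f c))" using rr by (simp add: ln_realpow)
  moreover have "real N * ln (R / r) \<ge> 0" using lR by simp
  ultimately have Mpos: "M > 0" and "real N * ln (R / r) \<le> M" using M by linarith+
  hence NM: "real N \<le> M / ln (R / r)" using lR by (simp add: field_simps)
  thus "(\<Sum>p\<in>Z. real_of_int (zorder f p)) \<le> M / ln (R / r)" unfolding N .
  have u0: "u p s \<noteq> 0" and ub: "norm (cnj (p - c) / (of_real (R\<^sup>2) - cnj (p - c) * (s - c))) \<le> r / (R\<^sup>2 - r\<^sup>2)"
    if "p \<in> Z" "s \<in> ball c r" for p s
  proof -
    have "norm (cnj (p - c) * (s - c)) \<le> r * r"
      unfolding norm_mult complex_mod_cnj using Zr[OF that(1)] that(2) rr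
      by (intro mult_mono) (auto simp: dist_norm norm_minus_commute)
    moreover have "norm (complex_of_real (R\<^sup>2)) - norm (cnj (p - c) * (s - c)) \<le> norm (of_real (R\<^sup>2) - cnj (p - c) * (s - c))"
      by (rule norm_triangle_ineq2)
    moreover have "norm (complex_of_real (R\<^sup>2)) = R\<^sup>2" by (simp only: norm_of_real) simp
    ultimately have 1: "R\<^sup>2 - r\<^sup>2 \<le> norm (of_real (R\<^sup>2) - cnj (p - c) * (s - c))" by (simp add: power2_eq_square)
    have 2: "R\<^sup>2 - r\<^sup>2 > 0" using rr by (simp add: power_strict_mono)
    show "u p s \<noteq> 0" using 1 2 rr by (auto simp: u_def)
    show "norm (cnj (p - c) / (of_real (R\<^sup>2) - cnj (p - c) * (s - c))) \<le> r / (R\<^sup>2 - r\<^sup>2)"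
      unfolding norm_divide complex_mod_cnj using 1 2 Zr[OF that(1)] rr by (intro frac_le) auto
  qed
  have sub: "ball c r \<subseteq> A" using rr R2 by (auto simp: A_def)
  have g0: "g s \<noteq> 0" if "s \<in> ball c r" for s
    using that g(3)[of s] sub by (auto simp: Z_def)
  have G0: "G s \<noteq> 0" if "s \<in> ball c r" for s
    using that u0[OF _ that] g0[OF that] finZ by (auto simp: G_def)
  obtain \<phi> where \<phi>: "\<phi> holomorphic_on ball c r" "\<And>s. s \<in> ball c r \<Longrightarrow> exp (\<phi> s) = G s"
    by (rule holomorphic_logarithm_exists[of "ball c r" G c])
       (use G0 holomorphic_on_subset[OF holG sub] rr in auto)
  have cr: "c \<in> ball c r" using rr by simp
  have Re\<phi>: "Re (\<phi> s) = ln (norm (G s))" if "s \<in> ball c r" for s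
    using \<phi>(2)[OF that] G0[OF that] by (metis ln_exp norm_exp_eq_Re)
  have bound: "norm (deriv (\<lambda>s. \<phi> s - \<phi> c) s) \<le> 8 * M * r / (r - r')\<^sup>2" if "norm (s - c) \<le> r'" for s
  proof (rule Borel_Caratheodory_deriv_zero[where c = c])
    show "Re (\<phi> s - \<phi> c) < M" if "s \<in> ball c r" for s
    proof -
      have "ln (norm (G s)) \<le> ln B" using Gs[of s] that rr G0[OF that] Bpos by (subst ln_le_cancel_iff) auto
      moreover have "ln (norm (f c)) \<le> ln (norm (G c))" using Gc_ge fc0 by (subst ln_le_cancel_iff) auto
      ultimately show ?thesis using M Bpos fc0 by (simp add: Re\<phi>[OF that] Re\<phi>[OF cr] ln_div)
    qed
  qed (use that rr Mpos \<phi> in \<open>auto intro!: holomorphic_intros\<close>)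
  fix s \<delta> assume s: "norm (s - c) \<le> r'" and \<delta>: "\<delta> > 0" and far: "\<And>p. p \<in> Z \<Longrightarrow> norm (s - p) \<ge> \<delta>"
  have sr: "s \<in> ball c r" using s rr by (simp add: dist_norm norm_minus_commute)
  have sA: "s \<in> A" using sr sub by blast
  define L where "L = deriv g s / g s"
  have dg: "(g has_field_derivative deriv g s) (at s)" using g(1) A(1) sA by (rule holomorphic_derivI)
  have d\<phi>: "(\<phi> has_field_derivative deriv \<phi> s) (at s)" using \<phi>(1) open_ball sr by (rule holomorphic_derivI)
  have snZ: "s \<noteq> p" if "p \<in> Z" for p using far[OF that] \<delta> by auto
  have fs0: "f s \<noteq> 0"
  proof
    assume "f s = 0"
    hence "s \<in> Z" using sr by (simp add: Z_def)
    thus False using snZ by blast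
  qed
  have "(G has_field_derivative G s * ((\<Sum>p\<in>Z. of_nat (m p) * (- cnj (p - c) / of_real R) / u p s) + deriv g s / g s)) (at s)"
    unfolding G_def
  proof (rule log_derivative_prod_mult)
    show "(u p has_field_derivative - cnj (p - c) / of_real R) (at s)" for p
      unfolding u_def using rr by (auto intro!: derivative_eq_intros)
  qed (use finZ u0 sr g0 dg in auto)
  moreover have "(G has_field_derivative G s * deriv \<phi> s) (at s)"
  proof -
    have "((\<lambda>s. exp (\<phi> s)) has_field_derivative exp (\<phi> s) * deriv \<phi> s) (at s)"
      by (rule DERIV_fun_exp[OF d\<phi>])
    hence "((\<lambda>s. exp (\<phi> s)) has_field_derivative G s * deriv \<phi> s) (at s)" using \<phi>(2)[OF sr] by simp
    thus ?thesis by (rule has_field_derivative_transform_within_open[OF _ open_ball sr]) (rule \<phi>(2))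
  qed
  ultimately have "G s * ((\<Sum>p\<in>Z. of_nat (m p) * (- cnj (p - c) / of_real R) / u p s) + L) = G s * deriv \<phi> s"
    unfolding L_def by (rule DERIV_unique)
  hence e1: "(\<Sum>p\<in>Z. of_nat (m p) * (- cnj (p - c) / of_real R) / u p s) + L = deriv \<phi> s" using G0[OF sr] by simp
  have "((\<lambda>s. (\<Prod>p\<in>Z. (s - p) ^ m p) * g s) has_field_derivative ((\<Prod>p\<in>Z. (s - p) ^ m p) * g s) * ((\<Sum>p\<in>Z. of_nat (m p) * 1 / (s - p)) + deriv g s / g s)) (at s)"
    by (rule log_derivative_prod_mult) (use finZ snZ g0[OF sr] dg in \<open>auto intro!: derivative_eq_intros\<close>)
  hence "((\<lambda>s. (\<Prod>p\<in>Z. (s - p) ^ m p) * g s) has_field_derivative f s * ((\<Sum>p\<in>Z. of_nat (m p) * 1 / (s - p)) + L)) (at s)"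
    unfolding L_def g(2)[OF sA] .
  hence "(f has_field_derivative f s * ((\<Sum>p\<in>Z. of_nat (m p) * 1 / (s - p)) + L)) (at s)"
    by (rule has_field_derivative_transform_within_open[OF _ A(1) sA]) (simp add: g(2))
  hence "deriv f s / f s = (\<Sum>p\<in>Z. of_nat (m p) * 1 / (s - p)) + L" using fs0 by (simp add: DERIV_imp_deriv)
  \<comment> \<open>\<open>L\<close>, the logarithmic derivative of g, is eliminated between the
    formulas for G and for f. Each zero leaves 1/(s - p) and a bounded term from its Blaschke
    factor.\<close>
  also have "\<dots> = deriv \<phi> s + (\<Sum>p\<in>Z. of_nat (m p) * (1 / (s - p) + cnj (p - c) / (of_real (R\<^sup>2) - cnj (p - c) * (s - c))))"
  proof -
    have "of_nat (m p) * (- cnj (p - c) / of_real R) / u p s = - (of_nat (m p) * (cnj (p - c) / (of_real (R\<^sup>2) - cnj (p - c) * (s - c))))" for p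
    proof -
      have gen: "k * (- x / R0) / (y / R0) = - (k * (x / y))" if "R0 \<noteq> 0" for k x y R0 :: complex
        using that by simp
      show ?thesis unfolding u_def by (rule gen) (use rr in simp)
    qed
    thus ?thesis unfolding e1[symmetric] by (simp add: sum_negf sum.distrib ring_distribs)
  qed
  finally have eq: "deriv f s / f s = deriv \<phi> s + (\<Sum>p\<in>Z. of_nat (m p) * (1 / (s - p) + cnj (p - c) / (of_real (R\<^sup>2) - cnj (p - c) * (s - c))))" .
  have D: "norm (deriv \<phi> s) \<le> 8 * M * r / (r - r')\<^sup>2"
  proof -
    have "((\<lambda>s. \<phi> s - \<phi> c) has_field_derivative deriv \<phi> s - 0) (at s)" by (intro DERIV_diff d\<phi> DERIV_const)
    hence "deriv (\<lambda>s. \<phi> s - \<phi> c) s = deriv \<phi> s" by (simp add: DERIV_imp_deriv)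
    thus ?thesis using bound[OF s] by simp
  qed
  have "norm (\<Sum>p\<in>Z. of_nat (m p) * (1 / (s - p) + cnj (p - c) / (of_real (R\<^sup>2) - cnj (p - c) * (s - c))))
      \<le> (\<Sum>p\<in>Z. real (m p) * (1 / \<delta> + r / (R\<^sup>2 - r\<^sup>2)))"
  proof (rule sum_norm_le)
    fix p assume p: "p \<in> Z"
    have "norm (1 / (s - p)) \<le> 1 / \<delta>" using far[OF p] \<delta> by (simp add: norm_divide frac_le)
    hence "norm (1 / (s - p) + cnj (p - c) / (of_real (R\<^sup>2) - cnj (p - c) * (s - c))) \<le> 1 / \<delta> + r / (R\<^sup>2 - r\<^sup>2)"
      using ub[OF p sr] by (intro order_trans[OF norm_triangle_ineq] add_mono)
    thus "norm (of_nat (m p) * (1 / (s - p) + cnj (p - c) / (of_real (R\<^sup>2) - cnj (p - c) * (s - c)))) \<le> real (m p) * (1 / \<delta> + r / (R\<^sup>2 - r\<^sup>2))"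
      unfolding norm_mult norm_of_nat by (intro mult_left_mono) auto
  qed
  also have "\<dots> = real N * (1 / \<delta> + r / (R\<^sup>2 - r\<^sup>2))" by (simp add: N_def sum_distrib_right)
  also have "\<dots> \<le> M / ln (R / r) * (1 / \<delta> + r / (R\<^sup>2 - r\<^sup>2))"
  proof (rule mult_right_mono[OF NM])
    have "R\<^sup>2 - r\<^sup>2 > 0" using rr by (simp add: power_strict_mono)
    thus "0 \<le> 1 / \<delta> + r / (R\<^sup>2 - r\<^sup>2)" using \<delta> rr by (intro add_nonneg_nonneg) auto
  qed
  finally show "norm (deriv f s / f s) \<le> 8 * M * r / (r - r')\<^sup>2 + M / ln (R / r) * (1 / \<delta> + r / (R\<^sup>2 - r\<^sup>2))"
    unfolding eq using D by (intro order_trans[OF norm_triangle_ineq] add_mono)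
qed

section \<open>Growth of zeta and digamma, and heights that keep away from zeros\<close>

lemma zeta_aux_poly_bound:
  obtains C where "C \<ge> 1" "\<And>s. Re s \<ge> -1/2 \<Longrightarrow> norm (zeta_aux s) \<le> C * (1 + norm s) ^ 3"
proof -
  define C0 where "C0 = (\<Sum>n. real (Suc n) powr (- (3/2)))"
  have sm: "summable (\<lambda>n. real (Suc n) powr (- (3/2)))" by (rule summable_Suc_powr) simp
  have C0: "C0 \<ge> 0" unfolding C0_def using sm by (rule suminf_nonneg) auto
  \<comment> \<open>The half-plane Re s \<ge> -1/2 is large enough: the discs used for the
    logarithmic derivative, of radius 49/20 about 2 + it, reach only to Re s = -9/20.\<close>
  have tail: "norm (zeta_tail s) \<le> C0" if "Re s \<ge> -1/2" for s
  proof -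
    have "norm (zeta_tail s) \<le> (\<Sum>n. norm (trap_kernel (real (Suc n)) s))"
      unfolding zeta_tail_def using that by (intro summable_norm trap_kernel_summable) auto
    also have "\<dots> \<le> C0" unfolding C0_def
    proof (rule suminf_le[OF _ _ sm])
      show "norm (trap_kernel (real (Suc n)) s) \<le> real (Suc n) powr (- (3/2))" for n
      proof -
        have "norm (trap_kernel (real (Suc n)) s) \<le> real (Suc n) powr (- Re s - 2) / 4"
          using that by (intro trap_kernel_norm_le) auto
        also have "\<dots> \<le> real (Suc n) powr (- Re s - 2)" by simp
        also have "\<dots> \<le> real (Suc n) powr (- (3/2))" using that by (intro powr_mono) (auto simp: field_simps)
        finally show ?thesis .
      qed
      show "summable (\<lambda>n. norm (trap_kernel (real (Suc n)) s))" using that by (intro trap_kernel_summable) auto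
    qed
    finally show ?thesis .
  qed
  show ?thesis
  proof (rule that[of "2 + C0"])
    show "norm (zeta_aux s) \<le> (2 + C0) * (1 + norm s) ^ 3" if "Re s \<ge> -1/2" for s
    proof -
      define r where "r = norm s"
      have r: "r \<ge> 0" by (simp add: r_def)
      have 1: "norm (s - 1) \<le> 1 + r" "norm (s + 1) \<le> 1 + r"
        using norm_triangle_ineq4[of s 1] norm_triangle_ineq[of s 1] by (auto simp: r_def)
      have "norm (zeta_aux s) \<le> norm (1 + (s - 1) / 2) + norm ((s - 1) * (s * (s + 1) / 2 * zeta_tail s))"
        unfolding zeta_aux_def by (rule norm_triangle_ineq)
      also have "norm (1 + (s - 1) / 2) \<le> 1 + norm ((s - 1) / 2)" using norm_triangle_ineq[of 1 "(s-1)/2"] by simp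
      also have "norm ((s - 1) / 2) \<le> (1 + r) / 2" using 1 by (simp add: norm_divide)
      also have "norm ((s - 1) * (s * (s + 1) / 2 * zeta_tail s)) \<le> (1 + r) * ((1 + r) * (1 + r) / 1 * C0)"
        unfolding norm_mult norm_divide r_def[symmetric] using 1 r tail[OF that] C0
        by (intro mult_mono frac_le) auto
      also have "1 + (1 + r) / 2 + (1 + r) * ((1 + r) * (1 + r) / 1 * C0) \<le> (2 + C0) * (1 + r) ^ 3"
      proof -
        have "1 + (1 + r) / 2 \<le> 2 * (1 + r) ^ 3" using r by (simp add: power3_eq_cube field_simps)
        moreover have "(1 + r) * ((1 + r) * (1 + r) / 1 * C0) = C0 * (1 + r) ^ 3" by (simp add: power3_eq_cube mult_ac)
        ultimately show ?thesis by (simp add: ring_distribs)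
      qed
      finally show ?thesis by (simp add: r_def)
    qed
  qed (use C0 in auto)
qed

text \<open>The k-th term of the digamma series is (x - 1)/((k + 1)(x + k)), and |x + k| \<ge> (k +
  1)/8. Linear growth is far from sharp, but any polynomial bound serves against the exponential
  decay of the kernel.\<close>

lemma Digamma_norm_le:
  fixes x :: complex assumes "Re x \<ge> 1/8"
  shows "norm (Digamma x) \<le> 15 * (1 + norm x)"
proof -
  have x0: "x \<noteq> 0" using assms by auto
  define f where "f = (\<lambda>k. inverse (of_nat (Suc k)) - inverse (x + of_nat k))"
  have le: "norm (f k) \<le> 8 * norm (x - 1) * real (Suc k) powr (-2)" for k
  proof -
    have d: "norm (x + of_nat k) \<ge> real (Suc k) / 8"
      using complex_Re_le_cmod[of "x + of_nat k"] assms by simp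
    hence nz: "x + of_nat k \<noteq> 0" by auto
    have "f k = (x - 1) / (of_nat (Suc k) * (x + of_nat k))"
      unfolding f_def using nz by (simp add: field_simps del: of_nat_Suc) (simp add: algebra_simps)
    hence "norm (f k) = norm (x - 1) / (real (Suc k) * norm (x + of_nat k))"
      by (simp add: norm_mult norm_divide del: of_nat_Suc)
    also have "\<dots> \<le> norm (x - 1) / (real (Suc k) * (real (Suc k) / 8))"
      using d by (intro divide_left_mono mult_left_mono mult_pos_pos) (auto intro: less_le_trans[OF _ d])
    also have "\<dots> = 8 * norm (x - 1) * real (Suc k) powr (-2)"
      by (simp add: powr_minus powr_numeral power2_eq_square field_simps)
    finally show ?thesis .
  qed
  have sm: "summable (\<lambda>k. 8 * norm (x - 1) * real (Suc k) powr (-2))"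
    using summable_Suc_powr[of 2] by (intro summable_mult) auto
  have "norm (\<Sum>k. f k) \<le> (\<Sum>k. 8 * norm (x - 1) * real (Suc k) powr (-2))"
    using le sm by (rule norm_suminf_le)
  also have "\<dots> = 8 * norm (x - 1) * (\<Sum>k. real (Suc k) powr (-2))"
    using summable_Suc_powr[of 2] by (intro suminf_mult) auto
  also have "\<dots> \<le> 8 * norm (x - 1) * (7 / 4)"
    using sum_inverse_squares_le by (intro mult_left_mono) auto
  also have "\<dots> \<le> 14 * (1 + norm x)" using norm_triangle_ineq4[of x 1] by simp
  finally have 1: "norm (\<Sum>k. f k) \<le> 14 * (1 + norm x)" .
  have 2: "norm (Digamma x) \<le> norm (\<Sum>k. f k) + norm (euler_mascheroni :: complex)"
    unfolding Digamma_def f_def by (rule norm_triangle_ineq4)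
  have "norm (euler_mascheroni :: complex) \<le> 1"
  proof -
    have "norm (complex_of_real euler_mascheroni) \<le> 1"
      using euler_mascheroni_less_13_over_22 euler_mascheroni_pos by (simp only: norm_of_real)
    thus ?thesis by (simp only: of_real_euler_mascheroni)
  qed
  hence "norm (Digamma x) \<le> 14 * (1 + norm x) + 1" using 1 2 by (meson add_mono order_trans)
  thus ?thesis using norm_ge_zero[of x] by argo
qed

text \<open>Pigeonhole: among N midpoints with spacing 1/N, a point of E can be nearer than 1/(2N)
  to at most one, and E has fewer than N points.\<close>

lemma exists_far_from_finite_set:
  fixes E :: "real set"
  assumes "finite E" "card E < N"
  obtains T where "a \<le> T" "T \<le> a + 1" "\<And>e. e \<in> E \<Longrightarrow> \<bar>T - e\<bar> \<ge> 1 / (2 * real N)"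
proof -
  define t where "t = (\<lambda>j. a + (real j + 1/2) / real N)"
  have N: "N > 0" using assms by auto
  have "\<exists>j<N. \<forall>e\<in>E. \<bar>t j - e\<bar> \<ge> 1 / (2 * real N)"
  proof (rule ccontr)
    assume "\<not> ?thesis"
    hence "\<forall>j\<in>{..<N}. \<exists>e. e \<in> E \<and> \<bar>t j - e\<bar> < 1 / (2 * real N)" by (auto simp: not_le)
    then obtain e where e: "\<And>j. j < N \<Longrightarrow> e j \<in> E" "\<And>j. j < N \<Longrightarrow> \<bar>t j - e j\<bar> < 1 / (2 * real N)"
      by (metis lessThan_iff)
    have "inj_on e {..<N}"
    proof (rule inj_onI)
      fix i j assume ij: "i \<in> {..<N}" "j \<in> {..<N}" "e i = e j"
      have "\<bar>t i - t j\<bar> < 1 / (2 * real N) + 1 / (2 * real N)"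
        using e(2)[of i] e(2)[of j] ij by auto
      also have "\<dots> = 1 / real N" by simp
      finally have "\<bar>real i - real j\<bar> / real N < 1 / real N"
        by (simp add: t_def flip: diff_divide_distrib)
      hence "\<bar>real i - real j\<bar> < 1" using N by (simp add: divide_less_cancel)
      thus "i = j" by linarith
    qed
    hence "card {..<N} \<le> card E" using e(1) assms(1) by (intro card_inj_on_le[of e]) auto
    thus False using assms by simp
  qed
  then obtain j where j: "j < N" "\<And>e. e \<in> E \<Longrightarrow> \<bar>t j - e\<bar> \<ge> 1 / (2 * real N)" by blast
  have "(real j + 1/2) / real N \<le> 1"
  proof -
    have "real j + 1 \<le> real N" using j(1) by linarith
    thus ?thesis using N by simp
  qed
  moreover have "(real j + 1/2) / real N \<ge> 0" by simp
  ultimately show ?thesis using j(2) by (intro that[of "t j"]) (auto simp: t_def)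
qed

text \<open>The radii 231/100 < 47/20 < 12/5 < 49/20 serve as r' < r < R < R1 in
  \<open>log_derivative_bound\<close>. The smallest disc covers the rectangle -1/4 \<le> Re s \<le>
  5/4, |Im s - t| \<le> 1/2, because (9/4)^2 + (1/2)^2 < (231/100)^2.\<close>

definition zeta_zero_disc :: "real \<Rightarrow> complex set" where
  "zeta_zero_disc t = {s \<in> cball (Complex 2 t) (47/20). zeta_aux s = 0}"

text \<open>The cubic bound for \<open>zeta_aux\<close> makes ln(B / |f(c)|) logarithmic in t; it is
  estimated further by ln x \<le> x - 1. So both the number of zeros in a disc and the logarithmic
  derivative away from them are linear in |t|.\<close>

lemma zeta_aux_local_bounds:
  obtains K where "K \<ge> 1" "\<And>t. finite (zeta_zero_disc t)"
    "\<And>t. (\<Sum>p\<in>zeta_zero_disc t. real_of_int (zorder zeta_aux p)) \<le> K * (1 + \<bar>t\<bar>)"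
    "\<And>t p. p \<in> zeta_zero_disc t \<Longrightarrow> zorder zeta_aux p > 0"
    "\<And>t s \<delta>. norm (s - Complex 2 t) \<le> 231/100 \<Longrightarrow> \<delta> > 0 \<Longrightarrow> (\<And>p. p \<in> zeta_zero_disc t \<Longrightarrow> norm (s - p) \<ge> \<delta>) \<Longrightarrow>
       norm (deriv zeta_aux s / zeta_aux s) \<le> K * (1 + \<bar>t\<bar>) * (1 + 1 / \<delta>)"
proof -
  obtain C where C: "C \<ge> 1" "\<And>s. Re s \<ge> -1/2 \<Longrightarrow> norm (zeta_aux s) \<le> C * (1 + norm s) ^ 3"
    using zeta_aux_poly_bound by blast
  \<comment> \<open>The estimate of the logarithm comes out as 4 C + 14 + 3 |t|, with 4 from the
    lower bound 1/4 at the centre; the surplus makes the inequality strict.\<close>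
  define M where "M = (\<lambda>t::real. 4 * C + 18 + 3 * \<bar>t\<bar>)"
  define lR where "lR = ln ((12/5) / (47/20 :: real))"
  have lR: "lR > 0" unfolding lR_def by (rule ln_gt_zero) simp
  define a b where "a = 8 * (47/20) / (47/20 - 231/100 :: real)\<^sup>2" and "b = (47/20) / ((12/5)\<^sup>2 - (47/20)\<^sup>2 :: real)"
  have a: "a > 0" and b: "b > 0" unfolding a_def b_def by (simp_all add: power2_eq_square)
  have in_half: "Re s \<ge> -1/2" if "s \<in> ball (Complex 2 t) (49/20)" for s t
  proof -
    have "2 - Re s < 49/20" using that abs_Re_le_cmod[of "Complex 2 t - s"] by (simp add: dist_norm)
    thus ?thesis by simp
  qed
  have L: "finite (zeta_zero_disc t)"
      "(\<Sum>p\<in>zeta_zero_disc t. real_of_int (zorder zeta_aux p)) \<le> M t / lR"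
      "\<And>p. p \<in> zeta_zero_disc t \<Longrightarrow> zorder zeta_aux p > 0"
      "\<And>s \<delta>. norm (s - Complex 2 t) \<le> 231/100 \<Longrightarrow> \<delta> > 0 \<Longrightarrow> (\<And>p. p \<in> zeta_zero_disc t \<Longrightarrow> norm (s - p) \<ge> \<delta>) \<Longrightarrow>
       norm (deriv zeta_aux s / zeta_aux s) \<le> M t * a + M t / lR * (1 / \<delta> + b)" for t
  proof -
    define c where "c = Complex 2 t"
    have ne1: "c \<noteq> 1" by (auto simp: c_def complex_eq_iff)
    have "riemann_zeta c = zeta_aux c / (c - 1)" using ne1 by (intro riemann_zeta_eq) (auto simp: c_def)
    moreover have "norm (riemann_zeta c) \<ge> 1/4" by (rule riemann_zeta_norm_ge) (simp add: c_def)
    moreover have "norm (c - 1) \<ge> 1" using complex_Re_le_cmod[of "c - 1"] by (simp add: c_def)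
    ultimately have cge: "norm (zeta_aux c) \<ge> 1/4"
      using mult_mono[of "1/4" "norm (zeta_aux c / (c - 1))" 1 "norm (c - 1)"] ne1 by (simp add: norm_divide)
    hence c0: "zeta_aux c \<noteq> 0" by auto
    have hol: "zeta_aux holomorphic_on ball c (49/20)"
      by (rule holomorphic_on_subset[OF zeta_aux_holomorphic]) (use in_half in \<open>force simp: c_def\<close>)
    have B: "norm (zeta_aux s) \<le> C * (6 + \<bar>t\<bar>) ^ 3" if "s \<in> ball c (49/20)" for s
    proof -
      have "norm s \<le> norm c + 49/20" using that norm_triangle_ineq[of c "s - c"] by (simp add: dist_norm norm_minus_commute)
      moreover have "norm c \<le> 2 + \<bar>t\<bar>" using cmod_le[of c] by (simp add: c_def)
      ultimately have "1 + norm s \<le> 6 + \<bar>t\<bar>" by simp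
      hence "C * (1 + norm s) ^ 3 \<le> C * (6 + \<bar>t\<bar>) ^ 3" using C(1) by (intro mult_left_mono power_mono) auto
      thus ?thesis using C(2)[OF in_half[of s t]] that by (simp add: c_def)
    qed
    have M: "ln (C * (6 + \<bar>t\<bar>) ^ 3 / norm (zeta_aux c)) < M t"
    proof -
      have "C * (6 + \<bar>t\<bar>) ^ 3 / norm (zeta_aux c) \<le> C * (6 + \<bar>t\<bar>) ^ 3 / (1/4)"
        using cge C(1) by (intro divide_left_mono mult_nonneg_nonneg mult_pos_pos) auto
      hence "ln (C * (6 + \<bar>t\<bar>) ^ 3 / norm (zeta_aux c)) \<le> ln (4 * C * (6 + \<bar>t\<bar>) ^ 3)"
        using cge C(1) by (subst ln_le_cancel_iff) (auto intro!: mult_pos_pos divide_pos_pos zero_less_power)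
      also have "\<dots> = ln (4 * C) + 3 * ln (6 + \<bar>t\<bar>)" using C(1) by (simp add: ln_mult ln_realpow)
      also have "\<dots> \<le> (4 * C - 1) + 3 * (6 + \<bar>t\<bar> - 1)"
        using C(1) by (intro add_mono mult_left_mono ln_le_minus_one) auto
      also have "\<dots> < M t" by (simp add: M_def)
      finally show ?thesis .
    qed
    have rr: "0 < (231/100::real)" "(231/100::real) < 47/20" "47/20 < (12/5::real)" "12/5 < (49/20::real)" by simp_all
    note LL = log_derivative_bound[OF rr hol B c0 M]
    show "finite (zeta_zero_disc t)" "\<And>p. p \<in> zeta_zero_disc t \<Longrightarrow> zorder zeta_aux p > 0"
      using LL(1,3) unfolding zeta_zero_disc_def c_def by blast+
    show "(\<Sum>p\<in>zeta_zero_disc t. real_of_int (zorder zeta_aux p)) \<le> M t / lR"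
      using LL(2) unfolding zeta_zero_disc_def c_def lR_def .
    show "norm (deriv zeta_aux s / zeta_aux s) \<le> M t * a + M t / lR * (1 / \<delta> + b)"
      if "norm (s - Complex 2 t) \<le> 231/100" "\<delta> > 0" "\<And>p. p \<in> zeta_zero_disc t \<Longrightarrow> norm (s - p) \<ge> \<delta>" for s \<delta>
    proof -
      have "norm (deriv zeta_aux s / zeta_aux s) \<le> 8 * M t * (47/20) / (47/20 - 231/100)\<^sup>2 + M t / lR * (1 / \<delta> + (47/20) / ((12/5)\<^sup>2 - (47/20)\<^sup>2))"
        unfolding lR_def by (rule LL(4)) (use that in \<open>auto simp: zeta_zero_disc_def c_def\<close>)
      also have "8 * M t * (47/20) / (47/20 - 231/100)\<^sup>2 = M t * a" by (simp add: a_def)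
      finally show ?thesis by (simp only: b_def)
    qed
  qed
  define D where "D = 4 * C + 18"
  have D: "D \<ge> 3" using C by (simp add: D_def)
  have MD: "M t \<le> D * (1 + \<bar>t\<bar>)" for t
    using mult_right_mono[OF D, of "\<bar>t\<bar>"] by (simp add: M_def D_def algebra_simps)
  have M0: "M t \<ge> 0" for t using C by (simp add: M_def)
  define K where "K = 1 + D / lR + D * a + D / lR * (1 + b)"
  have K: "K \<ge> 1" "K \<ge> D / lR" "K \<ge> D * a + D / lR * (1 + b)"
    unfolding K_def using D lR a b by (auto intro!: add_nonneg_nonneg)
  show ?thesis
  proof (rule that[of K])
    show "(\<Sum>p\<in>zeta_zero_disc t. real_of_int (zorder zeta_aux p)) \<le> K * (1 + \<bar>t\<bar>)" for t
    proof -
      have "M t / lR \<le> D * (1 + \<bar>t\<bar>) / lR" using MD[of t] lR by (intro divide_right_mono) auto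
      also have "\<dots> = D / lR * (1 + \<bar>t\<bar>)" by simp
      also have "\<dots> \<le> K * (1 + \<bar>t\<bar>)" using K by (intro mult_right_mono) auto
      finally show ?thesis using L(2)[of t] by simp
    qed
    show "norm (deriv zeta_aux s / zeta_aux s) \<le> K * (1 + \<bar>t\<bar>) * (1 + 1 / \<delta>)"
      if "norm (s - Complex 2 t) \<le> 231/100" "\<delta> > 0" "\<And>p. p \<in> zeta_zero_disc t \<Longrightarrow> norm (s - p) \<ge> \<delta>" for s t \<delta>
    proof -
      have "1 / \<delta> + b \<le> (1 + b) * (1 + 1 / \<delta>)" using that(2) b by (simp add: field_simps)
      moreover have "1 \<le> 1 + 1 / \<delta>" using that(2) by simp
      ultimately have "M t * a + M t / lR * (1 / \<delta> + b) \<le> M t * (a * (1 + 1 / \<delta>)) + M t / lR * ((1 + b) * (1 + 1 / \<delta>))"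
        using M0[of t] a lR by (intro add_mono mult_left_mono) (auto intro: mult_left_mono[of 1 _ a, simplified])
      also have "\<dots> = M t * ((a + (1 + b) / lR) * (1 + 1 / \<delta>))" using lR that(2) by (simp add: field_simps)
      also have "\<dots> \<le> (D * (1 + \<bar>t\<bar>)) * ((a + (1 + b) / lR) * (1 + 1 / \<delta>))"
        using MD[of t] a b lR that(2) by (intro mult_right_mono mult_nonneg_nonneg add_nonneg_nonneg) auto
      also have "\<dots> = (D * a + D / lR * (1 + b)) * ((1 + \<bar>t\<bar>) * (1 + 1 / \<delta>))" using lR by (simp add: field_simps)
      also have "\<dots> \<le> K * ((1 + \<bar>t\<bar>) * (1 + 1 / \<delta>))" using K(3) that(2) by (intro mult_right_mono mult_nonneg_nonneg) auto
      finally show ?thesis using L(4)[OF that] by (simp add: mult.assoc)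
    qed
  qed (use K L in auto)
qed

text \<open>Between n and n + 1 there are O(n + 1) ordinates to avoid, so some T keeps a distance of
  order 1/(n + 1) from all of them. Combined with the linear local bound this makes the logarithmic
  derivative quadratic in n.\<close>

lemma zeta_aux_good_heights:
  obtains K where "K \<ge> 1"
    "\<And>n::nat. \<exists>T. real n \<le> T \<and> T \<le> real n + 1 \<and> (\<forall>s. \<bar>Im s\<bar> = T \<and> -1/4 \<le> Re s \<and> Re s \<le> 5/4 \<longrightarrow>
        zeta_aux s \<noteq> 0 \<and> norm (deriv zeta_aux s / zeta_aux s) \<le> K * (1 + real n) ^ 2)"
proof -
  obtain K where K: "K \<ge> 1" "\<And>t. finite (zeta_zero_disc t)"
    "\<And>t. (\<Sum>p\<in>zeta_zero_disc t. real_of_int (zorder zeta_aux p)) \<le> K * (1 + \<bar>t\<bar>)"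
    "\<And>t p. p \<in> zeta_zero_disc t \<Longrightarrow> zorder zeta_aux p > 0"
    "\<And>t s \<delta>. norm (s - Complex 2 t) \<le> 231/100 \<Longrightarrow> \<delta> > 0 \<Longrightarrow> (\<And>p. p \<in> zeta_zero_disc t \<Longrightarrow> norm (s - p) \<ge> \<delta>) \<Longrightarrow>
       norm (deriv zeta_aux s / zeta_aux s) \<le> K * (1 + \<bar>t\<bar>) * (1 + 1 / \<delta>)"
    using zeta_aux_local_bounds by blast
  have card: "real (card (zeta_zero_disc t)) \<le> K * (1 + \<bar>t\<bar>)" for t
  proof -
    have "real (card (zeta_zero_disc t)) = (\<Sum>p\<in>zeta_zero_disc t. 1)" by simp
    also have "\<dots> \<le> (\<Sum>p\<in>zeta_zero_disc t. real_of_int (zorder zeta_aux p))"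
      using K(4)[of _ t] by (intro sum_mono) (simp add: Suc_le_eq int_one_le_iff_zero_less)
    finally show ?thesis using K(3)[of t] by simp
  qed
  show ?thesis
  proof (rule that[of "60 * K * K"])
    show "60 * K * K \<ge> 1" using mult_mono[of 1 K 1 K] K(1) by simp
    fix n :: nat
    \<comment> \<open>The same T has to serve at heights T and -T, so ordinates from the lower disc
      enter with reversed sign.\<close>
    define E where "E = Im ` zeta_zero_disc (real n + 1/2) \<union> (\<lambda>p. - Im p) ` zeta_zero_disc (- (real n + 1/2))"
    define N where "N = nat \<lfloor>4 * K * (1 + real n)\<rfloor> + 1"
    have finE: "finite E" using K(2) by (simp add: E_def)
    have "real (card E) \<le> real (card (zeta_zero_disc (real n + 1/2))) + real (card (zeta_zero_disc (- (real n + 1/2))))"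
      unfolding E_def using K(2) card_Un_le card_image_le by (smt (verit, best) of_nat_add of_nat_mono)
    also have "\<dots> \<le> K * (1 + \<bar>real n + 1/2\<bar>) + K * (1 + \<bar>- (real n + 1/2)\<bar>)" by (intro add_mono card)
    also have "\<dots> \<le> 4 * K * (1 + real n)" using K(1) by (simp add: algebra_simps)
    also have "\<dots> < real N" unfolding N_def by linarith
    finally have cE: "card E < N" by simp
    obtain T where T: "real n \<le> T" "T \<le> real n + 1" "\<And>e. e \<in> E \<Longrightarrow> \<bar>T - e\<bar> \<ge> 1 / (2 * real N)"
      using exists_far_from_finite_set[OF finE cE] by blast
    have N0: "real N > 0" by (simp add: N_def)
    have N1: "real N \<le> 5 * K * (1 + real n)"
    proof -
      have "real N \<le> 4 * K * (1 + real n) + 1" unfolding N_def using K(1) by simp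
      moreover have "1 * 1 \<le> K * (1 + real n)" using K(1) by (intro mult_mono) auto
      ultimately show ?thesis by (simp add: algebra_simps)
    qed
    have main: "zeta_aux s \<noteq> 0 \<and> norm (deriv zeta_aux s / zeta_aux s) \<le> 60 * K * K * (1 + real n)\<^sup>2"
      if s: "\<bar>Im s\<bar> = T" "-1/4 \<le> Re s" "Re s \<le> 5/4" for s
    proof -
      define t where "t = (if Im s \<ge> 0 then real n + 1/2 else - (real n + 1/2))"
      have t: "\<bar>t\<bar> = real n + 1/2" by (auto simp: t_def)
      have "\<bar>Im s - t\<bar> \<le> 1/2" using T s(1) by (auto simp: t_def abs_le_iff field_simps)
      hence "(Im s - t)\<^sup>2 \<le> (1/2)\<^sup>2" using abs_le_square_iff[of "Im s - t" "1/2"] by simp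
      moreover have "(Re s - 2)\<^sup>2 \<le> (9/4)\<^sup>2"
        using s by (intro abs_le_square_iff[THEN iffD1]) auto
      ultimately have "(norm (s - Complex 2 t))\<^sup>2 \<le> (231/100)\<^sup>2"
        unfolding cmod_power2 by (simp add: power2_eq_square)
      hence sn: "norm (s - Complex 2 t) \<le> 231/100" by (rule power2_le_imp_le) simp
      have far: "norm (s - p) \<ge> 1 / (2 * real N)" if p: "p \<in> zeta_zero_disc t" for p
      proof -
        have "\<bar>Im s - Im p\<bar> \<ge> 1 / (2 * real N)"
        proof (cases "Im s \<ge> 0")
          case True
          hence "Im p \<in> E" using p by (auto simp: t_def E_def)
          thus ?thesis using T(3) s(1) True by force
        next
          case False
          hence "- Im p \<in> E" using p by (auto simp: t_def E_def)
          from T(3)[OF this] show ?thesis using s(1) False by (simp add: abs_if split: if_splits)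
        qed
        thus ?thesis using abs_Im_le_cmod[of "s - p"] by simp
      qed
      have "norm (deriv zeta_aux s / zeta_aux s) \<le> K * (1 + \<bar>t\<bar>) * (1 + 1 / (1 / (2 * real N)))"
        by (rule K(5)[OF sn _ far]) (use N0 in auto)
      also have "\<dots> = K * ((3/2 + real n) * (1 + 2 * real N))" by (simp add: t)
      also have "\<dots> \<le> K * ((2 * (1 + real n)) * (11 * K * (1 + real n)))"
      proof (intro mult_left_mono mult_mono)
        have "1 * 1 \<le> K * (1 + real n)" using K(1) by (intro mult_mono) auto
        thus "1 + 2 * real N \<le> 11 * K * (1 + real n)" using N1 by simp
      qed (use K(1) in auto)
      also have "\<dots> = 22 * (K * K * (1 + real n)\<^sup>2)" by (simp add: power2_eq_square algebra_simps)
      also have "\<dots> \<le> 60 * (K * K * (1 + real n)\<^sup>2)" using K(1) by (intro mult_right_mono) auto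
      finally have b: "norm (deriv zeta_aux s / zeta_aux s) \<le> 60 * K * K * (1 + real n)\<^sup>2" by (simp add: mult.assoc)
      have "zeta_aux s \<noteq> 0"
      proof
        assume "zeta_aux s = 0"
        hence "s \<in> zeta_zero_disc t" using sn by (simp add: zeta_zero_disc_def dist_norm norm_minus_commute)
        from far[OF this] show False using N0 by simp
      qed
      thus ?thesis using b by simp
    qed
    show "\<exists>T. real n \<le> T \<and> T \<le> real n + 1 \<and> (\<forall>s. \<bar>Im s\<bar> = T \<and> -1/4 \<le> Re s \<and> Re s \<le> 5/4 \<longrightarrow>
        zeta_aux s \<noteq> 0 \<and> norm (deriv zeta_aux s / zeta_aux s) \<le> 60 * K * K * (1 + real n) ^ 2)"
      using T(1,2) main by blast
  qed
qed

section \<open>Integrals over vertical lines\<close>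

lemma integrable_exp_abs:
  assumes "a > (0::real)"
  shows "integrable lborel (\<lambda>t. exp (- a * \<bar>t\<bar>))"
proof -
  have "((\<lambda>x. x powr (1 - 1) * exp (- a * x)) has_integral (Gamma 1 * a powr (- 1))) {0<..}"
    using assms by (intro has_integral_Gamma_scaled) auto
  hence "((\<lambda>x. exp (- a * x)) has_integral (Gamma 1 * a powr (- 1))) {0<..}"
    by (rule has_integral_eq[rotated]) auto
  hence "(\<lambda>x. exp (- a * x)) absolutely_integrable_on {0<..}"
    by (intro nonnegative_absolutely_integrable_1) auto
  hence "set_integrable lborel {0<..} (\<lambda>x. exp (- a * x))"
    unfolding set_integrable_def by (subst (asm) integrable_completion) auto
  hence 1: "integrable lborel (\<lambda>x. indicator {0<..} x * exp (- a * x))" by (simp add: set_integrable_def)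
  have 2: "integrable lborel (\<lambda>x. indicator {0<..} (0 + (-1) * x) * exp (- a * (0 + (-1) * x)))"
    by (rule lborel_integrable_real_affine[OF 1]) simp
  have "integrable lborel (\<lambda>x. (indicator {0<..} x * exp (- a * x) + indicator {0<..} (0 + (-1) * x) * exp (- a * (0 + (-1) * x))) + indicator {0} x * (1::real))"
    using 1 2 by (intro Bochner_Integration.integrable_add) auto
  also have "(\<lambda>x. (indicator {0<..} x * exp (- a * x) + indicator {0<..} (0 + (-1) * x) * exp (- a * (0 + (-1) * x))) + indicator {0} x * (1::real)) = (\<lambda>t. exp (- a * \<bar>t\<bar>))"
    by (auto simp: indicator_def fun_eq_iff)
  finally show ?thesis .
qed

text \<open>Half of the exponential rate is spent on the quadratic factor, through y \<le> exp y
  with y = \<delta> (1 + x)/4.\<close>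

lemma poly_exp_le:
  fixes \<delta> x :: real assumes "\<delta> > 0" "x \<ge> 0"
  shows "(1 + x)\<^sup>2 * exp (- \<delta> * x) \<le> exp (\<delta> / 2) * (4 / \<delta>)\<^sup>2 * exp (- (\<delta> / 2) * x)"
proof -
  define y where "y = \<delta> * (1 + x) / 4"
  have y: "y \<ge> 0" using assms by (simp add: y_def)
  have "y \<le> exp y" using exp_ge_add_one_self[of y] by argo
  hence "y\<^sup>2 \<le> (exp y)\<^sup>2" using y by (intro power_mono)
  also have "(exp y)\<^sup>2 = exp (\<delta> / 2) * exp (\<delta> / 2 * x)"
    unfolding y_def power2_eq_square by (simp add: field_simps flip: exp_add)
  finally have y2: "y\<^sup>2 \<le> exp (\<delta> / 2) * exp (\<delta> / 2 * x)" .
  have "1 + x = 4 / \<delta> * y" using assms by (simp add: y_def)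
  hence "(1 + x)\<^sup>2 = (4 / \<delta>)\<^sup>2 * y\<^sup>2" by (simp only: power_mult_distrib)
  hence "(1 + x)\<^sup>2 \<le> (4 / \<delta>)\<^sup>2 * (exp (\<delta> / 2) * exp (\<delta> / 2 * x))"
    using mult_left_mono[OF y2, of "(4 / \<delta>)\<^sup>2"] by simp
  hence "(1 + x)\<^sup>2 * exp (- \<delta> * x) \<le> (4 / \<delta>)\<^sup>2 * (exp (\<delta> / 2) * exp (\<delta> / 2 * x)) * exp (- \<delta> * x)"
    by (intro mult_right_mono) auto
  also have "exp (\<delta> / 2 * x) * exp (- \<delta> * x) = exp (- (\<delta> / 2) * x)"
    by (simp add: field_simps flip: exp_add)
  hence "(4 / \<delta>)\<^sup>2 * (exp (\<delta> / 2) * exp (\<delta> / 2 * x)) * exp (- \<delta> * x) = exp (\<delta> / 2) * (4 / \<delta>)\<^sup>2 * exp (- (\<delta> / 2) * x)"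
    by (simp add: mult_ac)
  finally show ?thesis .
qed

lemma integrable_exp_decay:
  fixes f :: "real \<Rightarrow> complex"
  assumes "continuous_on UNIV f" "\<delta> > 0" "\<And>t. norm (f t) \<le> K * ((1 + \<bar>t\<bar>)\<^sup>2 * exp (- \<delta> * \<bar>t\<bar>))"
  shows "integrable lborel f"
proof (rule Bochner_Integration.integrable_bound)
  define K' where "K' = \<bar>K\<bar> * (exp (\<delta> / 2) * (4 / \<delta>)\<^sup>2)"
  show "integrable lborel (\<lambda>t. K' * exp (- (\<delta> / 2) * \<bar>t\<bar>))"
    using integrable_exp_abs[of "\<delta> / 2"] assms(2) by (intro integrable_mult_right) auto
  show "f \<in> borel_measurable lborel" using assms(1) by (simp add: borel_measurable_continuous_onI)
  have "norm (f t) \<le> norm (K' * exp (- (\<delta> / 2) * \<bar>t\<bar>))" for t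
  proof -
    have "norm (f t) \<le> \<bar>K\<bar> * ((1 + \<bar>t\<bar>)\<^sup>2 * exp (- \<delta> * \<bar>t\<bar>))"
      using assms(3)[of t] by (rule order_trans) (intro mult_right_mono mult_nonneg_nonneg, auto)
    also have "\<dots> \<le> \<bar>K\<bar> * (exp (\<delta> / 2) * (4 / \<delta>)\<^sup>2 * exp (- (\<delta> / 2) * \<bar>t\<bar>))"
      using assms(2) by (intro mult_left_mono poly_exp_le) auto
    also have "\<dots> = norm (K' * exp (- (\<delta> / 2) * \<bar>t\<bar>))" unfolding K'_def by (simp add: abs_mult)
    finally show ?thesis .
  qed
  thus "AE t in lborel. norm (f t) \<le> norm (K' * exp (- (\<delta> / 2) * \<bar>t\<bar>))" by simp
qed

lemma truncated_integral_tendsto: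
  fixes f :: "real \<Rightarrow> complex"
  assumes "integrable lborel f"
  shows "((\<lambda>T. integral {-T..T} f) \<longlongrightarrow> (LINT t|lborel. f t)) at_top"
proof -
  have eq: "integral {-T..T} f = (LINT t|lborel. indicator {-T..T} t *\<^sub>R f t)" for T
  proof -
    have "set_integrable lborel {-T..T} f" unfolding set_integrable_def
      using assms by (intro integrable_mult_indicator) auto
    from set_borel_integral_eq_integral(2)[OF this] show ?thesis by (simp add: set_lebesgue_integral_def)
  qed
  have "((\<lambda>T. LINT t|lborel. indicator {-T..T} t *\<^sub>R f t) \<longlongrightarrow> (LINT t|lborel. f t)) at_top"
  proof (rule integral_dominated_convergence_at_top[where w = "\<lambda>t. norm (f t)"])
    show "\<forall>\<^sub>F T in at_top. AE t in lborel. norm (indicator {-T..T} t *\<^sub>R f t) \<le> norm (f t)"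
      by (intro always_eventually allI AE_I2) (auto simp: indicator_def)
    show "AE t in lborel. ((\<lambda>T. indicator {-T..T} t *\<^sub>R f t) \<longlongrightarrow> f t) at_top"
    proof (rule AE_I2)
      fix t :: real
      have "\<forall>\<^sub>F T in at_top. indicator {-T..T} t *\<^sub>R f t = f t"
        using eventually_ge_at_top[of "\<bar>t\<bar>"] by eventually_elim (auto simp: indicator_def)
      thus "((\<lambda>T. indicator {-T..T} t *\<^sub>R f t) \<longlongrightarrow> f t) at_top" by (rule tendsto_eventually)
    qed
  qed (use assms in auto)
  thus ?thesis by (simp only: eq)
qed

text \<open>The vertical sides become real integrals, whereas the horizontal ones, both directed
  from left to right, are set apart because they are only ever estimated.\<close>

lemma contour_integral_rectpath:
  assumes "a < b" "T > 0" "continuous_on (path_image (rectpath (Complex a (-T)) (Complex b T))) F"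
  shows "contour_integral (rectpath (Complex a (-T)) (Complex b T)) F =
     \<i> * integral {-T..T} (\<lambda>t. F (Complex b t)) - \<i> * integral {-T..T} (\<lambda>t. F (Complex a t))
     + (contour_integral (linepath (Complex a (-T)) (Complex b (-T))) F - contour_integral (linepath (Complex a T) (Complex b T)) F)"
proof -
  define l1 l2 l3 l4 where "l1 = linepath (Complex a (-T)) (Complex b (-T))"
    and "l2 = linepath (Complex b (-T)) (Complex b T)" and "l3 = linepath (Complex b T) (Complex a T)"
    and "l4 = linepath (Complex a T) (Complex a (-T))"
  have rp: "rectpath (Complex a (-T)) (Complex b T) = l1 +++ l2 +++ l3 +++ l4"
    by (simp add: rectpath_def Let_def l1_def l2_def l3_def l4_def)
  have pi: "path_image (rectpath (Complex a (-T)) (Complex b T)) = path_image l1 \<union> path_image l2 \<union> path_image l3 \<union> path_image l4"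
    unfolding rp by (simp add: l1_def l2_def l3_def l4_def path_image_join Un_assoc)
  have c: "F contour_integrable_on l1" "F contour_integrable_on l2" "F contour_integrable_on l3" "F contour_integrable_on l4"
    unfolding l1_def l2_def l3_def l4_def
    by (intro contour_integrable_continuous_linepath continuous_on_subset[OF assms(3)];
        unfold pi; simp add: l1_def l2_def l3_def l4_def; blast)+
  have v: "valid_path l1" "valid_path l2" "valid_path l3" "valid_path l4"
    by (simp_all add: l1_def l2_def l3_def l4_def)
  have "contour_integral (rectpath (Complex a (-T)) (Complex b T)) F =
     contour_integral l1 F + (contour_integral l2 F + (contour_integral l3 F + contour_integral l4 F))"
    unfolding rp using c v by (simp add: l1_def l2_def l3_def l4_def)
  also have "contour_integral l2 F = \<i> * integral {-T..T} (\<lambda>t. F (Complex b t))"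
    unfolding l2_def using assms(2) by (intro contour_integral_linepath_same_Re) auto
  also have "contour_integral l3 F = - contour_integral (linepath (Complex a T) (Complex b T)) F"
    unfolding l3_def by (subst reversepath_linepath[symmetric], subst contour_integral_reversepath) auto
  also have "contour_integral l4 F = - contour_integral (linepath (Complex a (-T)) (Complex a T)) F"
    unfolding l4_def by (subst reversepath_linepath[symmetric], subst contour_integral_reversepath) auto
  also have "contour_integral (linepath (Complex a (-T)) (Complex a T)) F = \<i> * integral {-T..T} (\<lambda>t. F (Complex a t))"
    using assms(2) by (intro contour_integral_linepath_same_Re) auto
  finally show ?thesis by (simp add: l1_def)
qed

lemma horizontal_integral_bound:
  assumes "a < b" "continuous_on (closed_segment (Complex a T) (Complex b T)) F"
    "\<And>x. a \<le> x \<Longrightarrow> x \<le> b \<Longrightarrow> norm (F (Complex x T)) \<le> B"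
  shows "norm (contour_integral (linepath (Complex a T) (Complex b T)) F) \<le> B * (b - a)"
proof -
  have "norm (contour_integral (linepath (Complex a T) (Complex b T)) F) \<le> B * norm (Complex b T - Complex a T)"
  proof (rule contour_integral_bound_linepath)
    show "F contour_integrable_on linepath (Complex a T) (Complex b T)"
      by (rule contour_integrable_continuous_linepath[OF assms(2)])
    show "0 \<le> B" using assms(3)[of a] assms(1) norm_ge_zero[of "F (Complex a T)"] by linarith
    fix w assume "w \<in> closed_segment (Complex a T) (Complex b T)"
    hence "Im w = T \<and> a \<le> Re w \<and> Re w \<le> b"
      using assms(1) by (auto simp: closed_segment_same_Im closed_segment_eq_real_ivl)
    hence "w = Complex (Re w) T" "a \<le> Re w" "Re w \<le> b" by (auto simp: complex_eq_iff)
    thus "norm (F w) \<le> B" using assms(3)[of "Re w"] by simp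
  qed
  also have "norm (Complex b T - Complex a T) = b - a" using assms(1) by (simp add: cmod_def)
  finally show ?thesis .
qed

lemma path_image_rectpath_iff:
  assumes "a < b" "T > 0"
  shows "w \<in> path_image (rectpath (Complex a (-T)) (Complex b T)) \<longleftrightarrow>
     a \<le> Re w \<and> Re w \<le> b \<and> \<bar>Im w\<bar> \<le> T \<and> (Re w = a \<or> Re w = b \<or> \<bar>Im w\<bar> = T)"
  using assms by (subst path_image_rectpath_cbox_minus_box) (auto simp: in_cbox_complex_iff in_box_complex_iff)

text \<open>Residue theorem on rectangles of growing height. As \<phi> bounds F throughout the strip
  from height 1 on, every height beyond the poles will do; the wider strip a' < Re w < b' is an open
  domain around the closed rectangles. The factor is 2 pi and not 2 pi i because dw = i dt.\<close>

lemma vertical_line_shift: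
  fixes F :: "complex \<Rightarrow> complex"
  assumes ab: "a' < a" "a < b" "b < b'" and S: "finite S" "\<And>p. p \<in> S \<Longrightarrow> a < Re p \<and> Re p < b"
    and hol: "F holomorphic_on ({w. a' < Re w \<and> Re w < b'} - S)"
    and int: "integrable lborel (\<lambda>t. F (Complex a t))" "integrable lborel (\<lambda>t. F (Complex b t))"
    and bd: "\<And>w. a \<le> Re w \<Longrightarrow> Re w \<le> b \<Longrightarrow> \<bar>Im w\<bar> \<ge> 1 \<Longrightarrow> norm (F w) \<le> \<phi> \<bar>Im w\<bar>"
    and lim: "(\<phi> \<longlongrightarrow> 0) at_top"
  shows "(LINT t|lborel. F (Complex b t)) = (LINT t|lborel. F (Complex a t)) + 2 * pi * (\<Sum>p\<in>S. residue F p)"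
proof -
  define R where "R = (\<Sum>p\<in>S. residue F p)"
  define D where "D = {w. a' < Re w \<and> Re w < b'}"
  have D: "open D" "convex D"
  proof -
    have "D = {w. Re w > a'} \<inter> {w. Re w < b'}" by (auto simp: D_def)
    thus "open D" "convex D"
      by (simp_all add: open_Int open_halfspace_Re_gt open_halfspace_Re_lt convex_Int convex_halfspace_Re_gt convex_halfspace_Re_lt)
  qed
  obtain T0 where T0: "\<And>p. p \<in> S \<Longrightarrow> \<bar>Im p\<bar> < T0"
  proof -
    have "\<bar>Im p\<bar> < Max (insert 0 ((\<lambda>p. \<bar>Im p\<bar>) ` S)) + 1" if "p \<in> S" for p
    proof -
      have "\<bar>Im p\<bar> \<le> Max (insert 0 ((\<lambda>p. \<bar>Im p\<bar>) ` S))" by (rule Max_ge) (use S(1) that in auto)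
      thus ?thesis by simp
    qed
    thus ?thesis using that by blast
  qed
  have main: "norm (integral {-T..T} (\<lambda>t. F (Complex b t)) - integral {-T..T} (\<lambda>t. F (Complex a t)) - 2 * pi * R) \<le> 2 * (b - a) * \<phi> T"
    if T: "T \<ge> max 1 T0" for T
  proof -
    define g where "g = rectpath (Complex a (-T)) (Complex b T)"
    have Tp: "T > 0" using T by simp
    have sub: "path_image g \<subseteq> D - S"
      unfolding g_def using T0 T S(2) ab Tp by (auto simp: path_image_rectpath_iff D_def) force+
    have cont: "continuous_on (path_image g) F"
      by (rule holomorphic_on_imp_continuous_on, rule holomorphic_on_subset[OF hol]) (use sub in \<open>auto simp: D_def\<close>)
    have "contour_integral g F = 2 * pi * \<i> * (\<Sum>p\<in>S. winding_number g p * residue F p)"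
    proof (rule Residue_theorem[OF D(1) convex_connected[OF D(2)] S(1)])
      show "F holomorphic_on D - S" using hol by (simp add: D_def)
      show "\<forall>z. z \<notin> D \<longrightarrow> winding_number g z = 0"
      proof (intro allI impI)
        fix z assume "z \<notin> D"
        thus "winding_number g z = 0" unfolding g_def using ab Tp
          by (intro winding_number_rectpath_outside) (auto simp: D_def in_cbox_complex_iff)
      qed
    qed (use sub in \<open>auto simp: g_def\<close>)
    also have "(\<Sum>p\<in>S. winding_number g p * residue F p) = R" unfolding R_def
    proof (intro sum.cong refl)
      fix p assume p: "p \<in> S"
      have "winding_number g p = 1" unfolding g_def
        by (rule winding_number_rectpath) (use p T0[OF p] S(2)[OF p] T in \<open>auto simp: in_box_complex_iff\<close>)
      thus "winding_number g p * residue F p = residue F p" by simp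
    qed
    finally have eq: "contour_integral g F = 2 * pi * \<i> * R" .
    define h1 h2 where "h1 = contour_integral (linepath (Complex a (-T)) (Complex b (-T))) F"
      and "h2 = contour_integral (linepath (Complex a T) (Complex b T)) F"
    have seg: "closed_segment (Complex a T') (Complex b T') \<subseteq> path_image g" if "T' \<in> {T, -T}" for T'
      using that ab Tp unfolding g_def
      by (auto simp: path_image_rectpath_iff closed_segment_same_Im closed_segment_eq_real_ivl)
    have h: "norm h1 \<le> \<phi> T * (b - a)" "norm h2 \<le> \<phi> T * (b - a)"
      unfolding h1_def h2_def
      by (intro horizontal_integral_bound ab continuous_on_subset[OF cont] seg; use bd[of "Complex _ T"] bd[of "Complex _ (-T)"] T in force)+
    have "2 * pi * \<i> * R = \<i> * integral {-T..T} (\<lambda>t. F (Complex b t)) - \<i> * integral {-T..T} (\<lambda>t. F (Complex a t)) + (h1 - h2)"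
      unfolding eq[symmetric] g_def h1_def h2_def
      by (rule contour_integral_rectpath[OF ab(2) Tp cont[unfolded g_def]])
    hence "\<i> * (integral {-T..T} (\<lambda>t. F (Complex b t)) - integral {-T..T} (\<lambda>t. F (Complex a t)) - 2 * pi * R) = h2 - h1"
      by (simp add: algebra_simps)
    hence "norm (\<i> * (integral {-T..T} (\<lambda>t. F (Complex b t)) - integral {-T..T} (\<lambda>t. F (Complex a t)) - 2 * pi * R)) = norm (h2 - h1)" by simp
    also have "\<dots> \<le> norm h2 + norm h1" by (rule norm_triangle_ineq4)
    also have "\<dots> \<le> 2 * (b - a) * \<phi> T" using h by (simp add: algebra_simps)
    finally show ?thesis by (simp add: norm_mult)
  qed
  have "((\<lambda>T. integral {-T..T} (\<lambda>t. F (Complex b t)) - integral {-T..T} (\<lambda>t. F (Complex a t)) - 2 * pi * R) \<longlongrightarrow> 0) at_top"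
  proof (rule Lim_null_comparison)
    show "\<forall>\<^sub>F T in at_top. norm (integral {-T..T} (\<lambda>t. F (Complex b t)) - integral {-T..T} (\<lambda>t. F (Complex a t)) - 2 * pi * R) \<le> 2 * (b - a) * \<phi> T"
      using eventually_ge_at_top[of "max 1 T0"] by eventually_elim (rule main)
    show "((\<lambda>T. 2 * (b - a) * \<phi> T) \<longlongrightarrow> 0) at_top" using tendsto_mult_right_zero[OF lim] by simp
  qed
  moreover have "((\<lambda>T. integral {-T..T} (\<lambda>t. F (Complex b t)) - integral {-T..T} (\<lambda>t. F (Complex a t)) - 2 * pi * R) \<longlongrightarrow>
     (LINT t|lborel. F (Complex b t)) - (LINT t|lborel. F (Complex a t)) - 2 * pi * R) at_top"
    by (intro tendsto_diff truncated_integral_tendsto int tendsto_const)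
  ultimately have "(LINT t|lborel. F (Complex b t)) - (LINT t|lborel. F (Complex a t)) - 2 * pi * R = 0"
    by (rule tendsto_unique[rotated -1, OF _ trivial_limit_at_top_linorder, THEN sym, rotated])
  thus ?thesis by (simp add: R_def algebra_simps)
qed

section \<open>Integrals against the Mellin kernel\<close>

text \<open>The sine makes this kernel useful in two ways: it has simple poles at the integers with
  residues (-1)^k y^k / pi, and it changes sign under w -> w + 1, so a translation by 1 multiplies
  the kernel by -y. Equating the two effects of moving a line yields equations for the
  integrals.\<close>

definition mellin_kernel :: "complex \<Rightarrow> complex \<Rightarrow> complex" where
  "mellin_kernel y w = y powr w / sin (of_real pi * w)"

text \<open>This is \<open>1/(2\<pi>i)\<close> times the contour integral over the upward line \<open>Re w = c\<close>, since \<open>dw = i dt\<close>.\<close>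

definition line_integral :: "(complex \<Rightarrow> complex) \<Rightarrow> real \<Rightarrow> complex \<Rightarrow> complex" where
  "line_integral f c y = (LINT t|lborel. f (Complex c t) * mellin_kernel y (Complex c t)) / (2 * pi)"

lemma Arg_less_pi:
  fixes y :: complex
  assumes "y \<notin> \<real>\<^sub>\<le>\<^sub>0" shows "\<bar>Arg y\<bar> < pi"
proof -
  have "Arg y \<noteq> pi" using assms by (auto simp: Arg_eq_pi complex_nonpos_Reals_iff)
  thus ?thesis using Arg_bounded[of y] by auto
qed

text \<open>|sin(x + iv)|^2 = (cosh 2v - cos 2x)/2. From height 1 on the hyperbolic term dominates;
  on a line with cos(2 pi Re w) \<le> 0 the other term cannot diminish it at any height.\<close>

lemma norm_sin_ge:
  assumes "\<bar>Im w\<bar> \<ge> 1 \<or> cos (2 * pi * Re w) \<le> 0"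
  shows "norm (sin (of_real pi * w)) \<ge> exp (pi * \<bar>Im w\<bar>) / 4"
proof -
  define E where "E = exp (2 * (pi * \<bar>Im w\<bar>))"
  have E1: "E \<ge> 1" by (simp add: E_def)
  have E: "E + inverse E = exp (2 * (pi * Im w)) + inverse (exp (2 * (pi * Im w)))"
    by (cases "Im w \<ge> 0") (auto simp: E_def exp_minus)
  have c1: "cos (2 * pi * Re w) \<le> 1" by simp
  have "(norm (sin (of_real pi * w)))\<^sup>2 = (E + inverse E - 2 * cos (2 * pi * Re w)) / 4"
    unfolding norm_sin_squared E by (simp add: mult.assoc)
  moreover have "E + inverse E - 2 * cos (2 * pi * Re w) \<ge> E / 4"
  proof (cases "\<bar>Im w\<bar> \<ge> 1")
    case True
    have "2 * (pi * 1) \<le> 2 * (pi * \<bar>Im w\<bar>)" using True by (intro mult_left_mono) auto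
    hence "6 \<le> 2 * (pi * \<bar>Im w\<bar>)" using pi_gt3 by argo
    hence "E \<ge> 7" using exp_ge_add_one_self[of "2 * (pi * \<bar>Im w\<bar>)"] unfolding E_def by argo
    moreover have "inverse E \<ge> 0" using E1 by simp
    ultimately show ?thesis using c1 by argo
  next
    case False
    moreover have "inverse E \<ge> 0" using E1 by simp
    ultimately show ?thesis using assms E1 by argo
  qed
  ultimately have "(norm (sin (of_real pi * w)))\<^sup>2 \<ge> E / 16" by argo
  also have "E / 16 = (exp (pi * \<bar>Im w\<bar>) / 4)\<^sup>2" by (simp add: E_def exp_double power_divide)
  finally show ?thesis by (rule power2_le_imp_le) simp
qed

lemma mellin_kernel_norm_le:
  assumes "\<bar>Im w\<bar> \<ge> 1 \<or> cos (2 * pi * Re w) \<le> 0"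
  shows "norm (mellin_kernel y w) \<le> 4 * exp (\<bar>Re w\<bar> * \<bar>ln (norm y)\<bar>) * exp (- (pi - \<bar>Arg y\<bar>) * \<bar>Im w\<bar>)"
proof -
  have 1: "norm (y powr w) \<le> exp (\<bar>Re w\<bar> * \<bar>ln (norm y)\<bar>) * exp (\<bar>Arg y\<bar> * \<bar>Im w\<bar>)"
  proof -
    have "norm y powr Re w \<le> exp (\<bar>Re w\<bar> * \<bar>ln (norm y)\<bar>)"
      using abs_ge_self[of "Re w * ln (norm y)"] by (simp add: powr_def abs_mult)
    moreover have "exp (- Im w * Arg y) \<le> exp (\<bar>Arg y\<bar> * \<bar>Im w\<bar>)"
      using abs_ge_self[of "- Im w * Arg y"] by (simp add: abs_mult mult.commute)
    ultimately show ?thesis unfolding norm_powr_complex by (intro mult_mono) auto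
  qed
  have "norm (mellin_kernel y w) = norm (y powr w) / norm (sin (of_real pi * w))"
    by (simp add: mellin_kernel_def norm_divide)
  also have "\<dots> \<le> (exp (\<bar>Re w\<bar> * \<bar>ln (norm y)\<bar>) * exp (\<bar>Arg y\<bar> * \<bar>Im w\<bar>)) / (exp (pi * \<bar>Im w\<bar>) / 4)"
    using 1 norm_sin_ge[OF assms] by (intro frac_le) auto
  also have "\<dots> = 4 * exp (\<bar>Re w\<bar> * \<bar>ln (norm y)\<bar>) * exp (- (pi - \<bar>Arg y\<bar>) * \<bar>Im w\<bar>)"
    by (simp add: exp_diff algebra_simps)
  finally show ?thesis .
qed

lemma sin_pi_nonzero: "cos (2 * pi * Re w) \<le> 0 \<Longrightarrow> sin (of_real pi * w) \<noteq> 0"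
  using norm_sin_ge[of w] exp_gt_zero[of "pi * \<bar>Im w\<bar>"] by (metis divide_pos_pos norm_zero not_le zero_less_numeral)

lemma continuous_on_mellin_kernel_line:
  assumes "y \<noteq> 0" "cos (2 * pi * c) \<le> 0"
  shows "continuous_on UNIV (\<lambda>t. mellin_kernel y (Complex c t))"
proof -
  have "Complex c = (\<lambda>t. of_real c + \<i> * of_real t)" by (auto simp: complex_eq_iff)
  moreover have "sin (of_real pi * (of_real c + \<i> * of_real t)) \<noteq> 0" for t
    using assms(2) by (intro sin_pi_nonzero) simp
  ultimately show ?thesis unfolding mellin_kernel_def powr_def using assms(1)
    by (auto intro!: continuous_intros)
qed

lemma integrable_mellin_kernel:
  fixes y :: complex
  assumes y: "y \<notin> \<real>\<^sub>\<le>\<^sub>0" and c: "cos (2 * pi * c) \<le> 0"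
    and f: "continuous_on UNIV (\<lambda>t. f (Complex c t))" "\<And>t. norm (f (Complex c t)) \<le> K * (1 + \<bar>t\<bar>)\<^sup>2"
  shows "integrable lborel (\<lambda>t. f (Complex c t) * mellin_kernel y (Complex c t))"
proof (rule integrable_exp_decay[where \<delta> = "pi - \<bar>Arg y\<bar>" and K = "K * (4 * exp (\<bar>c\<bar> * \<bar>ln (norm y)\<bar>))"])
  show "continuous_on UNIV (\<lambda>t. f (Complex c t) * mellin_kernel y (Complex c t))"
    using y c by (intro continuous_intros f continuous_on_mellin_kernel_line) auto
  show "pi - \<bar>Arg y\<bar> > 0" using Arg_less_pi[OF y] by simp
  fix t
  have K: "K * (1 + \<bar>t\<bar>)\<^sup>2 \<ge> 0" using f(2)[of t] norm_ge_zero order_trans by blast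
  have "norm (f (Complex c t) * mellin_kernel y (Complex c t)) \<le>
     (K * (1 + \<bar>t\<bar>)\<^sup>2) * (4 * exp (\<bar>c\<bar> * \<bar>ln (norm y)\<bar>) * exp (- (pi - \<bar>Arg y\<bar>) * \<bar>t\<bar>))"
    unfolding norm_mult using mellin_kernel_norm_le[of "Complex c t" y] c
    by (intro mult_mono f(2) K) auto
  thus "norm (f (Complex c t) * mellin_kernel y (Complex c t)) \<le>
     K * (4 * exp (\<bar>c\<bar> * \<bar>ln (norm y)\<bar>)) * ((1 + \<bar>t\<bar>)\<^sup>2 * exp (- (pi - \<bar>Arg y\<bar>) * \<bar>t\<bar>))"
    by (simp only: mult_ac)
qed

lemma mellin_kernel_scale:
  fixes y :: complex
  assumes "r > 0" "y \<noteq> 0"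
  shows "mellin_kernel (of_real r * y) w = of_real r powr w * mellin_kernel y w"
proof -
  have "Ln (of_real r * y) = of_real (ln r) + Ln y" using Ln_times_of_real[OF assms] Ln_of_real[OF assms(1)] by simp
  thus ?thesis using assms by (simp add: mellin_kernel_def powr_def Ln_of_real ring_distribs exp_add)
qed

lemma mellin_kernel_add_1:
  fixes y :: complex
  assumes "y \<noteq> 0"
  shows "mellin_kernel y (w + 1) = - y * mellin_kernel y w"
proof -
  have "sin (of_real pi * (w + 1)) = - sin (of_real pi * w)"
    using sin_plus_pi[of "of_real pi * w"] by (simp add: ring_distribs)
  thus ?thesis using assms by (simp add: mellin_kernel_def powr_add)
qed

lemma residue_mellin_kernel:
  fixes y :: complex
  assumes "open A" "of_nat k \<in> A" "f holomorphic_on A" "\<And>w. w \<in> A \<Longrightarrow> w \<noteq> of_nat k \<Longrightarrow> sin (of_real pi * w) \<noteq> 0" "y \<notin> \<real>\<^sub>\<le>\<^sub>0"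
  shows "residue (\<lambda>w. f w * mellin_kernel y w) (of_nat k) = (-1) ^ k * f (of_nat k) * y ^ k / pi"
proof (rule residue_simple'[OF assms(1,2)])
  have y0: "y \<noteq> 0" using assms(5) by auto
  show "(\<lambda>w. f w * mellin_kernel y w) holomorphic_on A - {of_nat k}"
    unfolding mellin_kernel_def using assms y0
    by (intro holomorphic_intros holomorphic_on_subset[OF assms(3)]) auto
  have s0: "sin (complex_of_real pi * of_nat k) = 0"
    using sin_npi[of k] by (metis mult.commute of_real_0 of_real_mult of_real_of_nat_eq sin_of_real)
  have c0: "cos (complex_of_real pi * of_nat k) = (-1) ^ k"
    using cos_npi[of k] by (metis mult.commute of_real_mult of_real_of_nat_eq cos_of_real of_real_power of_real_minus of_real_1)
  have "((\<lambda>w. sin (complex_of_real pi * w)) has_field_derivative of_real pi * (-1) ^ k) (at (of_nat k))"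
    by (auto intro!: derivative_eq_intros simp: c0)
  hence "((\<lambda>w. (sin (of_real pi * w) - sin (of_real pi * of_nat k)) / (w - of_nat k)) \<longlongrightarrow> of_real pi * (-1) ^ k) (at (complex_of_nat k))"
    by (simp only: has_field_derivative_iff)
  hence 1: "((\<lambda>w. inverse (sin (of_real pi * w) / (w - of_nat k))) \<longlongrightarrow> inverse (of_real pi * (-1) ^ k)) (at (complex_of_nat k))"
    unfolding s0 by (intro tendsto_inverse) auto
  have "continuous_on A f" by (rule holomorphic_on_imp_continuous_on) fact
  hence "(f \<longlongrightarrow> f (of_nat k)) (at (of_nat k))"
    using assms(1,2) by (simp add: continuous_on_eq_continuous_at isCont_def)
  moreover have "((\<lambda>w. y powr w) \<longlongrightarrow> y powr of_nat k) (at (of_nat k))"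
    using y0 by (auto intro!: tendsto_intros simp: powr_def)
  ultimately have "((\<lambda>w. f w * y powr w * inverse (sin (of_real pi * w) / (w - of_nat k))) \<longlongrightarrow> f (of_nat k) * y powr of_nat k * inverse (of_real pi * (-1) ^ k)) (at (of_nat k))"
    by (intro tendsto_mult 1)
  also have "f (of_nat k) * y powr of_nat k * inverse (of_real pi * (-1) ^ k) = (-1) ^ k * f (of_nat k) * y ^ k / pi"
    using y0 by (cases "even k") (auto simp: powr_nat field_simps)
  finally show "((\<lambda>w. f w * mellin_kernel y w * (w - of_nat k)) \<longlongrightarrow> (-1) ^ k * f (of_nat k) * y ^ k / pi) (at (of_nat k))"
    by (simp add: mellin_kernel_def field_simps)
qed

lemma Complex_line: "Complex c = (\<lambda>t. of_real c + \<i> * of_real t)"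
  by (auto simp: complex_eq_iff)

lemma cos_three_quarters: "cos (2 * pi * (3/4 + real n)) = 0"
proof -
  have "2 * pi * (3/4 + real n) = (pi * real (2 * n) + pi / 2) + pi" by (simp add: algebra_simps)
  hence "cos (2 * pi * (3/4 + real n)) = - cos (pi * real (2 * n) + pi / 2)" by (simp only: cos_periodic_pi)
  also have "\<dots> = sin (pi * real (2 * n))" by (simp only: cos_add cos_pi_half sin_pi_half)
  also have "\<dots> = 0" by (rule sin_npi2)
  finally show ?thesis .
qed

text \<open>The poles crossed are exactly the integers 1, ..., n: f is holomorphic for Re w > 1/2,
  so only the sine contributes. The new line satisfies the same cosine condition as the old one,
  which gives integrability on both.\<close>

lemma line_integral_shift:
  fixes y :: complex
  assumes y: "y \<notin> \<real>\<^sub>\<le>\<^sub>0" and f: "f holomorphic_on {w. Re w > 1/2}"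
    and bd: "\<And>w. Re w \<ge> 3/4 \<Longrightarrow> Re w \<le> 3/4 + real n \<Longrightarrow> norm (f w) \<le> K * (1 + \<bar>Im w\<bar>)\<^sup>2" and n: "n > 0"
  shows "line_integral f (3/4 + real n) y = line_integral f (3/4) y + (\<Sum>k=1..n. (-1) ^ k * f (of_nat k) * y ^ k / pi)"
proof -
  define F where "F = (\<lambda>w. f w * mellin_kernel y w)"
  define S where "S = complex_of_nat ` {1..n}"
  define \<delta> where "\<delta> = pi - \<bar>Arg y\<bar>"
  have \<delta>: "\<delta> > 0" using Arg_less_pi[OF y] by (simp add: \<delta>_def)
  have y0: "y \<noteq> 0" using y by auto
  define C where "C = \<bar>K\<bar> * (4 * exp ((3/4 + real n) * \<bar>ln (norm y)\<bar>))"
  have sinz: "w \<in> S" if w': "1/2 < Re w" "Re w < 1 + real n" "sin (of_real pi * w) = 0" for w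
  proof -
    obtain i :: int where "of_real pi * w = of_int i * of_real pi" using w'(3) by (auto simp: sin_eq_0 mult.commute)
    hence w: "w = of_int i" by simp
    hence "i \<ge> 1" "i \<le> int n" using w' by auto
    hence "w = of_nat (nat i)" "nat i \<in> {1..n}" using w by auto
    thus ?thesis by (auto simp: S_def)
  qed
  have holF: "F holomorphic_on {w. 1/2 < Re w \<and> Re w < 1 + real n} - S"
    unfolding F_def mellin_kernel_def using y0 sinz
    by (intro holomorphic_intros holomorphic_on_subset[OF f]) auto
  have int: "integrable lborel (\<lambda>t. F (Complex (3/4 + real m) t))" if "m \<in> {0, n}" for m
    unfolding F_def
  proof (rule integrable_mellin_kernel[OF y])
    show "cos (2 * pi * (3/4 + real m)) \<le> 0" by (simp only: cos_three_quarters)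
    show "continuous_on UNIV (\<lambda>t. f (Complex (3/4 + real m) t))"
      by (rule continuous_on_compose2[OF holomorphic_on_imp_continuous_on[OF f]])
         (auto simp: Complex_line intro!: continuous_intros)
    show "norm (f (Complex (3/4 + real m) t)) \<le> K * (1 + \<bar>t\<bar>)\<^sup>2" for t
      using bd[of "Complex (3/4 + real m) t"] that by auto
  qed
  have "(LINT t|lborel. F (Complex (3/4 + real n) t)) = (LINT t|lborel. F (Complex (3/4) t)) + 2 * pi * (\<Sum>p\<in>S. residue F p)"
  proof (rule vertical_line_shift[where a' = "1/2" and b' = "1 + real n" and \<phi> = "\<lambda>t. C * (exp (\<delta> / 2) * (4 / \<delta>)\<^sup>2) * exp (- (\<delta> / 2) * t)"])
    show "finite S" by (simp add: S_def)
    show "\<And>p. p \<in> S \<Longrightarrow> 3/4 < Re p \<and> Re p < 3/4 + real n" by (auto simp: S_def)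
    show "integrable lborel (\<lambda>t. F (Complex (3/4) t))" "integrable lborel (\<lambda>t. F (Complex (3/4 + real n) t))"
      using int[of 0] int[of n] by simp_all
    show "((\<lambda>t. C * (exp (\<delta> / 2) * (4 / \<delta>)\<^sup>2) * exp (- (\<delta> / 2) * t)) \<longlongrightarrow> 0) at_top"
    proof (rule tendsto_mult_right_zero)
      have "filterlim (\<lambda>t. (\<delta> / 2) * t) at_top at_top" using \<delta> by (intro filterlim_tendsto_pos_mult_at_top[OF tendsto_const] filterlim_ident) auto
      hence "filterlim (\<lambda>t. - ((\<delta> / 2) * t)) at_bot at_top" by (simp add: filterlim_uminus_at_bot)
      thus "((\<lambda>t. exp (- (\<delta> / 2) * t)) \<longlongrightarrow> 0) at_top" by (intro filterlim_compose[OF exp_at_bot]) simp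
    qed
    fix w assume w: "3/4 \<le> Re w" "Re w \<le> 3/4 + real n" "1 \<le> \<bar>Im w\<bar>"
    have K: "K * (1 + \<bar>Im w\<bar>)\<^sup>2 \<ge> 0" using bd[OF w(1,2)] norm_ge_zero order_trans by blast
    have "norm (F w) \<le> K * (1 + \<bar>Im w\<bar>)\<^sup>2 * (4 * exp (\<bar>Re w\<bar> * \<bar>ln (norm y)\<bar>) * exp (- \<delta> * \<bar>Im w\<bar>))"
      unfolding F_def norm_mult \<delta>_def using w K by (intro mult_mono bd mellin_kernel_norm_le) auto
    also have "\<dots> \<le> \<bar>K\<bar> * (1 + \<bar>Im w\<bar>)\<^sup>2 * (4 * exp ((3/4 + real n) * \<bar>ln (norm y)\<bar>) * exp (- \<delta> * \<bar>Im w\<bar>))"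
      using w by (intro mult_mono mult_right_mono mult_left_mono) (auto intro!: mult_right_mono)
    also have "\<dots> = C * ((1 + \<bar>Im w\<bar>)\<^sup>2 * exp (- \<delta> * \<bar>Im w\<bar>))" by (simp add: C_def)
    also have "\<dots> \<le> C * (exp (\<delta> / 2) * (4 / \<delta>)\<^sup>2 * exp (- (\<delta> / 2) * \<bar>Im w\<bar>))"
      using \<delta> by (intro mult_left_mono poly_exp_le) (auto simp: C_def)
    finally show "norm (F w) \<le> C * (exp (\<delta> / 2) * (4 / \<delta>)\<^sup>2) * exp (- (\<delta> / 2) * \<bar>Im w\<bar>)" by (simp only: mult.assoc)
  qed (use n holF in auto)
  also have "(\<Sum>p\<in>S. residue F p) = (\<Sum>k=1..n. residue F (of_nat k))"
    unfolding S_def by (subst sum.reindex) (auto simp: inj_on_def)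
  also have "\<dots> = (\<Sum>k=1..n. (-1) ^ k * f (of_nat k) * y ^ k / pi)"
  proof (intro sum.cong refl)
    fix k assume k: "k \<in> {1..n}"
    define A where "A = ball (complex_of_nat k) (1/2)"
    have A: "real k - 1/2 < Re w \<and> Re w < real k + 1/2" if "w \<in> A" for w
      using that abs_Re_le_cmod[of "of_nat k - w"] by (auto simp: A_def dist_norm)
    have nz: "sin (of_real pi * w) \<noteq> 0" if "w \<in> A" "w \<noteq> of_nat k" for w
    proof
      assume "sin (of_real pi * w) = 0"
      moreover have "1/2 < Re w" "Re w < 1 + real n" using A[OF that(1)] k by auto
      ultimately obtain j where "w = of_nat j" using sinz by (auto simp: S_def)
      thus False using A[OF that(1)] that(2) by auto
    qed
    have "f holomorphic_on A" by (rule holomorphic_on_subset[OF f]) (use A k in force)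
    from residue_mellin_kernel[OF _ _ this nz y, of k]
    show "residue F (of_nat k) = (-1) ^ k * f (of_nat k) * y ^ k / pi" by (simp add: A_def F_def)
  qed
  finally show ?thesis unfolding line_integral_def F_def by (simp add: add_divide_distrib)
qed

lemma line_integral_translate:
  fixes y :: complex
  assumes "y \<noteq> 0"
  shows "line_integral f (c + 1) y = - y * line_integral (\<lambda>w. f (w + 1)) c y"
proof -
  have c: "Complex (c + 1) t = Complex c t + 1" for t by (simp add: complex_eq_iff)
  have "line_integral f (c + 1) y = (LINT t|lborel. - y * (f (Complex c t + 1) * mellin_kernel y (Complex c t))) / (2 * pi)"
    unfolding line_integral_def c mellin_kernel_add_1[OF assms] by (simp add: mult_ac)
  also have "(LINT t|lborel. - y * (f (Complex c t + 1) * mellin_kernel y (Complex c t))) = - y * (LINT t|lborel. f (Complex c t + 1) * mellin_kernel y (Complex c t))"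
    by (rule integral_mult_right_zero)
  finally show ?thesis by (simp add: line_integral_def)
qed

lemma one_plus_nonzero: "y \<notin> \<real>\<^sub>\<le>\<^sub>0 \<Longrightarrow> 1 + y \<noteq> (0 :: complex)"
  by (auto simp: complex_nonpos_Reals_iff complex_eq_iff)

lemma line_integral_one:
  fixes y :: complex
  assumes "y \<notin> \<real>\<^sub>\<le>\<^sub>0"
  shows "line_integral (\<lambda>_. 1) (3/4) y = y / (pi * (1 + y))"
proof -
  define I where "I = line_integral (\<lambda>_. 1) (3/4) y"
  have "line_integral (\<lambda>_. 1) (3/4 + real 1) y = I + (\<Sum>k=1..1. (-1) ^ k * 1 * y ^ k / pi)"
    unfolding I_def by (rule line_integral_shift[OF assms, where K = 1]) (auto intro!: one_le_power)
  moreover have "line_integral (\<lambda>_. 1) (3/4 + 1) y = - y * I"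
    using assms unfolding I_def by (intro line_integral_translate) auto
  ultimately have "- y * I = I - y / pi" by simp
  hence "I * (pi * (1 + y)) = y" by (simp add: field_simps)
  moreover have "pi * (1 + y) \<noteq> 0" using one_plus_nonzero[OF assms] by simp
  ultimately show ?thesis unfolding I_def[symmetric] by (simp only: eq_divide_eq) simp
qed

section \<open>Kernel integrals of simple poles and of n^(-w)\<close>

lemma has_integral_complex_powr_01:
  assumes "Re s > -1"
  shows "((\<lambda>x. of_real x powr s) has_integral 1 / (s + 1)) {0..1}"
proof -
  have s1: "s + 1 \<noteq> 0" using assms by (auto simp: complex_eq_iff)
  have "((\<lambda>x. of_real x powr s) has_integral (of_real 1 powr (s + 1) / (s + 1) - of_real 0 powr (s + 1) / (s + 1))) {0..1}"
  proof (rule fundamental_theorem_of_calculus_interior)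
    show "continuous_on {0..1} (\<lambda>x. of_real x powr (s + 1) / (s + 1))"
      using assms s1 by (intro continuous_intros) auto
    fix x :: real assume x: "x \<in> {0<..<1}"
    have "((\<lambda>u. u powr (s + 1) / (s + 1)) has_field_derivative of_real x powr s) (at (of_real x))"
      using x s1 by (auto intro!: derivative_eq_intros)
    from has_vector_derivative_real_field[OF this]
    show "((\<lambda>x. of_real x powr (s + 1) / (s + 1)) has_vector_derivative of_real x powr s) (at x)" by simp
  qed auto
  thus ?thesis by simp
qed

lemma integrable_real_powr_01:
  assumes "s > (-1::real)"
  shows "integrable lborel (\<lambda>x. indicator {0..1} x * x powr s)" "(LINT x|lborel. indicator {0..1} x * x powr s) = 1 / (s + 1)"
proof -
  have h: "((\<lambda>x. x powr s) has_integral 1 / (s + 1)) {0..1}"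
    using has_integral_powr_from_0[of s 1] assms by simp
  hence "(\<lambda>x. x powr s) absolutely_integrable_on {0..1}"
    by (intro nonnegative_absolutely_integrable_1) auto
  hence *: "set_integrable lborel {0..1} (\<lambda>x. x powr s)"
    unfolding set_integrable_def by (subst (asm) integrable_completion) auto
  thus "integrable lborel (\<lambda>x. indicator {0..1} x * x powr s)" by (simp add: set_integrable_def)
  show "(LINT x|lborel. indicator {0..1} x * x powr s) = 1 / (s + 1)"
    using set_borel_integral_eq_integral(2)[OF *] integral_unique[OF h] by (simp add: set_lebesgue_integral_def)
qed

lemma integrable_complex_powr_01:
  assumes "Re s > -1"
  shows "integrable lborel (\<lambda>x. indicator {0..1} x *\<^sub>R (complex_of_real x powr s))"
    "(LINT x|lborel. indicator {0..1} x *\<^sub>R (complex_of_real x powr s)) = 1 / (s + 1)"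
proof -
  show *: "integrable lborel (\<lambda>x. indicator {0..1} x *\<^sub>R (complex_of_real x powr s))"
  proof (rule Bochner_Integration.integrable_bound[OF integrable_real_powr_01(1)[OF assms]])
    have "norm (indicator {0..1} x *\<^sub>R (complex_of_real x powr s)) \<le> norm (indicator {0..1} x * x powr Re s)" for x
      by (cases "x = 0") (auto simp: indicator_def norm_powr_real_powr)
    thus "AE x in lborel. norm (indicator {0..1} x *\<^sub>R (complex_of_real x powr s)) \<le> norm (indicator {0..1} x * x powr Re s)"
      by simp
  qed measurable
  show "(LINT x|lborel. indicator {0..1} x *\<^sub>R (complex_of_real x powr s)) = 1 / (s + 1)"
    using set_borel_integral_eq_integral(2)[of "{0..1}" "\<lambda>x. complex_of_real x powr s"] *
      integral_unique[OF has_integral_complex_powr_01[OF assms]]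
    by (simp add: set_lebesgue_integral_def set_integrable_def)
qed

lemma of_real_mult_notin_nonpos_Reals:
  "r > 0 \<Longrightarrow> y \<notin> \<real>\<^sub>\<le>\<^sub>0 \<Longrightarrow> complex_of_real r * y \<notin> \<real>\<^sub>\<le>\<^sub>0"
  by (auto simp: complex_nonpos_Reals_iff mult_le_0_iff)

lemma csqrt_Re_pos: "y \<notin> \<real>\<^sub>\<le>\<^sub>0 \<Longrightarrow> Re (csqrt y) > 0"
proof -
  assume y: "y \<notin> \<real>\<^sub>\<le>\<^sub>0"
  have "Re (csqrt y) \<noteq> 0"
  proof
    assume 0: "Re (csqrt y) = 0"
    have "y = (csqrt y)\<^sup>2" by simp
    hence "Im y = 0" "Re y \<le> 0" using 0 by (metis Im_power2 mult_zero_left mult_zero_right) (metis 0 Re_power2 \<open>y = (csqrt y)\<^sup>2\<close> diff_0 neg_le_0_iff_le zero_le_power2 power_zero_numeral)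
    thus False using y by (simp add: complex_nonpos_Reals_iff)
  qed
  moreover have "Re (csqrt y) \<ge> 0" using csqrt_principal[of y] by auto
  ultimately show ?thesis by simp
qed

text \<open>The antiderivative 4 sqrt(y) Arctan(sqrt(x y)) comes from the substitution x = u^2.
  Since Re (csqrt y) > 0, its argument keeps off the branch cuts of \<open>Arctan\<close>; at x = 0,
  where the integrand is singular, only continuity of the antiderivative is used.\<close>

lemma has_integral_csqrt_Arctan:
  fixes y :: complex assumes y: "y \<notin> \<real>\<^sub>\<le>\<^sub>0"
  shows "((\<lambda>x. of_real (2 * x powr (-1/2)) * (y / (1 + of_real x * y))) has_integral 4 * csqrt y * Arctan (csqrt y)) {0..1}"
proof -
  have Re: "Re (csqrt y) > 0" by (rule csqrt_Re_pos[OF y])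
  have "((\<lambda>x. of_real (2 * x powr (-1/2)) * (y / (1 + of_real x * y))) has_integral
     4 * csqrt y * Arctan (of_real (sqrt 1) * csqrt y) - 4 * csqrt y * Arctan (of_real (sqrt 0) * csqrt y)) {0..1}"
  proof (rule fundamental_theorem_of_calculus_interior)
    have "isCont Arctan (of_real (sqrt x) * csqrt y)" if "x \<in> {0..1}" for x
    proof (cases "x = 0")
      case False
      hence "Re (of_real (sqrt x) * csqrt y) > 0" using that Re by simp
      thus ?thesis by (intro continuous_at_Arctan) auto
    qed (auto intro: continuous_at_Arctan)
    hence "isCont (\<lambda>x. Arctan (of_real (sqrt x) * csqrt y)) x" if "x \<in> {0..1}" for x
      by (rule isCont_o2[rotated]) (use that in \<open>auto intro!: continuous_intros\<close>)
    thus "continuous_on {0..1} (\<lambda>x. 4 * csqrt y * Arctan (of_real (sqrt x) * csqrt y))"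
      by (intro continuous_at_imp_continuous_on ballI isCont_mult continuous_const)
    fix x :: real assume x: "x \<in> {0<..<1}"
    have nz: "1 + of_real x * y \<noteq> 0" using x y by (intro one_plus_nonzero of_real_mult_notin_nonpos_Reals) auto
    have Re': "Re (of_real (sqrt x) * csqrt y) \<noteq> 0" using x Re by simp
    have "((\<lambda>x. of_real (sqrt x)) has_vector_derivative complex_of_real (inverse (sqrt x) / 2)) (at x)"
      using x by (intro has_vector_derivative_of_real) (auto intro!: derivative_eq_intros)
    hence 1: "((\<lambda>x. of_real (sqrt x) * csqrt y) has_vector_derivative complex_of_real (inverse (sqrt x) / 2) * csqrt y) (at x)"
      by (rule has_vector_derivative_mult_left)
    have 2: "(Arctan has_field_derivative inverse (1 + (of_real (sqrt x) * csqrt y)\<^sup>2)) (at (of_real (sqrt x) * csqrt y))"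
      using Re' by (intro has_field_derivative_Arctan) auto
    have "((Arctan \<circ> (\<lambda>x. of_real (sqrt x) * csqrt y)) has_vector_derivative
        complex_of_real (inverse (sqrt x) / 2) * csqrt y * inverse (1 + (of_real (sqrt x) * csqrt y)\<^sup>2)) (at x)"
      by (rule field_vector_diff_chain_at[OF 1 2])
    hence "((\<lambda>x. 4 * csqrt y * Arctan (of_real (sqrt x) * csqrt y)) has_vector_derivative
        4 * csqrt y * (complex_of_real (inverse (sqrt x) / 2) * csqrt y * inverse (1 + (of_real (sqrt x) * csqrt y)\<^sup>2))) (at x)"
      unfolding o_def by (rule has_vector_derivative_mult_right)
    also have "(of_real (sqrt x) * csqrt y)\<^sup>2 = of_real x * y"
      using x by (simp add: power_mult_distrib flip: of_real_power)
    also have "4 * csqrt y * (complex_of_real (inverse (sqrt x) / 2) * csqrt y * inverse (1 + of_real x * y))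
        = of_real (2 * inverse (sqrt x)) * ((csqrt y)\<^sup>2 / (1 + of_real x * y))"
    proof -
      have "4 * c * (k / 2 * c * inverse D) = (2 * k) * (c\<^sup>2 / D)" for c k D :: complex
      proof -
        have "4 * c * (k / 2 * c * inverse D) = (4 * (k / 2)) * (c * c * inverse D)" by (simp only: mult_ac)
        also have "4 * (k / 2) = 2 * k" by simp
        finally show ?thesis by (simp only: power2_eq_square divide_inverse)
      qed
      from this[of "csqrt y" "of_real (inverse (sqrt x))" "1 + of_real x * y"] show ?thesis
        by (simp only: of_real_divide of_real_mult of_real_numeral)
    qed
    also have "\<dots> = of_real (2 * x powr (-1/2)) * (y / (1 + of_real x * y))"
      using x by (simp add: powr_minus powr_half_sqrt)
    finally show "((\<lambda>x. 4 * csqrt y * Arctan (of_real (sqrt x) * csqrt y)) has_vector_derivative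
        of_real (2 * x powr (-1/2)) * (y / (1 + of_real x * y))) (at x)" .
  qed auto
  thus ?thesis by simp
qed

text \<open>1/(w - 1/2) is the integral of x^(w - 3/2) over [0, 1], convergent because Re w = 3/4
  exceeds 1/2. By Fubini the inner integral is that of the constant 1 against the kernel at x y, and
  the remaining integral over x is an arctangent.\<close>

lemma line_integral_pole_half:
  fixes y :: complex assumes y: "y \<notin> \<real>\<^sub>\<le>\<^sub>0"
  shows "line_integral (\<lambda>w. 1 / (w - 1/2)) (3/4) y = 2 / pi * csqrt y * Arctan (csqrt y)"
proof -
  have y0: "y \<noteq> 0" using y by auto
  define W where "W = (\<lambda>t. Complex (3/4) t)"
  define k where "k = (\<lambda>t. mellin_kernel y (W t))"
  have c0: "cos (2 * pi * (3/4)) \<le> 0" using cos_three_quarters[of 0] by simp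
  have intk: "integrable lborel (\<lambda>t. mellin_kernel y' (W t))" if "y' \<notin> \<real>\<^sub>\<le>\<^sub>0" for y'
    using integrable_mellin_kernel[OF that c0, of "\<lambda>_. 1" 1] by (simp add: W_def)
  have [measurable]: "k \<in> borel_measurable borel"
    using borel_measurable_integrable[OF intk[OF y]] by (simp add: k_def)
  have [measurable]: "W \<in> borel_measurable borel" unfolding W_def Complex_line by measurable
  define G where "G = (\<lambda>t x. indicator {0..1} x *\<^sub>R (of_real x powr (W t - 3/2) * k t))"
  have ReW: "Re (W t) = 3/4" for t by (simp add: W_def)
  have "integrable (lborel \<Otimes>\<^sub>M lborel) (\<lambda>(t, x). G t x)"
  proof (rule lborel_pair.Fubini_integrable)
    show "(\<lambda>(t, x). G t x) \<in> borel_measurable (lborel \<Otimes>\<^sub>M lborel)" unfolding G_def by measurable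
    have "(LINT x|lborel. norm (G t x)) = 4 * norm (k t)" for t
    proof -
      have "norm (G t x) = (indicator {0..1} x * x powr (-3/4)) * norm (k t)" for x
        unfolding G_def by (cases "x = 0") (auto simp: indicator_def norm_mult norm_powr_real_powr ReW)
      thus ?thesis using integrable_real_powr_01(2)[of "-3/4"] by simp
    qed
    thus "integrable lborel (\<lambda>t. LINT x|lborel. norm (case (t, x) of (t, x) \<Rightarrow> G t x))"
      using intk[OF y] by (auto simp: k_def intro!: integrable_norm)
    show "AE t in lborel. integrable lborel (\<lambda>x. case (t, x) of (t, x) \<Rightarrow> G t x)"
    proof (rule AE_I2)
      fix t
      have "integrable lborel (\<lambda>x. (indicator {0..1} x *\<^sub>R (complex_of_real x powr (W t - 3/2))) * k t)"
        by (intro integrable_mult_left integrable_complex_powr_01) (simp add: ReW)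
      thus "integrable lborel (\<lambda>x. case (t, x) of (t, x) \<Rightarrow> G t x)" by (simp add: G_def)
    qed
  qed
  hence int: "integrable (lborel \<Otimes>\<^sub>M lborel) (case_prod G)" by simp
  have swap: "(LINT x|lborel. LINT t|lborel. G t x) = (LINT t|lborel. LINT x|lborel. G t x)"
    by (rule lborel_pair.Fubini_integral[OF int])
  have L: "(LINT x|lborel. G t x) = 1 / (W t - 1/2) * k t" for t
  proof -
    have "(LINT x|lborel. G t x) = (LINT x|lborel. (indicator {0..1} x *\<^sub>R (complex_of_real x powr (W t - 3/2))) * k t)"
      by (simp add: G_def)
    also have "\<dots> = (LINT x|lborel. (indicator {0..1} x *\<^sub>R (complex_of_real x powr (W t - 3/2)))) * k t"
      by (rule integral_mult_left_zero)
    also have "\<dots> = 1 / (W t - 3/2 + 1) * k t" by (subst integrable_complex_powr_01(2)) (simp_all add: ReW)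
    finally show ?thesis by simp
  qed
  have R: "(LINT t|lborel. G t x) = indicator {0..1} x *\<^sub>R (of_real (2 * x powr (-1/2)) * (y / (1 + of_real x * y)))" for x
  proof (cases "x \<in> {0<..1}")
    case True
    hence x: "x > 0" "x \<le> 1" by auto
    have xy: "of_real x * y \<notin> \<real>\<^sub>\<le>\<^sub>0" using x y by (intro of_real_mult_notin_nonpos_Reals)
    have "(LINT t|lborel. G t x) = (LINT t|lborel. of_real x powr (-3/2) * (1 * mellin_kernel (of_real x * y) (W t)))"
    proof (intro Bochner_Integration.integral_cong refl)
      fix t
      have "-3/2 + W t = W t - 3/2" by simp
      hence e: "complex_of_real x powr (W t - 3/2) = of_real x powr (-3/2) * of_real x powr (W t)"
        using powr_add[of "complex_of_real x" "-3/2" "W t"] x by simp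
      show "G t x = of_real x powr (-3/2) * (1 * mellin_kernel (of_real x * y) (W t))"
        unfolding G_def k_def mellin_kernel_scale[OF x(1) y0] e using x by (simp add: indicator_def)
    qed
    also have "\<dots> = of_real x powr (-3/2) * (LINT t|lborel. 1 * mellin_kernel (of_real x * y) (W t))"
      by (rule integral_mult_right_zero)
    also have "(LINT t|lborel. 1 * mellin_kernel (of_real x * y) (W t)) = 2 * pi * line_integral (\<lambda>_. 1) (3/4) (of_real x * y)"
      by (simp add: line_integral_def W_def)
    also have "\<dots> = 2 * (of_real x * y) / (1 + of_real x * y)"
      unfolding line_integral_one[OF xy] by simp
    also have "of_real x powr (-3/2) = complex_of_real (x powr (-3/2))"
      using x by (simp add: powr_of_real[symmetric])
    also have "x powr (-3/2) = x powr (-1/2) / x"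
    proof -
      have "(-3/2::real) + 1 = -1/2" by simp
      hence "x powr (-1/2) = x powr (-3/2) * x powr 1" by (metis powr_add)
      thus ?thesis using x by simp
    qed
    finally show ?thesis using x by (simp add: indicator_def)
  next
    case False
    thus ?thesis by (cases "x = 0") (auto simp: G_def indicator_def)
  qed
  have intx: "integrable lborel (\<lambda>x. LINT t|lborel. G t x)"
    using lborel_pair.integrable_snd[OF int] by simp
  have "(LINT t|lborel. 1 / (W t - 1/2) * k t) = (LINT x|lborel. indicator {0..1} x *\<^sub>R (of_real (2 * x powr (-1/2)) * (y / (1 + of_real x * y))))"
    using swap unfolding L R by simp
  also have "\<dots> = integral {0..1} (\<lambda>x. of_real (2 * x powr (-1/2)) * (y / (1 + of_real x * y)))"
    using set_borel_integral_eq_integral(2)[of "{0..1}" "\<lambda>x. of_real (2 * x powr (-1/2)) * (y / (1 + of_real x * y))"] intx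
    unfolding R by (simp add: set_lebesgue_integral_def set_integrable_def)
  also have "\<dots> = 4 * csqrt y * Arctan (csqrt y)"
    by (rule integral_unique[OF has_integral_csqrt_Arctan[OF y]])
  finally show ?thesis by (simp add: line_integral_def k_def W_def)
qed

lemma line_integral_nat_powr:
  fixes y :: complex assumes y: "y \<notin> \<real>\<^sub>\<le>\<^sub>0" and n: "n > 0"
  shows "line_integral (\<lambda>w. of_nat n powr (- w)) (3/4) y = y / (pi * (y + of_nat n))"
proof -
  have r: "1 / real n > 0" and y0: "y \<noteq> 0" using n y by auto
  have "of_nat n powr (- w) * mellin_kernel y w = 1 * mellin_kernel (of_real (1 / real n) * y) w" for w
  proof -
    have l1: "Ln (complex_of_real (1 / real n)) = - of_real (ln (real n))"
      unfolding Ln_of_real[OF r] using n by (simp add: ln_div)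
    have l2: "Ln (of_nat n) = complex_of_real (ln (real n))" using Ln_of_real[of "real n"] n by simp
    have "complex_of_real (1 / real n) \<noteq> 0" using n by simp
    hence "complex_of_real (1 / real n) powr w = exp (w * (- of_real (ln (real n))))"
      unfolding l1[symmetric] by (simp only: powr_def if_False)
    moreover have "of_nat n powr (- w) = exp (- w * of_real (ln (real n)))"
      unfolding l2[symmetric] using n by (simp add: powr_def)
    ultimately have "complex_of_real (1 / real n) powr w = of_nat n powr (- w)" by simp
    thus ?thesis unfolding mellin_kernel_scale[OF r y0, of w] by simp
  qed
  hence "line_integral (\<lambda>w. of_nat n powr (- w)) (3/4) y = line_integral (\<lambda>_. 1) (3/4) (of_real (1 / real n) * y)"
    unfolding line_integral_def by (simp only:)
  also have "\<dots> = (of_real (1 / real n) * y) / (pi * (1 + of_real (1 / real n) * y))"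
    using y r by (intro line_integral_one of_real_mult_notin_nonpos_Reals)
  also have "\<dots> = y / (pi * (y + of_nat n))"
    using n by (simp add: field_simps)
  finally show ?thesis .
qed

lemma line_integral_add:
  assumes "integrable lborel (\<lambda>t. f (Complex c t) * mellin_kernel y (Complex c t))"
    "integrable lborel (\<lambda>t. g (Complex c t) * mellin_kernel y (Complex c t))"
  shows "line_integral (\<lambda>w. f w + g w) c y = line_integral f c y + line_integral g c y"
  unfolding line_integral_def using Bochner_Integration.integral_add[OF assms]
  by (simp add: ring_distribs add_divide_distrib)

lemma line_integral_cmult: "line_integral (\<lambda>w. a * f w) c y = a * line_integral f c y"
  unfolding line_integral_def by (simp add: mult.assoc)

lemma integrable_three_quarters:
  fixes y :: complex
  assumes "y \<notin> \<real>\<^sub>\<le>\<^sub>0" "f holomorphic_on {w. Re w > 1/2}" "\<And>w. Re w = 3/4 \<Longrightarrow> norm (f w) \<le> K * (1 + \<bar>Im w\<bar>)\<^sup>2"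
  shows "integrable lborel (\<lambda>t. f (Complex (3/4) t) * mellin_kernel y (Complex (3/4) t))"
proof (rule integrable_mellin_kernel[OF assms(1), where K = K])
  show "cos (2 * pi * (3/4)) \<le> 0" using cos_three_quarters[of 0] by simp
  show "continuous_on UNIV (\<lambda>t. f (Complex (3/4) t))"
    by (rule continuous_on_compose2[OF holomorphic_on_imp_continuous_on[OF assms(2)]])
       (auto simp: Complex_line intro!: continuous_intros)
  show "norm (f (Complex (3/4) t)) \<le> K * (1 + \<bar>t\<bar>)\<^sup>2" for t using assms(3)[of "Complex (3/4) t"] by simp
qed

lemma norm_inverse_shift_le:
  assumes "Re w \<ge> 3/4" "a \<ge> -1/2"
  shows "norm (1 / (w + of_real a)) \<le> 4 * (1 + \<bar>Im w\<bar>)\<^sup>2"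
proof -
  have "norm (w + of_real a) \<ge> 1/4" using complex_Re_le_cmod[of "w + of_real a"] assms by simp
  hence "norm (1 / (w + of_real a)) \<le> 1 / (1/4)" unfolding norm_divide by (intro frac_le) auto
  also have "\<dots> \<le> 4 * (1 + \<bar>Im w\<bar>)\<^sup>2" by (simp add: one_le_power)
  finally show ?thesis .
qed

text \<open>Moving the line by one turns the integral of 1/(w - 1/2) into -y times that of 1/(w +
  1/2), and the kernel's pole at w = 1 contributes -2y/pi.\<close>

lemma line_integral_pole_minus_half:
  fixes y :: complex assumes y: "y \<notin> \<real>\<^sub>\<le>\<^sub>0"
  shows "y * line_integral (\<lambda>w. 1 / (w + 1/2)) (3/4) y = 2 * y / pi - 2 / pi * csqrt y * Arctan (csqrt y)"
proof -
  have "line_integral (\<lambda>w. 1 / (w - 1/2)) (3/4 + real 1) y = line_integral (\<lambda>w. 1 / (w - 1/2)) (3/4) y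
      + (\<Sum>k=1..1. (-1) ^ k * (1 / (of_nat k - 1/2)) * y ^ k / pi)"
  proof (rule line_integral_shift[OF y, where K = 4])
    show "(\<lambda>w. 1 / (w - 1/2)) holomorphic_on {w. Re w > 1/2}"
      by (intro holomorphic_intros) (auto simp: complex_eq_iff)
    show "norm (1 / (w - 1/2)) \<le> 4 * (1 + \<bar>Im w\<bar>)\<^sup>2" if "3/4 \<le> Re w" for w
      using norm_inverse_shift_le[of w "-1/2"] that by simp
  qed simp
  moreover have "line_integral (\<lambda>w. 1 / (w - 1/2)) (3/4 + 1) y = - y * line_integral (\<lambda>w. 1 / (w + 1 - 1/2)) (3/4) y"
    using y by (intro line_integral_translate) auto
  moreover have "(\<lambda>w. 1 / (w + 1 - 1/2)) = (\<lambda>w::complex. 1 / (w + 1/2))" by (simp add: algebra_simps)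
  ultimately show ?thesis unfolding line_integral_pole_half[OF y] by (simp add: field_simps)
qed

section \<open>The archimedean factor\<close>

text \<open>On the right half-plane Arctan s + Arctan(1/s) has derivative zero; its value at s = 1
  is pi/2.\<close>

lemma Arctan_inverse:
  fixes s :: complex assumes "Re s > 0"
  shows "Arctan (1 / s) = pi / 2 - Arctan s"
proof -
  define A where "A = {s. Re s > 0}"
  have "((\<lambda>s. Arctan s + Arctan (1 / s)) has_field_derivative 0) (at u within A)" if u: "u \<in> A" for u
  proof -
    have u0: "u \<noteq> 0" "Re u > 0" using u by (auto simp: A_def)
    have Re': "Re (1 / u) > 0" using u0 by (simp add: Re_divide divide_simps sum_power2_gt_zero_iff complex_eq_iff)
    have nz: "1 + u\<^sup>2 \<noteq> 0"
    proof
      assume "1 + u\<^sup>2 = 0"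
      hence "(u - \<i>) * (u + \<i>) = 0" by (simp add: power2_eq_square algebra_simps)
      hence "u = \<i> \<or> u = - \<i>" by (auto simp: eq_neg_iff_add_eq_0)
      thus False using u0(2) by auto
    qed
    have "((\<lambda>s. 1 / s) has_field_derivative - 1 / u\<^sup>2) (at u)"
      using u0 by (auto intro!: derivative_eq_intros simp: power2_eq_square)
    hence "((\<lambda>s. Arctan (1 / s)) has_field_derivative inverse (1 + (1 / u)\<^sup>2) * (- 1 / u\<^sup>2)) (at u)"
      by (rule DERIV_chain2[OF has_field_derivative_Arctan, rotated]) (use Re' in auto)
    hence "((\<lambda>s. Arctan s + Arctan (1 / s)) has_field_derivative inverse (1 + u\<^sup>2) + inverse (1 + (1 / u)\<^sup>2) * (- 1 / u\<^sup>2)) (at u)"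
      using u0 by (intro DERIV_add has_field_derivative_Arctan) auto
    also have "inverse (1 + u\<^sup>2) + inverse (1 + (1 / u)\<^sup>2) * (- 1 / u\<^sup>2) = 0"
    proof -
      have "1 + (1 / u)\<^sup>2 = (1 + u\<^sup>2) / u\<^sup>2" using u0 by (simp add: field_simps)
      thus ?thesis using u0 nz by (simp add: inverse_eq_divide)
    qed
    finally show ?thesis by (rule has_field_derivative_at_within)
  qed
  moreover have "convex A" unfolding A_def by (rule convex_halfspace_Re_gt)
  ultimately have "\<exists>c. \<forall>s\<in>A. Arctan s + Arctan (1 / s) = c" by (intro has_field_derivative_zero_constant)
  then obtain c where c: "\<And>s. s \<in> A \<Longrightarrow> Arctan s + Arctan (1 / s) = c" by blast
  have "Arctan 1 = complex_of_real (pi / 4)"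
    using Arctan_of_real[of 1] by (simp add: arctan_one)
  moreover have "c = Arctan 1 + Arctan 1" using c[of 1] by (simp add: A_def)
  ultimately have "c = pi / 2" by (simp add: mult.commute)
  thus ?thesis using c[of s] assms by (simp add: A_def algebra_simps)
qed

lemma Digamma_three_quarters: "Digamma (3/4 :: complex) = Digamma (1/4 :: complex) + pi"
proof -
  have "(1/4 :: complex) \<notin> \<int>"
  proof
    assume "(1/4 :: complex) \<in> \<int>"
    then obtain i where "(1/4 :: complex) = of_int i" by (auto elim: Ints_cases)
    hence "4 * complex_of_int i = 1" by (simp add: mult.commute)
    hence "complex_of_int (4 * i) = of_int 1" by simp
    hence "4 * i = 1" by (simp only: of_int_eq_iff)
    thus False by presburger
  qed
  from Digamma_reflection[OF this] have "Digamma (3/4 :: complex) - Digamma (1/4 :: complex) = of_real pi * cot (complex_of_real (pi / 4))" by simp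
  also have "cot (complex_of_real (pi / 4)) = of_real (cot (pi / 4))" by (rule cot_of_real[symmetric])
  also have "cot (pi / 4) = 1" by (simp add: cot_def sin_45 cos_45)
  finally show ?thesis by (simp add: algebra_simps)
qed

text \<open>Splitting the partial sums for digamma at 1/2 into even and odd indices gives the sum of
  the values at 1/4 and 3/4 (the duplication formula); reflection gives their difference.\<close>

lemma Digamma_quarter: "Digamma (1/4 :: complex) = - of_real (euler_mascheroni + 3 * ln 2 + pi / 2)"
proof -
  define S where "S = (\<lambda>z m. of_real (ln (real m)) - (\<Sum>n<m. inverse (z + of_nat n)) :: complex)"
  have S: "S z \<longlonglongrightarrow> Digamma z" if "z \<noteq> 0" for z unfolding S_def using Digamma_LIMSEQ[OF that] .
  have eq: "S (1/4) m + S (3/4) m = 2 * S (1/2) (2 * m) - 2 * of_real (ln 2)" if "m > 0" for m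
  proof -
    have "(\<Sum>k<2*m. inverse (1/2 + of_nat k :: complex)) = (\<Sum>n<m. inverse (1/2 + of_nat (2*n)) + inverse (1/2 + of_nat (2*n+1)))"
      by (induction m) (auto simp: algebra_simps)
    hence "2 * (\<Sum>k<2*m. inverse (1/2 + of_nat k :: complex)) = (\<Sum>n<m. 2 * inverse (1/2 + of_nat (2*n)) + 2 * inverse (1/2 + of_nat (2*n+1)))"
      by (simp only: sum_distrib_left ring_distribs)
    also have "\<dots> = (\<Sum>n<m. inverse (1/4 + of_nat n) + inverse (3/4 + of_nat n))"
    proof (intro sum.cong refl)
      fix n
      have "(1/2 + of_nat (2*n) :: complex) = 2 * (1/4 + of_nat n)" "(1/2 + of_nat (2*n+1) :: complex) = 2 * (3/4 + of_nat n)"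
        by simp_all
      thus "2 * inverse (1/2 + of_nat (2*n)) + 2 * inverse (1/2 + of_nat (2*n+1)) = inverse (1/4 + of_nat n :: complex) + inverse (3/4 + of_nat n)"
        by (simp only: inverse_mult_distrib) simp
    qed
    finally have "2 * (\<Sum>k<2*m. inverse (1/2 + of_nat k :: complex)) = (\<Sum>n<m. inverse (1/4 + of_nat n)) + (\<Sum>n<m. inverse (3/4 + of_nat n))"
      by (simp only: sum.distrib)
    moreover have "complex_of_real (ln (real (2 * m))) = of_real (ln 2) + of_real (ln (real m))"
      using that by (simp add: ln_mult)
    ultimately show ?thesis unfolding S_def by (simp add: algebra_simps)
  qed
  have "(\<lambda>m. S (1/4) m + S (3/4) m) \<longlonglongrightarrow> (Digamma (1/4 :: complex) + Digamma (3/4 :: complex))" by (intro tendsto_add S) auto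
  moreover have "(\<lambda>m. S (1/4) m + S (3/4) m) \<longlonglongrightarrow> 2 * Digamma (1/2) - 2 * of_real (ln 2)"
  proof (rule Lim_transform_eventually)
    have "(\<lambda>m. S (1/2) (2 * m)) \<longlonglongrightarrow> Digamma (1/2)"
      using LIMSEQ_subseq_LIMSEQ[OF S, of "1/2" "\<lambda>m. 2 * m"] by (simp add: o_def strict_mono_def)
    thus "(\<lambda>m. 2 * S (1/2) (2 * m) - 2 * of_real (ln 2)) \<longlonglongrightarrow> 2 * Digamma (1/2) - 2 * of_real (ln 2)"
      by (intro tendsto_intros)
    show "\<forall>\<^sub>F m in sequentially. 2 * S (1/2) (2 * m) - 2 * of_real (ln 2) = S (1/4) m + S (3/4) m"
      using eventually_gt_at_top[of 0] by eventually_elim (use eq in auto)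
  qed
  ultimately have "Digamma (1/4 :: complex) + Digamma (3/4 :: complex) = (2 * Digamma (1/2) - 2 * of_real (ln 2) :: complex)"
    by (rule LIMSEQ_unique)
  hence "2 * Digamma (1/4 :: complex) = 2 * (- euler_mascheroni - of_real (2 * ln 2)) - 2 * of_real (ln 2) - complex_of_real pi"
    unfolding Digamma_three_quarters Digamma_one_half by (simp add: algebra_simps)
  also have "\<dots> = 2 * (- of_real (euler_mascheroni + 3 * ln 2 + pi / 2))"
    by (simp add: algebra_simps)
  finally have e: "2 * Digamma (1/4 :: complex) = 2 * (- of_real (euler_mascheroni + 3 * ln 2 + pi / 2))" .
  show ?thesis by (rule iffD1[OF mult_left_cancel e]) simp
qed

lemma Digamma_line_holomorphic: "(\<lambda>w. Digamma (of_real a + w / 2) / 2) holomorphic_on {w. Re w > 1/2}" if "a \<ge> 0"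
proof -
  have "(\<lambda>w. Digamma (of_real a + w / 2) / 2) field_differentiable (at w)" if w: "Re w > 1/2" for w
  proof -
    have "of_real a + w / 2 \<notin> \<int>\<^sub>\<le>\<^sub>0" using w \<open>a \<ge> 0\<close> by (intro Re_pos_not_nonpos_Ints) auto
    hence "((\<lambda>w. Digamma (of_real a + w / 2) / 2) has_field_derivative Polygamma 1 (of_real a + w / 2) * (1 / 2) / 2) (at w)"
      by (auto intro!: derivative_eq_intros)
    thus ?thesis by (auto simp: field_differentiable_def)
  qed
  thus ?thesis by (auto simp: holomorphic_on_def intro: field_differentiable_at_within)
qed

text \<open>The range of Re w ends at 11/4 = 3/4 + 2 to allow a shift of the line by two; a is 1/4
  or 5/4, the offset before and after that shift.\<close>

lemma Digamma_line_bound: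
  assumes "1/4 \<le> a" "a \<le> 5/4" "3/4 \<le> Re w" "Re w \<le> 11/4"
  shows "norm (Digamma (of_real a + w / 2) / 2) \<le> 30 * (1 + \<bar>Im w\<bar>)\<^sup>2"
proof -
  have "norm (Digamma (of_real a + w / 2)) \<le> 15 * (1 + norm (of_real a + w / 2))"
    using assms by (intro Digamma_norm_le) auto
  also have "norm (of_real a + w / 2) \<le> a + norm w / 2"
    using norm_triangle_ineq[of "of_real a" "w / 2"] assms by (simp add: norm_divide)
  also have "norm w \<le> 11/4 + \<bar>Im w\<bar>" using cmod_le[of w] assms by simp
  finally have "norm (Digamma (of_real a + w / 2)) \<le> 15 * (1 + (a + (11/4 + \<bar>Im w\<bar>) / 2))" by simp
  hence "norm (Digamma (of_real a + w / 2)) \<le> 60 * (1 + \<bar>Im w\<bar>)" using assms(2) by argo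
  also have "\<dots> \<le> 60 * (1 + \<bar>Im w\<bar>)\<^sup>2"
    using mult_right_mono[of 1 "1 + \<bar>Im w\<bar>" "1 + \<bar>Im w\<bar>"]
    by (intro mult_left_mono) (auto simp: power2_eq_square)
  finally show ?thesis by (simp add: norm_divide)
qed

text \<open>The line moves by two because the digamma recurrence needs w/2 to grow by 1. The poles
  at w = 1 and w = 2 contribute digamma at 3/4 and at 5/4, both expressed through its value at 1/4,
  and the recurrence itself brings in the integral of 1/(w + 1/2).\<close>

lemma line_integral_Digamma:
  fixes y :: complex assumes y: "y \<notin> \<real>\<^sub>\<le>\<^sub>0"
  shows "(y\<^sup>2 - 1) * line_integral (\<lambda>w. Digamma (5/4 + w / 2) / 2) (3/4) y =
    - line_integral (\<lambda>w. 1 / (w + 1/2)) (3/4) y - y * (Digamma (1/4 :: complex) + pi) / (2 * pi) + y\<^sup>2 * (Digamma (1/4 :: complex) / 2 + 2) / pi"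
proof -
  define f where "f = (\<lambda>w::complex. Digamma (1/4 + w / 2) / 2)"
  define g where "g = (\<lambda>w::complex. Digamma (5/4 + w / 2) / 2)"
  define h where "h = (\<lambda>w::complex. 1 / (w + 1/2))"
  have y0: "y \<noteq> 0" using y by auto
  have f_eq: "f = (\<lambda>w. Digamma (of_real (1/4) + w / 2) / 2)" and g_eq: "g = (\<lambda>w. Digamma (of_real (5/4) + w / 2) / 2)"
    by (simp_all add: f_def g_def)
  have holf: "f holomorphic_on {w. Re w > 1/2}" unfolding f_eq by (rule Digamma_line_holomorphic) simp
  have holg: "g holomorphic_on {w. Re w > 1/2}" unfolding g_eq by (rule Digamma_line_holomorphic) simp
  have "line_integral f (3/4 + real 2) y = line_integral f (3/4) y + (\<Sum>k=1..2. (-1) ^ k * f (of_nat k) * y ^ k / pi)"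
  proof (rule line_integral_shift[OF y holf, where K = 30])
    show "norm (f w) \<le> 30 * (1 + \<bar>Im w\<bar>)\<^sup>2" if "3/4 \<le> Re w" "Re w \<le> 3/4 + real 2" for w
      unfolding f_eq by (rule Digamma_line_bound) (use that in auto)
  qed simp
  also have "(\<Sum>k=1..2. (-1) ^ k * f (of_nat k) * y ^ k / pi) = - f 1 * y / pi + f 2 * y\<^sup>2 / pi"
    by (simp add: numeral_2_eq_2)
  also have "line_integral f (3/4 + real 2) y = y\<^sup>2 * line_integral g (3/4) y"
  proof -
    have "line_integral f (3/4 + 1 + 1) y = - y * (- y * line_integral (\<lambda>w. f (w + 1 + 1)) (3/4) y)"
      unfolding line_integral_translate[OF y0] ..
    moreover have "(\<lambda>w. f (w + 1 + 1)) = g" by (auto simp: f_def g_def fun_eq_iff field_simps)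
    ultimately show ?thesis by (simp add: power2_eq_square)
  qed
  also have "line_integral f (3/4) y = line_integral g (3/4) y - line_integral h (3/4) y"
  proof -
    have fgh: "f w = g w + (-1) * h w" if "Re w > 0" for w
    proof -
      have nz: "1/4 + w / 2 \<noteq> 0" "w + 1/2 \<noteq> 0" using that by (auto simp: complex_eq_iff)
      have "Digamma (1/4 + w / 2 + 1) = Digamma (1/4 + w / 2) + 1 / (1/4 + w / 2)" by (rule Digamma_plus1[OF nz(1)])
      moreover have "1/4 + w / 2 + 1 = 5/4 + w / 2" by simp
      moreover have e: "1/4 + w / 2 = (w + 1/2) / 2" by (simp add: field_simps)
      have "1 / (1/4 + w / 2) = 2 * h w" unfolding e h_def by simp
      ultimately show ?thesis unfolding f_def g_def by (simp add: add_divide_distrib)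
    qed
    have "line_integral f (3/4) y = line_integral (\<lambda>w. g w + (-1) * h w) (3/4) y"
      unfolding line_integral_def by (simp add: fgh)
    also have "\<dots> = line_integral g (3/4) y + line_integral (\<lambda>w. (-1) * h w) (3/4) y"
    proof (rule line_integral_add)
      show "integrable lborel (\<lambda>t. g (Complex (3/4) t) * mellin_kernel y (Complex (3/4) t))"
      proof (rule integrable_three_quarters[OF y holg, where K = 30])
        show "norm (g w) \<le> 30 * (1 + \<bar>Im w\<bar>)\<^sup>2" if "Re w = 3/4" for w
          unfolding g_eq by (rule Digamma_line_bound) (use that in auto)
      qed
      have "integrable lborel (\<lambda>t. h (Complex (3/4) t) * mellin_kernel y (Complex (3/4) t))"
      proof (rule integrable_three_quarters[OF y, where K = 4])
        show "h holomorphic_on {w. Re w > 1/2}" unfolding h_def by (intro holomorphic_intros) (auto simp: complex_eq_iff)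
        show "norm (h w) \<le> 4 * (1 + \<bar>Im w\<bar>)\<^sup>2" if "Re w = 3/4" for w
          using norm_inverse_shift_le[of w "1/2"] that by (simp add: h_def)
      qed
      thus "integrable lborel (\<lambda>t. (-1) * h (Complex (3/4) t) * mellin_kernel y (Complex (3/4) t))" by simp
    qed
    also have "line_integral (\<lambda>w. (-1) * h w) (3/4) y = (-1) * line_integral h (3/4) y" by (rule line_integral_cmult)
    finally show ?thesis by simp
  qed
  finally have "y\<^sup>2 * line_integral g (3/4) y = line_integral g (3/4) y - line_integral h (3/4) y + (- f 1 * y / pi + f 2 * y\<^sup>2 / pi)" .
  moreover have "f 1 = (Digamma (1/4 :: complex) + pi) / 2"
    unfolding f_def using Digamma_three_quarters by simp
  moreover have "f 2 = Digamma (1/4 :: complex) / 2 + 2"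
    unfolding f_def using Digamma_plus1[of "1/4 :: complex"] by simp
  ultimately show ?thesis unfolding g_def[symmetric] h_def[symmetric]
    by (simp add: algebra_simps)
qed

text \<open>The part of \<open>\<xi>'/\<xi>(1/2 + w)\<close> that does not come from the Euler product.\<close>

definition archimedean_factor :: "complex \<Rightarrow> complex" where
  "archimedean_factor w = 1 / (w - 1/2) - of_real (ln pi) / 2 + Digamma (5/4 + w / 2) / 2"

lemma archimedean_factor_integrable:
  fixes y :: complex assumes y: "y \<notin> \<real>\<^sub>\<le>\<^sub>0"
  shows "integrable lborel (\<lambda>t. (1 / (Complex (3/4) t - 1/2)) * mellin_kernel y (Complex (3/4) t))"
    "integrable lborel (\<lambda>t. (Digamma (5/4 + Complex (3/4) t / 2) / 2) * mellin_kernel y (Complex (3/4) t))"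
    "integrable lborel (\<lambda>t. 1 * mellin_kernel y (Complex (3/4) t))"
proof -
  show "integrable lborel (\<lambda>t. (1 / (Complex (3/4) t - 1/2)) * mellin_kernel y (Complex (3/4) t))"
  proof (rule integrable_three_quarters[OF y, where K = 4])
    show "(\<lambda>w. 1 / (w - 1/2)) holomorphic_on {w. Re w > 1/2}" by (intro holomorphic_intros) (auto simp: complex_eq_iff)
    show "norm (1 / (w - 1/2)) \<le> 4 * (1 + \<bar>Im w\<bar>)\<^sup>2" if "Re w = 3/4" for w
      using norm_inverse_shift_le[of w "-1/2"] that by simp
  qed
  have "integrable lborel (\<lambda>t. (Digamma (of_real (5/4) + Complex (3/4) t / 2) / 2) * mellin_kernel y (Complex (3/4) t))"
  proof (rule integrable_three_quarters[OF y Digamma_line_holomorphic, where K = 30])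
    show "norm (Digamma (of_real (5/4) + w / 2) / 2) \<le> 30 * (1 + \<bar>Im w\<bar>)\<^sup>2" if "Re w = 3/4" for w
      by (rule Digamma_line_bound) (use that in auto)
  qed simp
  thus "integrable lborel (\<lambda>t. (Digamma (5/4 + Complex (3/4) t / 2) / 2) * mellin_kernel y (Complex (3/4) t))" by simp
  show "integrable lborel (\<lambda>t. 1 * mellin_kernel y (Complex (3/4) t))"
    by (rule integrable_three_quarters[OF y, where K = 1 and f = "\<lambda>_. 1"]) (auto intro!: one_le_power)
qed

lemma line_integral_archimedean:
  fixes y :: complex assumes y: "y \<notin> \<real>\<^sub>\<le>\<^sub>0"
  shows "line_integral archimedean_factor (3/4) y = line_integral (\<lambda>w. 1 / (w - 1/2)) (3/4) y
     - of_real (ln pi) / 2 * (y / (pi * (1 + y))) + line_integral (\<lambda>w. Digamma (5/4 + w / 2) / 2) (3/4) y"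
    and "integrable lborel (\<lambda>t. archimedean_factor (Complex (3/4) t) * mellin_kernel y (Complex (3/4) t))"
proof -
  note I = archimedean_factor_integrable[OF y]
  have I3: "integrable lborel (\<lambda>t. (- of_real (ln pi) / 2) * 1 * mellin_kernel y (Complex (3/4) t))"
    using I(3) by simp
  have af: "archimedean_factor = (\<lambda>w. (1 / (w - 1/2) + (- of_real (ln pi) / 2) * 1) + Digamma (5/4 + w / 2) / 2)"
    by (simp add: archimedean_factor_def fun_eq_iff)
  have I12: "integrable lborel (\<lambda>t. (1 / (Complex (3/4) t - 1/2) + (- of_real (ln pi) / 2) * 1) * mellin_kernel y (Complex (3/4) t))"
    using Bochner_Integration.integrable_add[OF I(1) I3] by (simp add: ring_distribs)
  show "integrable lborel (\<lambda>t. archimedean_factor (Complex (3/4) t) * mellin_kernel y (Complex (3/4) t))"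
    unfolding af using Bochner_Integration.integrable_add[OF I12 I(2)] by (simp add: ring_distribs)
  have "line_integral archimedean_factor (3/4) y = line_integral (\<lambda>w. 1 / (w - 1/2) + (- of_real (ln pi) / 2) * 1) (3/4) y + line_integral (\<lambda>w. Digamma (5/4 + w / 2) / 2) (3/4) y"
    unfolding af by (rule line_integral_add[OF I12 I(2)])
  also have "line_integral (\<lambda>w. 1 / (w - 1/2) + (- of_real (ln pi) / 2) * 1) (3/4) y = line_integral (\<lambda>w. 1 / (w - 1/2)) (3/4) y + line_integral (\<lambda>w. (- of_real (ln pi) / 2) * 1) (3/4) y"
    by (rule line_integral_add[OF I(1) I3])
  also have "line_integral (\<lambda>w. (- of_real (ln pi) / 2) * 1) (3/4) y = (- of_real (ln pi) / 2) * line_integral (\<lambda>_. 1) (3/4) y"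
    by (rule line_integral_cmult)
  also have "line_integral (\<lambda>_. 1) (3/4) y = y / (pi * (1 + y))" by (rule line_integral_one[OF y])
  finally show "line_integral archimedean_factor (3/4) y = line_integral (\<lambda>w. 1 / (w - 1/2)) (3/4) y
     - of_real (ln pi) / 2 * (y / (pi * (1 + y))) + line_integral (\<lambda>w. Digamma (5/4 + w / 2) / 2) (3/4) y" by simp
qed

section \<open>Logarithmic derivatives of the completed and of the original zeta function\<close>

lemma xi_fun_log_derivative:
  assumes s: "Re s > -1" "zeta_aux s \<noteq> 0"
  shows "xi_fun s \<noteq> 0" "deriv xi_fun s / xi_fun s = deriv zeta_aux s / zeta_aux s - of_real (ln pi) / 2 + Digamma (s / 2 + 1) / 2"
proof -
  have G: "s / 2 + 1 \<notin> \<int>\<^sub>\<le>\<^sub>0" using s by (intro Re_pos_not_nonpos_Ints) simp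
  have nz: "complex_of_real pi powr (- s / 2) \<noteq> 0" "Gamma (s / 2 + 1) \<noteq> 0" using G by (auto simp: Gamma_eq_zero_iff)
  show "xi_fun s \<noteq> 0" using s nz by (simp add: xi_fun_def)
  have z: "(zeta_aux has_field_derivative deriv zeta_aux s) (at s)"
    by (rule holomorphic_derivI[OF zeta_aux_holomorphic open_halfspace_Re_gt]) (use s in simp)
  have "((\<lambda>s. exp (- s / 2 * Ln (of_real pi))) has_field_derivative exp (- s / 2 * Ln (of_real pi)) * (- (Ln (of_real pi)) / 2)) (at s)"
    by (auto intro!: derivative_eq_intros)
  hence p: "((\<lambda>s. of_real pi powr (- s / 2)) has_field_derivative of_real pi powr (- s / 2) * (- of_real (ln pi) / 2)) (at s)"
    by (simp add: powr_def Ln_of_real)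
  have g: "((\<lambda>s. Gamma (s / 2 + 1)) has_field_derivative Gamma (s / 2 + 1) * Digamma (s / 2 + 1) * (1 / 2)) (at s)"
    using G by (auto intro!: derivative_eq_intros)
  have "(xi_fun has_field_derivative
     (deriv zeta_aux s * of_real pi powr (- s / 2) + of_real pi powr (- s / 2) * (- of_real (ln pi) / 2) * zeta_aux s) * Gamma (s / 2 + 1)
      + Gamma (s / 2 + 1) * Digamma (s / 2 + 1) * (1 / 2) * (zeta_aux s * of_real pi powr (- s / 2))) (at s)"
    unfolding xi_fun_def [abs_def] by (intro DERIV_mult z p g)
  hence d: "deriv xi_fun s = (deriv zeta_aux s * of_real pi powr (- s / 2) + of_real pi powr (- s / 2) * (- of_real (ln pi) / 2) * zeta_aux s) * Gamma (s / 2 + 1)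
      + Gamma (s / 2 + 1) * Digamma (s / 2 + 1) * (1 / 2) * (zeta_aux s * of_real pi powr (- s / 2))" by (rule DERIV_imp_deriv)
  have al: "((d * p + p * l * z) * g + g * D * (1 / 2) * (z * p)) / (z * p * g) = d / z + l + D / 2"
    if "z \<noteq> 0" "p \<noteq> 0" "g \<noteq> 0" for d p l z g D :: complex
    using that by (simp add: field_simps)
  show "deriv xi_fun s / xi_fun s = deriv zeta_aux s / zeta_aux s - of_real (ln pi) / 2 + Digamma (s / 2 + 1) / 2"
    unfolding d xi_fun_def al[OF s(2) nz] by simp
qed

lemma zeta_aux_log_derivative:
  assumes s: "Re s > -1" "s \<noteq> 1" "riemann_zeta s \<noteq> 0"
  shows "zeta_aux s \<noteq> 0" "deriv zeta_aux s / zeta_aux s = 1 / (s - 1) + deriv riemann_zeta s / riemann_zeta s"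
proof -
  define A where "A = {s. Re s > -1} - {1::complex}"
  have A: "open A" "s \<in> A" using s by (auto simp: A_def open_Diff open_halfspace_Re_gt)
  have eq: "(u - 1) * riemann_zeta u = zeta_aux u" if "u \<in> A" for u
    using riemann_zeta_eq[of u] that by (auto simp: A_def)
  show "zeta_aux s \<noteq> 0" using eq[OF A(2)] s by auto
  have z: "(riemann_zeta has_field_derivative deriv riemann_zeta s) (at s)"
    by (rule holomorphic_derivI[OF riemann_zeta_holomorphic]) (use s in auto)
  have "((\<lambda>u. (u - 1) * riemann_zeta u) has_field_derivative (1 - 0) * riemann_zeta s + deriv riemann_zeta s * (s - 1)) (at s)"
    by (intro DERIV_mult DERIV_diff DERIV_ident DERIV_const z)
  hence "(zeta_aux has_field_derivative (1 - 0) * riemann_zeta s + deriv riemann_zeta s * (s - 1)) (at s)"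
    by (rule has_field_derivative_transform_within_open[OF _ A]) (rule eq)
  hence d: "deriv zeta_aux s = riemann_zeta s + deriv riemann_zeta s * (s - 1)" by (simp add: DERIV_imp_deriv)
  show "deriv zeta_aux s / zeta_aux s = 1 / (s - 1) + deriv riemann_zeta s / riemann_zeta s"
    unfolding d eq[OF A(2), symmetric] using s by (simp add: field_simps)
qed

lemma zeta_log_derivative_half:
  "deriv riemann_zeta (1/2) / riemann_zeta (1/2) = of_real (ln pi) / 2 - Digamma (1/4 :: complex) / 2"
proof -
  have z0: "zeta_aux (1/2) \<noteq> 0" using zeta_aux_nonzero_real[of "1/2"] by simp
  hence rz: "riemann_zeta (1/2) \<noteq> 0" using riemann_zeta_eq[of "1/2"] by (auto simp: complex_eq_iff)
  have d: "(xi_fun has_field_derivative deriv xi_fun (1/2)) (at (1/2))"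
    by (rule holomorphic_derivI[OF xi_fun_holomorphic open_halfspace_Re_gt]) simp
  have "((\<lambda>s. xi_fun (1 - s)) has_field_derivative deriv xi_fun (1/2) * (-1)) (at (1/2))"
    by (rule DERIV_chain2[where f = xi_fun]) (use d in \<open>auto intro!: derivative_eq_intros\<close>)
  moreover have "open ({s. Re s > -1} \<inter> {s. Re s < 2})" by (intro open_Int open_halfspace_Re_gt open_halfspace_Re_lt)
  ultimately have "(xi_fun has_field_derivative deriv xi_fun (1/2) * (-1)) (at (1/2))"
    by (rule has_field_derivative_transform_within_open) (auto simp: xi_fun_reflection[symmetric])
  from DERIV_unique[OF d this] have "deriv xi_fun (1/2) = 0" by simp
  hence "0 = deriv zeta_aux (1/2) / zeta_aux (1/2) - of_real (ln pi) / 2 + Digamma (1/2 / 2 + 1) / 2"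
    using xi_fun_log_derivative(2)[of "1/2"] z0 by simp
  also have "deriv zeta_aux (1/2) / zeta_aux (1/2) = 1 / (1/2 - 1) + deriv riemann_zeta (1/2) / riemann_zeta (1/2)"
    using rz by (intro zeta_aux_log_derivative) (auto simp: complex_eq_iff)
  \<comment> \<open>Half of the 4 gained here cancels 1/(1/2 - 1) = -2.\<close>
  also have "Digamma (1/2 / 2 + 1 :: complex) = Digamma (1/4 :: complex) + 4" using Digamma_plus1[of "1/4 :: complex"] by simp
  finally show ?thesis by (simp add: field_simps)
qed

lemma xi_log_derivative_line:
  assumes "Re w = 3/4"
  shows "deriv xi_fun (1/2 + w) / xi_fun (1/2 + w) = archimedean_factor w - mangoldt_series (1/2 + w)"
proof -
  define s where "s = 1/2 + w"
  have s: "Re s > 1" using assms by (simp add: s_def)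
  have rz: "riemann_zeta s \<noteq> 0" by (rule riemann_zeta_nonzero[OF s])
  have s1: "s \<noteq> 1" using s by auto
  have za: "zeta_aux s \<noteq> 0" "deriv zeta_aux s / zeta_aux s = 1 / (s - 1) + deriv riemann_zeta s / riemann_zeta s"
    using zeta_aux_log_derivative[of s] s s1 rz by auto
  have "deriv riemann_zeta s = - (riemann_zeta s * mangoldt_series s)"
    by (rule DERIV_imp_deriv[OF riemann_zeta_has_field_derivative[OF s]])
  hence m: "deriv riemann_zeta s / riemann_zeta s = - mangoldt_series s" using rz by simp
  have "deriv xi_fun s / xi_fun s = 1 / (s - 1) - mangoldt_series s - of_real (ln pi) / 2 + Digamma (s / 2 + 1) / 2"
    using xi_fun_log_derivative(2)[of s] s za m by simp
  also have "s - 1 = w - 1/2" by (simp add: s_def)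
  also have "s / 2 + 1 = 5/4 + w / 2" by (simp add: s_def field_simps)
  finally show ?thesis by (simp add: archimedean_factor_def s_def)
qed

section \<open>Zeros of the zeta function\<close>

text \<open>\<open>zeta_zeros_upper\<close> puts no bound on Re \<rho>, so zeros must be ruled out
  in all of Re s < 0, beyond the reach of \<open>zeta_aux\<close>. The reflected formula extends
  there from -1 < Re s < 0 by the identity theorem.\<close>

lemma riemann_zeta_left:
  assumes "Re s < 0"
  shows "riemann_zeta s = xi_fun (1 - s) * rGamma (s / 2 + 1) * of_real pi powr (s / 2) / (s - 1)"
proof -
  define f where "f = (\<lambda>s. xi_fun (1 - s) * rGamma (s / 2 + 1) * of_real pi powr (s / 2) / (s - 1))"
  define S where "S = {s. Re s < 0}"
  have S: "open S" "connected S" unfolding S_def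
    by (simp_all add: open_halfspace_Re_lt convex_connected convex_halfspace_Re_lt)
  have "xi_fun \<circ> (\<lambda>s. 1 - s) holomorphic_on S"
    by (intro holomorphic_on_compose holomorphic_intros holomorphic_on_subset[OF xi_fun_holomorphic]) (auto simp: S_def)
  hence "f holomorphic_on S" unfolding f_def o_def by (intro holomorphic_intros) (auto simp: S_def)
  hence hol: "(\<lambda>s. riemann_zeta s - f s) holomorphic_on S"
    by (intro holomorphic_intros holomorphic_on_subset[OF riemann_zeta_holomorphic]) (auto simp: S_def)
  define U where "U = {s. Re s > -1} \<inter> S"
  have "riemann_zeta s - f s = 0"
  proof (rule analytic_continuation[OF hol S, of U "-1/2"])
    have "open U" unfolding U_def using S by (intro open_Int open_halfspace_Re_gt)
    hence "interior U = U" by (rule interior_open)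
    moreover have "-1/2 \<in> U" by (simp add: U_def S_def)
    ultimately show "(-1/2) islimpt U" by (intro interior_limit_point) simp
    fix u assume u: "u \<in> U"
    have "xi_fun u = xi_fun (1 - u)" using u by (intro xi_fun_reflection) (auto simp: U_def S_def)
    moreover have "Gamma (u / 2 + 1) * rGamma (u / 2 + 1) = 1"
      using u Re_pos_not_nonpos_Ints[of "u / 2 + 1"] by (simp add: U_def S_def rGamma_inverse_Gamma Gamma_eq_zero_iff)
    moreover have "complex_of_real pi powr (- u / 2) * of_real pi powr (u / 2) = 1" by (simp flip: powr_add)
    moreover have "xi_fun u * rGamma (u / 2 + 1) * of_real pi powr (u / 2) =
        zeta_aux u * (Gamma (u / 2 + 1) * rGamma (u / 2 + 1)) * (of_real pi powr (- u / 2) * of_real pi powr (u / 2))"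
      by (simp only: xi_fun_def mult_ac)
    ultimately have "xi_fun (1 - u) * rGamma (u / 2 + 1) * of_real pi powr (u / 2) = zeta_aux u"
      by (simp only: mult_1_right)
    moreover have "riemann_zeta u = zeta_aux u / (u - 1)"
      using u by (intro riemann_zeta_eq) (auto simp: U_def S_def)
    ultimately show "riemann_zeta u - f u = 0" by (simp add: f_def)
  qed (use assms in \<open>auto simp: U_def S_def\<close>)
  thus ?thesis by (simp add: f_def)
qed

lemma zeta_aux_nonzero_right: "Re s > 1 \<Longrightarrow> zeta_aux s \<noteq> 0"
  using zeta_aux_log_derivative(1)[of s] riemann_zeta_nonzero[of s] by force

lemma xi_fun_eq_0_iff: "Re s > -1 \<Longrightarrow> xi_fun s = 0 \<longleftrightarrow> zeta_aux s = 0"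
  using xi_fun_log_derivative(1)[of s] by (auto simp: xi_fun_def)

text \<open>Reflection carries non-vanishing for Re s > 1 over to Re s < 0; real zeros are excluded
  by \<open>zeta_aux_nonzero_real\<close>.\<close>

lemma xi_fun_zero_strip:
  assumes "-1 < Re s" "Re s < 2" "xi_fun s = 0"
  shows "0 \<le> Re s" "Re s \<le> 1" "Im s \<noteq> 0"
proof -
  have s: "zeta_aux s = 0" using assms xi_fun_eq_0_iff by blast
  have "xi_fun (1 - s) = 0" using xi_fun_reflection[of s] assms by simp
  hence s': "zeta_aux (1 - s) = 0" using assms by (subst (asm) xi_fun_eq_0_iff) auto
  show 1: "Re s \<le> 1" using zeta_aux_nonzero_right[of s] s by force
  show 0: "0 \<le> Re s" using zeta_aux_nonzero_right[of "1 - s"] s' by force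
  show "Im s \<noteq> 0"
  proof
    assume "Im s = 0"
    hence "s = of_real (Re s)" by (simp add: complex_eq_iff)
    thus False using zeta_aux_nonzero_real[OF 0 1] s by simp
  qed
qed

text \<open>For Re \<rho> < 0 the reflected formula vanishes only through \<open>rGamma\<close>,
  hence only at real points. Above the real axis the zeros of zeta are therefore those of the
  completed function in the strip.\<close>

lemma zeta_zeros_upper_iff:
  "\<rho> \<in> zeta_zeros_upper \<longleftrightarrow> Im \<rho> > 0 \<and> -1 < Re \<rho> \<and> Re \<rho> < 2 \<and> xi_fun \<rho> = 0"
proof (cases "Re \<rho> < 0")
  case True
  have "riemann_zeta \<rho> \<noteq> 0" if "Im \<rho> > 0"
  proof -
    have "\<rho> / 2 + 1 \<notin> \<int>\<^sub>\<le>\<^sub>0" using that by (auto elim!: nonpos_Ints_cases simp: complex_eq_iff)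
    moreover have "xi_fun (1 - \<rho>) \<noteq> 0" using True zeta_aux_nonzero_right[of "1 - \<rho>"] by (subst xi_fun_eq_0_iff) auto
    ultimately show ?thesis using riemann_zeta_left[OF True] that by (auto simp: rGamma_eq_zero_iff)
  qed
  moreover have "\<not> (-1 < Re \<rho> \<and> Re \<rho> < 2 \<and> xi_fun \<rho> = 0)" using xi_fun_zero_strip(1)[of \<rho>] True by auto
  ultimately show ?thesis by (auto simp: zeta_zeros_upper_def)
next
  case False
  show ?thesis
  proof (cases "\<rho> = 1")
    case False
    hence "riemann_zeta \<rho> = zeta_aux \<rho> / (\<rho> - 1)" using \<open>\<not> Re \<rho> < 0\<close> by (intro riemann_zeta_eq) auto
    hence "riemann_zeta \<rho> = 0 \<longleftrightarrow> xi_fun \<rho> = 0" using False \<open>\<not> Re \<rho> < 0\<close> by (simp add: xi_fun_eq_0_iff)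
    moreover have "Re \<rho> < 2" if "riemann_zeta \<rho> = 0"
      using riemann_zeta_nonzero[of \<rho>] that by force
    ultimately show ?thesis using False \<open>\<not> Re \<rho> < 0\<close> by (auto simp: zeta_zeros_upper_def)
  qed (auto simp: zeta_zeros_upper_def)
qed

section \<open>Multiplicities, and zeros counted with exponential weights\<close>

lemma zorder_mult_nonzero:
  assumes "f analytic_on {z}" "g analytic_on {z}" "g z \<noteq> 0" "\<forall>\<^sub>F w in at z. f w \<noteq> 0"
  shows "zorder (\<lambda>w. f w * g w) z = zorder f z"
proof -
  have "isCont g z" using assms(2) by (rule analytic_at_imp_isCont)
  hence "(g \<longlongrightarrow> g z) (at z)" by (simp add: isCont_def)
  hence "\<forall>\<^sub>F w in at z. g w \<noteq> 0" using assms(3) by (rule tendsto_imp_eventually_ne)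
  hence "\<forall>\<^sub>F w in at z. f w * g w \<noteq> 0" using assms(4) by eventually_elim simp
  hence "zorder (\<lambda>w. f w * g w) z = zorder f z + zorder g z"
    using assms by (intro zorder_times_analytic)
  thus ?thesis using zorder_eq_0I[OF assms(2,3)] by simp
qed

lemma zeta_aux_analytic: "Re s > -1 \<Longrightarrow> zeta_aux analytic_on {s}"
  using analytic_at[of zeta_aux s] zeta_aux_holomorphic open_halfspace_Re_gt by blast

lemma zeta_aux_eventually_nonzero:
  assumes "Re s > -1"
  shows "\<forall>\<^sub>F w in at s. zeta_aux w \<noteq> 0"
proof -
  have "\<forall>\<^sub>F w in at s. zeta_aux w \<noteq> 0 \<and> w \<in> {s. Re s > -1}"
    by (rule non_zero_neighbour_alt[OF zeta_aux_holomorphic, of _ 1])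
       (use assms in \<open>auto simp: open_halfspace_Re_gt convex_connected convex_halfspace_Re_gt\<close>)
  thus ?thesis by (auto elim: eventually_mono)
qed

text \<open>The sum in the theorem is weighted by the order of zeta, the argument principle by that
  of the completed function. The power of pi and the Gamma factor are analytic and nonzero here, so
  the orders agree.\<close>

lemma zorder_xi_fun: "zorder xi_fun s = zorder zeta_aux s" if s: "Re s > -1"
proof -
  define g where "g = (\<lambda>s. complex_of_real pi powr (- s / 2) * Gamma (s / 2 + 1))"
  have G: "s / 2 + 1 \<notin> \<int>\<^sub>\<le>\<^sub>0" using s by (intro Re_pos_not_nonpos_Ints) simp
  have "g analytic_on {s}" unfolding g_def using G pi_gt_zero by (intro analytic_intros) (auto simp: not_le)
  moreover have "g s \<noteq> 0" using G by (simp add: g_def Gamma_eq_zero_iff)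
  ultimately have "zorder (\<lambda>s. zeta_aux s * g s) s = zorder zeta_aux s"
    using s by (intro zorder_mult_nonzero zeta_aux_analytic zeta_aux_eventually_nonzero) auto
  thus ?thesis by (simp add: xi_fun_def [abs_def] g_def mult.assoc)
qed

lemma zorder_riemann_zeta: "zorder riemann_zeta s = zorder zeta_aux s" if s: "Re s > -1" "s \<noteq> 1"
proof -
  have "(\<lambda>s. inverse (s - 1)) analytic_on {s}" using s by (intro analytic_intros) auto
  hence "zorder (\<lambda>s. zeta_aux s * inverse (s - 1)) s = zorder zeta_aux s"
    using s by (intro zorder_mult_nonzero zeta_aux_analytic zeta_aux_eventually_nonzero) auto
  moreover have "zorder (\<lambda>s. zeta_aux s * inverse (s - 1)) s = zorder riemann_zeta s"
  proof (rule zorder_cong[OF _ refl])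
    have "open ({s. Re s > -1} - {1})" by (intro open_Diff open_halfspace_Re_gt) auto
    hence "\<forall>\<^sub>F u in nhds s. u \<in> {s. Re s > -1} - {1}" using s by (intro eventually_nhds_in_open) auto
    hence "\<forall>\<^sub>F u in at s. u \<in> {s. Re s > -1} - {1}" by (rule eventually_nhds_conv_at[THEN iffD1, THEN conjunct1])
    thus "\<forall>\<^sub>F u in at s. zeta_aux u * inverse (u - 1) = riemann_zeta u"
      by eventually_elim (auto simp: riemann_zeta_eq divide_inverse)
  qed
  ultimately show ?thesis by simp
qed

text \<open>Zeros are grouped by the integer part n of their height. A group lies in
  \<open>zeta_zero_disc (real n + 1/2)\<close>, since 2^2 + (1/2)^2 < (47/20)^2, so its total
  multiplicity is O(n + 1), and the weighted groups are dominated by a geometric series.\<close>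

lemma zeta_zeros_weighted_bound:
  assumes \<delta>: "\<delta> > (0::real)"
  obtains B where "\<And>F. finite F \<Longrightarrow> F \<subseteq> zeta_zeros_upper \<Longrightarrow>
     (\<Sum>\<rho>\<in>F. real_of_int \<bar>zorder riemann_zeta \<rho>\<bar> * exp (- \<delta> * Im \<rho>)) \<le> B"
proof -
  obtain K where K: "K \<ge> 1" "\<And>t. finite (zeta_zero_disc t)"
    "\<And>t. (\<Sum>p\<in>zeta_zero_disc t. real_of_int (zorder zeta_aux p)) \<le> K * (1 + \<bar>t\<bar>)"
    "\<And>t p. p \<in> zeta_zero_disc t \<Longrightarrow> zorder zeta_aux p > 0"
    "\<And>t s \<delta>. norm (s - Complex 2 t) \<le> 231/100 \<Longrightarrow> \<delta> > 0 \<Longrightarrow> (\<And>p. p \<in> zeta_zero_disc t \<Longrightarrow> norm (s - p) \<ge> \<delta>) \<Longrightarrow>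
       norm (deriv zeta_aux s / zeta_aux s) \<le> K * (1 + \<bar>t\<bar>) * (1 + 1 / \<delta>)"
    using zeta_aux_local_bounds by blast
  define C where "C = 2 * K * (exp (\<delta> / 2) * (4 / \<delta>)\<^sup>2)"
  define a where "a = (\<lambda>n. C * exp (- (\<delta> / 2)) ^ n)"
  have C: "C \<ge> 0" using K(1) by (simp add: C_def)
  have a0: "a n \<ge> 0" for n using C by (simp add: a_def)
  have sa: "summable a" unfolding a_def using \<delta> by (intro summable_mult summable_geometric) auto
  show ?thesis
  proof (rule that[of "suminf a"])
    fix F assume F: "finite F" "F \<subseteq> zeta_zeros_upper"
    define h where "h = (\<lambda>\<rho>. real_of_int \<bar>zorder riemann_zeta \<rho>\<bar> * exp (- \<delta> * Im \<rho>))"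
    define fl where "fl = (\<lambda>\<rho>. nat \<lfloor>Im \<rho>\<rfloor>)"
    have "sum h F = (\<Sum>n\<in>fl ` F. sum h {\<rho>\<in>F. fl \<rho> = n})" by (rule sum.image_gen[OF F(1)])
    also have "\<dots> \<le> (\<Sum>n\<in>fl ` F. a n)"
    proof (rule sum_mono)
      fix n
      define D where "D = zeta_zero_disc (real n + 1/2)"
      have all: "\<rho> \<in> D \<and> real n \<le> Im \<rho> \<and> zorder riemann_zeta \<rho> = zorder zeta_aux \<rho>"
        if r: "\<rho> \<in> {\<rho>\<in>F. fl \<rho> = n}" for \<rho>
      proof -
        from r F have "\<rho> \<in> zeta_zeros_upper" by auto
        hence z: "Im \<rho> > 0" "-1 < Re \<rho>" "Re \<rho> < 2" "xi_fun \<rho> = 0" by (auto simp: zeta_zeros_upper_iff)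
        have "fl \<rho> = n" using r by simp
        hence n: "real n \<le> Im \<rho>" "Im \<rho> < real n + 1" using z(1) unfolding fl_def by linarith+
        have zo: "zorder riemann_zeta \<rho> = zorder zeta_aux \<rho>" using z by (intro zorder_riemann_zeta) auto
        have "\<bar>Im \<rho> - (real n + 1/2)\<bar> \<le> 1/2" using n by (auto simp: abs_le_iff field_simps)
        hence "(Im \<rho> - (real n + 1/2))\<^sup>2 \<le> (1/2)\<^sup>2" using abs_le_square_iff[of "Im \<rho> - (real n + 1/2)" "1/2"] by simp
        moreover have "(Re \<rho> - 2)\<^sup>2 \<le> 2\<^sup>2"
          using xi_fun_zero_strip[OF z(2,3,4)] by (intro abs_le_square_iff[THEN iffD1]) auto
        ultimately have "(norm (\<rho> - Complex 2 (real n + 1/2)))\<^sup>2 \<le> (47/20)\<^sup>2"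
          unfolding cmod_power2 by (simp add: power2_eq_square)
        hence "norm (\<rho> - Complex 2 (real n + 1/2)) \<le> 47/20" by (rule power2_le_imp_le) simp
        hence "\<rho> \<in> D" using z by (simp add: D_def zeta_zero_disc_def dist_norm norm_minus_commute xi_fun_eq_0_iff)
        thus ?thesis using n(1) zo by blast
      qed
      have sub: "{\<rho>\<in>F. fl \<rho> = n} \<subseteq> D" and im: "\<And>\<rho>. \<rho> \<in> {\<rho>\<in>F. fl \<rho> = n} \<Longrightarrow> real n \<le> Im \<rho>"
        and zo: "\<And>\<rho>. \<rho> \<in> {\<rho>\<in>F. fl \<rho> = n} \<Longrightarrow> zorder riemann_zeta \<rho> = zorder zeta_aux \<rho>"
        using all by blast+
      have "sum h {\<rho>\<in>F. fl \<rho> = n} \<le> (\<Sum>\<rho>\<in>{\<rho>\<in>F. fl \<rho> = n}. real_of_int (zorder zeta_aux \<rho>) * exp (- \<delta> * real n))"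
      proof (rule sum_mono)
        fix \<rho> assume r: "\<rho> \<in> {\<rho>\<in>F. fl \<rho> = n}"
        have "zorder zeta_aux \<rho> > 0" using K(4) sub r by (auto simp: D_def)
        thus "h \<rho> \<le> real_of_int (zorder zeta_aux \<rho>) * exp (- \<delta> * real n)"
          unfolding h_def zo[OF r] using im[OF r] \<delta> by (auto intro!: mult_left_mono)
      qed
      also have "\<dots> \<le> (\<Sum>\<rho>\<in>D. real_of_int (zorder zeta_aux \<rho>) * exp (- \<delta> * real n))"
        by (rule sum_mono2) (use K(2,4) sub in \<open>auto simp: D_def intro!: mult_nonneg_nonneg less_imp_le\<close>)
      also have "\<dots> = (\<Sum>\<rho>\<in>D. real_of_int (zorder zeta_aux \<rho>)) * exp (- \<delta> * real n)" by (simp add: sum_distrib_right)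
      also have "\<dots> \<le> (K * (1 + \<bar>real n + 1/2\<bar>)) * exp (- \<delta> * real n)"
        unfolding D_def by (intro mult_right_mono K(3)) auto
      also have "\<dots> \<le> (2 * K * (1 + real n)\<^sup>2) * exp (- \<delta> * real n)"
      proof (intro mult_right_mono)
        have "(1 + \<bar>real n + 1/2\<bar>) \<le> 2 * (1 + real n)" by simp
        also have "\<dots> \<le> 2 * (1 + real n)\<^sup>2" by (simp add: power2_eq_square algebra_simps)
        finally have "K * (1 + \<bar>real n + 1/2\<bar>) \<le> K * (2 * (1 + real n)\<^sup>2)" using K(1) by (intro mult_left_mono) auto
        thus "K * (1 + \<bar>real n + 1/2\<bar>) \<le> 2 * K * (1 + real n)\<^sup>2" by simp
      qed auto
      also have "\<dots> = 2 * K * ((1 + real n)\<^sup>2 * exp (- \<delta> * real n))" by simp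
      also have "\<dots> \<le> 2 * K * (exp (\<delta> / 2) * (4 / \<delta>)\<^sup>2 * exp (- (\<delta> / 2) * real n))"
        using K(1) \<delta> by (intro mult_left_mono poly_exp_le) auto
      also have "\<dots> = a n" by (simp add: a_def C_def exp_of_nat_mult[symmetric] mult.commute)
      finally show "sum h {\<rho>\<in>F. fl \<rho> = n} \<le> a n" .
    qed
    also have "\<dots> \<le> suminf a" using F(1) a0 by (intro sum_le_suminf[OF sa]) auto
    finally show "(\<Sum>\<rho>\<in>F. real_of_int \<bar>zorder riemann_zeta \<rho>\<bar> * exp (- \<delta> * Im \<rho>)) \<le> suminf a" by (simp add: h_def)
  qed
qed

lemma zeta_zeros_summable:
  fixes f :: "complex \<Rightarrow> complex"
  assumes "\<delta> > 0" "\<And>\<rho>. \<rho> \<in> zeta_zeros_upper \<Longrightarrow> norm (f \<rho>) \<le> C * exp (- \<delta> * Im \<rho>)"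
  shows "(\<lambda>\<rho>. of_int (zorder riemann_zeta \<rho>) * f \<rho>) summable_on zeta_zeros_upper"
proof -
  obtain B where B: "\<And>F. finite F \<Longrightarrow> F \<subseteq> zeta_zeros_upper \<Longrightarrow>
     (\<Sum>\<rho>\<in>F. real_of_int \<bar>zorder riemann_zeta \<rho>\<bar> * exp (- \<delta> * Im \<rho>)) \<le> B"
    using zeta_zeros_weighted_bound[OF assms(1)] by blast
  have "(\<lambda>\<rho>. norm (of_int (zorder riemann_zeta \<rho>) * f \<rho>)) summable_on zeta_zeros_upper"
  proof (rule nonneg_bdd_above_summable_on)
    show "bdd_above (sum (\<lambda>\<rho>. norm (of_int (zorder riemann_zeta \<rho>) * f \<rho>)) ` {F. F \<subseteq> zeta_zeros_upper \<and> finite F})"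
    proof (rule bdd_aboveI2)
      fix F assume F: "F \<in> {F. F \<subseteq> zeta_zeros_upper \<and> finite F}"
      have "(\<Sum>\<rho>\<in>F. norm (of_int (zorder riemann_zeta \<rho>) * f \<rho>)) \<le> (\<Sum>\<rho>\<in>F. \<bar>C\<bar> * (real_of_int \<bar>zorder riemann_zeta \<rho>\<bar> * exp (- \<delta> * Im \<rho>)))"
      proof (rule sum_mono)
        fix \<rho> assume "\<rho> \<in> F"
        hence "norm (f \<rho>) \<le> C * exp (- \<delta> * Im \<rho>)" using F assms(2) by auto
        also have "\<dots> \<le> \<bar>C\<bar> * exp (- \<delta> * Im \<rho>)" by (intro mult_right_mono) auto
        finally have "norm (of_int (zorder riemann_zeta \<rho>) :: complex) * norm (f \<rho>) \<le> real_of_int \<bar>zorder riemann_zeta \<rho>\<bar> * (\<bar>C\<bar> * exp (- \<delta> * Im \<rho>))"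
          by (intro mult_mono) auto
        thus "norm (of_int (zorder riemann_zeta \<rho>) * f \<rho>) \<le> \<bar>C\<bar> * (real_of_int \<bar>zorder riemann_zeta \<rho>\<bar> * exp (- \<delta> * Im \<rho>))"
          by (simp add: norm_mult mult_ac)
      qed
      also have "\<dots> = \<bar>C\<bar> * (\<Sum>\<rho>\<in>F. real_of_int \<bar>zorder riemann_zeta \<rho>\<bar> * exp (- \<delta> * Im \<rho>))" by (rule sum_distrib_left[symmetric])
      also have "\<dots> \<le> \<bar>C\<bar> * B" using B F by (intro mult_left_mono) auto
      finally show "(\<Sum>\<rho>\<in>F. norm (of_int (zorder riemann_zeta \<rho>) * f \<rho>)) \<le> \<bar>C\<bar> * B" .
    qed
  qed auto
  thus ?thesis by (rule abs_summable_summable)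
qed

section \<open>The sum over the zeros\<close>

text \<open>The value at \<open>w = 0\<close> is the limit, so that the removable singularity is filled in.\<close>

definition odd_kernel :: "complex \<Rightarrow> complex \<Rightarrow> complex" where
  "odd_kernel z w = (if w = 0 then 2 * Ln z / pi else (z powr w - z powr (- w)) / sin (of_real pi * w))"

lemma odd_kernel_even: "odd_kernel z (- w) = odd_kernel z w"
proof (cases "w = 0")
  case False
  have "(a - b) / (- c) = (b - a) / c" for a b c :: complex by (metis minus_diff_eq minus_divide_divide)
  thus ?thesis using False by (simp add: odd_kernel_def)
qed simp

lemma sin_pi_eq_0_strip:
  assumes "\<bar>Re w\<bar> < 1" "sin (of_real pi * w) = 0"
  shows "w = 0"
proof -
  obtain i :: int where "of_real pi * w = of_int i * of_real pi" using assms(2) by (auto simp: sin_eq_0 mult.commute)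
  hence w: "w = of_int i" by simp
  hence "\<bar>i\<bar> < 1" using assms(1) by simp
  thus ?thesis using w by simp
qed

text \<open>Numerator and denominator both vanish at 0. Dividing each by w and filling in the
  derivatives 2 Ln z and pi gives a quotient of holomorphic functions whose denominator has no zero
  in the strip.\<close>

lemma odd_kernel_holomorphic:
  assumes "z \<noteq> 0"
  shows "odd_kernel z holomorphic_on {w. \<bar>Re w\<bar> < 1}"
proof -
  define A where "A = {w. \<bar>Re w\<bar> < 1}"
  have "A = {w. Re w < 1} \<inter> {w. Re w > -1}" by (auto simp: A_def)
  hence A: "open A" by (simp add: open_Int open_halfspace_Re_gt open_halfspace_Re_lt)
  define N where "N = (\<lambda>w. z powr w - z powr (- w))"
  define s where "s = (\<lambda>w. sin (of_real pi * w) :: complex)"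
  have "((\<lambda>w. exp (w * Ln z) - exp (- w * Ln z)) has_field_derivative exp (0 * Ln z) * Ln z - exp (- 0 * Ln z) * (- Ln z)) (at 0)"
    by (auto intro!: derivative_eq_intros)
  hence dN: "deriv N 0 = 2 * Ln z" using assms by (intro DERIV_imp_deriv) (simp add: N_def powr_def)
  have "(s has_field_derivative cos (of_real pi * 0) * of_real pi) (at 0)"
    unfolding s_def by (auto intro!: derivative_eq_intros)
  hence ds: "deriv s 0 = pi" by (intro DERIV_imp_deriv) simp
  have "(\<lambda>w. if w = 0 then deriv N 0 else (N w - N 0) / (w - 0)) holomorphic_on A"
    by (intro pole_lemma_open A) (use assms in \<open>auto simp: N_def intro!: holomorphic_intros\<close>)
  moreover have "(\<lambda>w. if w = 0 then deriv s 0 else (s w - s 0) / (w - 0)) holomorphic_on A"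
    by (intro pole_lemma_open A) (auto simp: s_def intro!: holomorphic_intros)
  moreover have "(if w = 0 then deriv s 0 else (s w - s 0) / (w - 0)) \<noteq> 0" if "w \<in> A" for w
    using sin_pi_eq_0_strip[of w] that by (auto simp: ds A_def) (auto simp: s_def)
  ultimately have "(\<lambda>w. (if w = 0 then deriv N 0 else (N w - N 0) / (w - 0)) / (if w = 0 then deriv s 0 else (s w - s 0) / (w - 0))) holomorphic_on A"
    by (intro holomorphic_on_divide)
  also have "(\<lambda>w. (if w = 0 then deriv N 0 else (N w - N 0) / (w - 0)) / (if w = 0 then deriv s 0 else (s w - s 0) / (w - 0))) = odd_kernel z"
    by (auto simp: fun_eq_iff odd_kernel_def dN ds) (auto simp: N_def s_def assms)
  finally show ?thesis by (simp add: A_def)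
qed

lemma odd_kernel_eq:
  assumes "z \<notin> \<real>\<^sub>\<le>\<^sub>0" "w \<noteq> 0"
  shows "odd_kernel z w = mellin_kernel z w - mellin_kernel (1 / z) w"
proof -
  have "z powr (- w) = (1 / z) powr w"
    using assms Ln_inverse[of z] by (auto simp: powr_def inverse_eq_divide)
  thus ?thesis using assms(2) by (simp add: odd_kernel_def mellin_kernel_def diff_divide_distrib)
qed

text \<open>For |Im w| \<ge> 1 the kernel estimate is applied at w and at -w. Nearer the real axis
  the two parts have poles at 0 that cancel only jointly, so the remaining compact rectangle is
  handled by continuity.\<close>

lemma odd_kernel_bound:
  assumes "z \<notin> \<real>\<^sub>\<le>\<^sub>0"
  obtains C where "C \<ge> 0" "\<And>w. \<bar>Re w\<bar> \<le> 3/4 \<Longrightarrow> norm (odd_kernel z w) \<le> C * exp (- (pi - \<bar>Arg z\<bar>) * \<bar>Im w\<bar>)"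
proof -
  define \<delta> where "\<delta> = pi - \<bar>Arg z\<bar>"
  have \<delta>: "\<delta> > 0" using Arg_less_pi[OF assms] by (simp add: \<delta>_def)
  have z0: "z \<noteq> 0" using assms by auto
  define Q where "Q = cbox (Complex (-3/4) (-1)) (Complex (3/4) 1)"
  have "continuous_on Q (odd_kernel z)"
    by (rule holomorphic_on_imp_continuous_on, rule holomorphic_on_subset[OF odd_kernel_holomorphic[OF z0]])
       (auto simp: Q_def in_cbox_complex_iff)
  hence "compact (odd_kernel z ` Q)" unfolding Q_def by (intro compact_continuous_image compact_cbox)
  then obtain C0 where C0: "\<And>w. w \<in> Q \<Longrightarrow> norm (odd_kernel z w) \<le> C0"
    using compact_imp_bounded bounded_iff by (metis imageI)
  define C1 where "C1 = 8 * exp (3/4 * \<bar>ln (norm z)\<bar>)"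
  have C1: "C1 \<ge> 0" by (simp add: C1_def)
  show ?thesis
  proof (rule that[of "\<bar>C0\<bar> * exp \<delta> + C1"])
    fix w assume w: "\<bar>Re w\<bar> \<le> 3/4"
    have "norm (odd_kernel z w) \<le> (\<bar>C0\<bar> * exp \<delta> + C1) * exp (- \<delta> * \<bar>Im w\<bar>)"
    proof (cases "\<bar>Im w\<bar> \<ge> 1")
      case True
      have w0: "w \<noteq> 0" using True by auto
      have k: "norm (mellin_kernel z u) \<le> 4 * exp (3/4 * \<bar>ln (norm z)\<bar>) * exp (- \<delta> * \<bar>Im w\<bar>)" if "u \<in> {w, - w}" for u
      proof -
        have "norm (mellin_kernel z u) \<le> 4 * exp (\<bar>Re u\<bar> * \<bar>ln (norm z)\<bar>) * exp (- (pi - \<bar>Arg z\<bar>) * \<bar>Im u\<bar>)"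
          using True that by (intro mellin_kernel_norm_le) auto
        also have "\<dots> \<le> 4 * exp (3/4 * \<bar>ln (norm z)\<bar>) * exp (- \<delta> * \<bar>Im w\<bar>)"
        proof -
          have "\<bar>Re u\<bar> = \<bar>Re w\<bar>" "\<bar>Im u\<bar> = \<bar>Im w\<bar>" using that by auto
          moreover from this have "\<bar>Re u\<bar> * \<bar>ln (norm z)\<bar> \<le> 3/4 * \<bar>ln (norm z)\<bar>"
            using w by (intro mult_right_mono) auto
          ultimately show ?thesis unfolding \<delta>_def by (intro mult_mono) auto
        qed
        finally show ?thesis .
      qed
      have "odd_kernel z w = mellin_kernel z w + mellin_kernel z (- w)"
        using w0 by (simp add: odd_kernel_def mellin_kernel_def diff_divide_distrib)
      hence "norm (odd_kernel z w) \<le> norm (mellin_kernel z w) + norm (mellin_kernel z (- w))"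
        by (simp add: norm_triangle_ineq)
      also have "\<dots> \<le> C1 * exp (- \<delta> * \<bar>Im w\<bar>)" using k[of w] k[of "- w"] by (simp add: C1_def)
      also have "\<dots> \<le> (\<bar>C0\<bar> * exp \<delta> + C1) * exp (- \<delta> * \<bar>Im w\<bar>)" by (intro mult_right_mono) auto
      finally show ?thesis .
    next
      case False
      hence "w \<in> Q" using w by (auto simp: Q_def in_cbox_complex_iff abs_le_iff)
      hence "norm (odd_kernel z w) \<le> \<bar>C0\<bar> * 1" using C0[of w] by simp
      also have "\<dots> \<le> \<bar>C0\<bar> * (exp \<delta> * exp (- \<delta> * \<bar>Im w\<bar>))"
      proof (intro mult_left_mono)
        have "\<delta> * \<bar>Im w\<bar> \<le> \<delta> * 1" using False \<delta> by (intro mult_left_mono) auto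
        thus "1 \<le> exp \<delta> * exp (- \<delta> * \<bar>Im w\<bar>)" by (simp flip: exp_add)
      qed auto
      also have "\<dots> \<le> (\<bar>C0\<bar> * exp \<delta> + C1) * exp (- \<delta> * \<bar>Im w\<bar>)" using C1 by (simp add: ring_distribs)
      finally show ?thesis .
    qed
    thus "norm (odd_kernel z w) \<le> (\<bar>C0\<bar> * exp \<delta> + C1) * exp (- (pi - \<bar>Arg z\<bar>) * \<bar>Im w\<bar>)" by (simp add: \<delta>_def)
  qed (use C1 in auto)
qed

text \<open>With i \<alpha> = w the sine becomes (z^w - z^(-w))/(2i), and sinh(pi \<alpha>) becomes
  -i sin(pi w). The 1/2 absorbs the factor 2 in front of the sum over zeros.\<close>

lemma sin_div_sinh_eq_odd_kernel:
  fixes z w \<alpha> :: complex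
  assumes "z \<noteq> 0" "w \<noteq> 0" "\<alpha> = - \<i> * w"
  shows "sin (\<alpha> * Ln z) / sinh (pi * \<alpha>) = odd_kernel z w / 2"
proof -
  have i: "\<i> * (- \<i> * x) = x" for x :: complex by (simp flip: mult.assoc)
  have e0: "\<i> * (\<alpha> * Ln z) = w * Ln z" using assms(3) i[of "w * Ln z"] by (simp add: mult.assoc)
  have 1: "sin (\<alpha> * Ln z) = (z powr w - z powr (- w)) / (2 * \<i>)"
    unfolding sin_exp_eq e0 using assms(1) by (simp add: powr_def)
  have "sinh (pi * \<alpha>) = - (\<i> * sin (of_real pi * w))"
  proof -
    have e: "of_real pi * \<alpha> = - (\<i> * (of_real pi * w))" using assms(3) by simp
    show ?thesis unfolding e sinh_minus by (simp add: sinh_conv_sin)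
  qed
  hence "sin (\<alpha> * Ln z) / sinh (pi * \<alpha>) = ((z powr w - z powr (- w)) / (2 * \<i>)) / (- (\<i> * sin (of_real pi * w)))"
    unfolding 1 by simp
  also have "\<dots> = odd_kernel z w / 2" using assms(2) by (simp add: odd_kernel_def)
  finally show ?thesis .
qed

section \<open>Symmetry of the zeros and of the logarithmic derivative\<close>

lemma zorder_reflect:
  assumes "f analytic_on {z}" "\<forall>\<^sub>F w in at z. f w \<noteq> 0"
  shows "zorder (\<lambda>w. f (a - w)) (a - z) = zorder f z"
proof -
  define n where "n = zorder f z"
  obtain r where r: "r > 0" "zor_poly f z holomorphic_on cball z r" "zor_poly f z z \<noteq> 0"
     "\<And>w. w \<in> cball z r - {z} \<Longrightarrow> f w = zor_poly f z w * (w - z) powi n"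
    using zorder_exist[OF isolated_singularity_at_analytic[OF assms(1)] not_essential_analytic[OF assms(1)]
        eventually_frequently[OF _ assms(2)]] unfolding n_def by auto
  have dd: "dist z (a - w) = dist (a - z) w" for w
    using norm_minus_commute[of z "a - w"] by (simp add: dist_norm algebra_simps)
  show ?thesis unfolding n_def[symmetric]
  \<comment> \<open>Reversing the direction only multiplies the regular factor by (-1)^n.\<close>
  proof (rule zorder_eqI[of "ball (a - z) r" _ "\<lambda>w. (-1) powi n * zor_poly f z (a - w)"])
    have "zor_poly f z \<circ> (\<lambda>w. a - w) holomorphic_on ball (a - z) r"
      by (intro holomorphic_on_compose holomorphic_intros holomorphic_on_subset[OF r(2)])
         (auto simp: dd)
    thus "(\<lambda>w. (-1) powi n * zor_poly f z (a - w)) holomorphic_on ball (a - z) r"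
      by (intro holomorphic_intros) (simp add: o_def)
    fix w assume w: "w \<in> ball (a - z) r" "w \<noteq> a - z"
    have m: "a - w \<in> cball z r - {z}" using w by (auto simp: dd)
    have "f (a - w) = zor_poly f z (a - w) * ((-1) * (w - (a - z))) powi n"
      using r(4)[OF m] by (simp add: algebra_simps)
    thus "f (a - w) = (-1) powi n * zor_poly f z (a - w) * (w - (a - z)) powi n"
      unfolding power_int_mult_distrib by simp
  qed (use r in auto)
qed

lemma xi_fun_analytic: "Re s > -1 \<Longrightarrow> xi_fun analytic_on {s}"
  using analytic_at[of xi_fun s] xi_fun_holomorphic open_halfspace_Re_gt by blast

lemma xi_fun_eventually_nonzero:
  assumes "Re s > -1"
  shows "\<forall>\<^sub>F w in at s. xi_fun w \<noteq> 0"
proof -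
  have "xi_fun 2 \<noteq> 0" using zeta_aux_nonzero_right[of 2] xi_fun_eq_0_iff[of 2] by simp
  hence "\<forall>\<^sub>F w in at s. xi_fun w \<noteq> 0 \<and> w \<in> {s. Re s > -1}"
    by (intro non_zero_neighbour_alt[OF xi_fun_holomorphic, of _ 2])
       (use assms in \<open>auto simp: open_halfspace_Re_gt convex_connected convex_halfspace_Re_gt\<close>)
  thus ?thesis by (auto elim: eventually_mono)
qed

lemma open_strip: "open {s. a < Re s \<and> Re s < b}"
proof -
  have "{s. a < Re s \<and> Re s < b} = {s. Re s > a} \<inter> {s. Re s < b}" by auto
  thus ?thesis by (simp add: open_Int open_halfspace_Re_gt open_halfspace_Re_lt)
qed

lemma zorder_xi_fun_reflect:
  assumes "-1 < Re s" "Re s < 2"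
  shows "zorder xi_fun (1 - s) = zorder xi_fun s"
proof -
  have "zorder xi_fun (1 - s) = zorder (\<lambda>w. xi_fun (1 - w)) (1 - s)"
  proof (rule zorder_cong[OF _ refl])
    have "\<forall>\<^sub>F w in nhds (1 - s). w \<in> {s. -1 < Re s \<and> Re s < 2}"
      using assms by (intro eventually_nhds_in_open open_strip) auto
    hence "\<forall>\<^sub>F w in at (1 - s). w \<in> {s. -1 < Re s \<and> Re s < 2}"
      by (rule eventually_nhds_conv_at[THEN iffD1, THEN conjunct1])
    thus "\<forall>\<^sub>F w in at (1 - s). xi_fun w = xi_fun (1 - w)"
      by eventually_elim (auto intro: xi_fun_reflection)
  qed
  also have "\<dots> = zorder xi_fun s"
    using assms by (intro zorder_reflect xi_fun_analytic xi_fun_eventually_nonzero)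
  finally show ?thesis .
qed

lemma deriv_xi_fun_reflect:
  assumes "-1 < Re s" "Re s < 2"
  shows "deriv xi_fun (1 - s) = - deriv xi_fun s"
proof -
  have d: "(xi_fun has_field_derivative deriv xi_fun (1 - s)) (at (1 - s))"
    by (rule holomorphic_derivI[OF xi_fun_holomorphic open_halfspace_Re_gt]) (use assms in simp)
  have "((\<lambda>s. xi_fun (1 - s)) has_field_derivative deriv xi_fun (1 - s) * (-1)) (at s)"
    by (rule DERIV_chain2[where f = xi_fun]) (use d in \<open>auto intro!: derivative_eq_intros\<close>)
  hence "(xi_fun has_field_derivative deriv xi_fun (1 - s) * (-1)) (at s)"
    by (rule has_field_derivative_transform_within_open[OF _ open_strip, of _ _ _ "-1" 2])
       (use assms in \<open>auto simp: xi_fun_reflection[symmetric]\<close>)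
  hence "deriv xi_fun s = deriv xi_fun (1 - s) * (-1)" by (rule DERIV_imp_deriv)
  thus ?thesis by simp
qed

lemma xi_fun_finite_zeros:
  "finite {s. -1/2 < Re s \<and> Re s < 3/2 \<and> \<bar>Im s\<bar> < T \<and> xi_fun s = 0}"
proof -
  define S where "S = {s. Re s > -1}"
  define Q where "Q = cbox (Complex (-1/2) (-T)) (Complex (3/2) T)"
  have two: "xi_fun 2 \<noteq> 0" using zeta_aux_nonzero_right[of 2] xi_fun_eq_0_iff[of 2] by simp
  have Q: "Q \<subseteq> S" by (auto simp: Q_def S_def in_cbox_complex_iff)
  have "finite {s\<in>Q. xi_fun s = 0}"
  proof (cases "xi_fun constant_on S")
    case True
    then obtain c where c: "\<And>s. s \<in> S \<Longrightarrow> xi_fun s = c" by (auto simp: constant_on_def)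
    hence "c \<noteq> 0" using two c[of 2] by (auto simp: S_def)
    hence "{s\<in>Q. xi_fun s = 0} = {}" using Q c by auto
    thus ?thesis by (simp only: finite.emptyI)
  next
    case False
    thus ?thesis using Q xi_fun_holomorphic unfolding S_def
      by (intro holomorphic_compact_finite_zeros[of xi_fun "{s. Re s > -1}"])
         (auto simp: Q_def open_halfspace_Re_gt convex_connected convex_halfspace_Re_gt)
  qed
  thus ?thesis by (rule finite_subset[rotated]) (auto simp: Q_def in_cbox_complex_iff abs_less_iff)
qed

text \<open>The argument principle weighted by the kernel. The rectangle -1/4 \<le> Re s \<le> 5/4
  is symmetric about 1/2: its zeros are the upper ones P and their reflections 1 - p, with equal
  orders and equal kernel values, and its left side contributes as much as its right because the
  integrand is odd. Both doublings cancel, and the horizontal sides are the error.\<close>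

lemma zero_sum_contour:
  assumes z: "z \<noteq> 0" and T: "T > 0"
    and B: "\<And>s. \<bar>Im s\<bar> = T \<Longrightarrow> -1/4 \<le> Re s \<Longrightarrow> Re s \<le> 5/4 \<Longrightarrow>
      xi_fun s \<noteq> 0 \<and> norm (deriv xi_fun s * odd_kernel z (s - 1/2) / xi_fun s) \<le> B"
  shows "finite {\<rho>\<in>zeta_zeros_upper. Im \<rho> < T}"
    and "norm ((\<Sum>\<rho>\<in>{\<rho>\<in>zeta_zeros_upper. Im \<rho> < T}. of_int (zorder riemann_zeta \<rho>) * odd_kernel z (\<rho> - 1/2))
       - integral {-T..T} (\<lambda>t. deriv xi_fun (Complex (5/4) t) * odd_kernel z (Complex (5/4) t - 1/2) / xi_fun (Complex (5/4) t)) / (2 * pi)) \<le> B"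
proof -
  define h where "h = (\<lambda>s. odd_kernel z (s - 1/2))"
  define F where "F = (\<lambda>s. deriv xi_fun s * h s / xi_fun s)"
  \<comment> \<open>The box is taller than the rectangle, so it may contain zeros with |Im s| > T;
    they drop out since their winding number is 0.\<close>
  define S where "S = box (Complex (-1/2) (-(T+1))) (Complex (3/2) (T+1))"
  define pz where "pz = {w\<in>S. xi_fun w = 0 \<or> w \<in> {}}"
  define g where "g = rectpath (Complex (-1/4) (-T)) (Complex (5/4) T)"
  define P where "P = {\<rho>\<in>zeta_zeros_upper. Im \<rho> < T}"
  have S: "open S" "connected S" by (simp_all add: S_def open_box convex_connected convex_box)
  have inS: "s \<in> S \<longleftrightarrow> -1/2 < Re s \<and> Re s < 3/2 \<and> \<bar>Im s\<bar> < T + 1" for s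
    by (auto simp: S_def in_box_complex_iff)
  have strip: "0 \<le> Re s \<and> Re s \<le> 1 \<and> Im s \<noteq> 0" if "xi_fun s = 0" "-1 < Re s" "Re s < 2" for s
    using xi_fun_zero_strip[OF that(2,3,1)] by blast
  have finpz: "finite pz" using xi_fun_finite_zeros[of "T + 1"] by (rule finite_subset[rotated]) (auto simp: pz_def inS)
  have Psub: "P \<subseteq> pz"
    using strip by (fastforce simp: P_def pz_def zeta_zeros_upper_iff inS)
  show "finite {\<rho>\<in>zeta_zeros_upper. Im \<rho> < T}" using finite_subset[OF Psub finpz] by (simp add: P_def)
  have holxi: "xi_fun holomorphic_on S" by (rule holomorphic_on_subset[OF xi_fun_holomorphic]) (auto simp: inS)
  have "odd_kernel z \<circ> (\<lambda>s. s - 1/2) holomorphic_on S"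
    by (intro holomorphic_on_compose holomorphic_intros holomorphic_on_subset[OF odd_kernel_holomorphic[OF z]])
       (auto simp: inS abs_less_iff)
  hence holh: "h holomorphic_on S" by (simp add: h_def o_def)
  have pim: "s \<in> path_image g \<longleftrightarrow> -1/4 \<le> Re s \<and> Re s \<le> 5/4 \<and> \<bar>Im s\<bar> \<le> T \<and> (Re s = -1/4 \<or> Re s = 5/4 \<or> \<bar>Im s\<bar> = T)" for s
    unfolding g_def using T by (intro path_image_rectpath_iff) auto
  have img: "path_image g \<subseteq> S - pz"
  proof
    fix s assume s: "s \<in> path_image g"
    hence "s \<in> S" by (auto simp: pim inS)
    moreover have "xi_fun s \<noteq> 0"
    proof
      assume 0: "xi_fun s = 0"
      have r: "-1/4 \<le> Re s" "Re s \<le> 5/4" using s pim by blast+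
      hence "0 \<le> Re s \<and> Re s \<le> 1 \<and> Im s \<noteq> 0" using strip[OF 0] by simp
      hence "\<bar>Im s\<bar> = T" using s pim[of s] by auto
      thus False using B[of s] r 0 by blast
    qed
    ultimately show "s \<in> S - pz" by (simp add: pz_def)
  qed
  have homo: "\<forall>w. w \<notin> S \<longrightarrow> winding_number g w = 0"
  proof (intro allI impI)
    fix w assume "w \<notin> S"
    thus "winding_number g w = 0" unfolding g_def using T
      by (intro winding_number_rectpath_outside) (auto simp: inS in_cbox_complex_iff)
  qed
  have "contour_integral g F = 2 * pi * \<i> * (\<Sum>p\<in>pz. winding_number g p * h p * zorder xi_fun p)"
    unfolding F_def pz_def
  proof (rule argument_principle[OF S])
    show "xi_fun holomorphic_on S - {}" using holxi by simp
    show "path_image g \<subseteq> S - {w\<in>S. xi_fun w = 0 \<or> w \<in> {}}" using img by (simp add: pz_def)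
    show "finite {w\<in>S. xi_fun w = 0 \<or> w \<in> {}}" using finpz by (simp add: pz_def)
  qed (use holh homo in \<open>auto simp: g_def\<close>)
  also have "(\<Sum>p\<in>pz. winding_number g p * h p * zorder xi_fun p) = (\<Sum>p\<in>P \<union> (\<lambda>s. 1 - s) ` P. h p * zorder xi_fun p)"
  proof (rule sum.mono_neutral_cong_right[OF finpz])
    have "(\<lambda>s. 1 - s) ` P \<subseteq> pz"
    proof
      fix p assume "p \<in> (\<lambda>s. 1 - s) ` P"
      then obtain q where q: "q \<in> P" "p = 1 - q" by blast
      hence "q \<in> pz" using Psub by blast
      hence qz: "xi_fun q = 0" "-1 < Re q" "Re q < 2" "q \<in> S" by (auto simp: pz_def inS)
      thus "p \<in> pz" using q strip[OF qz(1,2,3)] xi_fun_reflection[OF qz(2,3)] by (auto simp: pz_def inS)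
    qed
    thus "P \<union> (\<lambda>s. 1 - s) ` P \<subseteq> pz" using Psub by blast
    have cl: "Im p \<noteq> 0 \<and> \<bar>Im p\<bar> \<noteq> T \<and> 0 \<le> Re p \<and> Re p \<le> 1" if "p \<in> pz" for p
    proof -
      have p: "xi_fun p = 0" "-1 < Re p" "Re p < 2" using that by (auto simp: pz_def inS)
      have "\<bar>Im p\<bar> \<noteq> T" using B[of p] p strip[OF p] by auto
      thus ?thesis using strip[OF p] by blast
    qed
    have dich: "p \<in> P \<union> (\<lambda>s. 1 - s) ` P" if "p \<in> pz" "\<bar>Im p\<bar> < T" for p
    proof (cases "Im p > 0")
      case True
      thus ?thesis using that by (auto simp: P_def zeta_zeros_upper_iff pz_def inS)
    next
      case False
      have p: "xi_fun p = 0" "-1 < Re p" "Re p < 2" using that by (auto simp: pz_def inS)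
      have "1 - p \<in> P" using False cl[OF that(1)] that xi_fun_reflection[OF p(2,3)] p
        by (auto simp: P_def zeta_zeros_upper_iff)
      thus ?thesis by (intro UnI2 image_eqI[of _ _ "1 - p"]) auto
    qed
    show "\<forall>p\<in>pz - (P \<union> (\<lambda>s. 1 - s) ` P). winding_number g p * h p * of_int (zorder xi_fun p) = 0"
    proof
      fix p assume p: "p \<in> pz - (P \<union> (\<lambda>s. 1 - s) ` P)"
      hence "\<not> \<bar>Im p\<bar> < T" using dich by blast
      hence "\<bar>Im p\<bar> > T" using cl[of p] p by auto
      hence "winding_number g p = 0" unfolding g_def using T
        by (intro winding_number_rectpath_outside) (auto simp: in_cbox_complex_iff)
      thus "winding_number g p * h p * of_int (zorder xi_fun p) = 0" by simp
    qed
    show "winding_number g p * h p * of_int (zorder xi_fun p) = h p * of_int (zorder xi_fun p)" if "p \<in> P \<union> (\<lambda>s. 1 - s) ` P" for p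
    proof -
      have "p \<in> pz" using that Psub \<open>(\<lambda>s. 1 - s) ` P \<subseteq> pz\<close> by blast
      moreover have "\<bar>Im p\<bar> < T" using that by (auto simp: P_def zeta_zeros_upper_iff)
      ultimately have "winding_number g p = 1" unfolding g_def using cl[of p]
        by (intro winding_number_rectpath) (auto simp: in_box_complex_iff)
      thus ?thesis by simp
    qed
  qed
  also have "\<dots> = (\<Sum>p\<in>P. h p * zorder xi_fun p) + (\<Sum>p\<in>(\<lambda>s. 1 - s) ` P. h p * zorder xi_fun p)"
    using finite_subset[OF Psub finpz] by (intro sum.union_disjoint) (auto simp: P_def zeta_zeros_upper_iff)
  also have "(\<Sum>p\<in>(\<lambda>s. 1 - s) ` P. h p * zorder xi_fun p) = (\<Sum>p\<in>P. h (1 - p) * zorder xi_fun (1 - p))"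
    by (subst sum.reindex) (auto simp: inj_on_def o_def)
  also have "\<dots> = (\<Sum>p\<in>P. h p * zorder xi_fun p)"
  proof (intro sum.cong refl)
    fix p assume "p \<in> P"
    hence p: "-1 < Re p" "Re p < 2" by (auto simp: P_def zeta_zeros_upper_iff)
    have "h (1 - p) = h p" using odd_kernel_even[of z "p - 1/2"] by (simp add: h_def)
    thus "h (1 - p) * zorder xi_fun (1 - p) = h p * zorder xi_fun p" using zorder_xi_fun_reflect[OF p] by simp
  qed
  also have "(\<Sum>p\<in>P. h p * zorder xi_fun p) = (\<Sum>\<rho>\<in>P. of_int (zorder riemann_zeta \<rho>) * h \<rho>)"
  proof (intro sum.cong refl)
    fix p assume "p \<in> P"
    hence p: "-1 < Re p" "Im p > 0" by (auto simp: P_def zeta_zeros_upper_iff)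
    have "zorder xi_fun p = zorder riemann_zeta p"
      using zorder_xi_fun[OF p(1)] zorder_riemann_zeta[OF p(1)] p(2) by force
    thus "h p * zorder xi_fun p = of_int (zorder riemann_zeta p) * h p" by (simp add: mult.commute)
  qed
  finally have ap: "contour_integral g F = 2 * pi * \<i> * (2 * (\<Sum>\<rho>\<in>P. of_int (zorder riemann_zeta \<rho>) * h \<rho>))" by simp
  define \<Sigma> where "\<Sigma> = (\<Sum>\<rho>\<in>P. of_int (zorder riemann_zeta \<rho>) * h \<rho>)"
  have "F holomorphic_on S - pz" unfolding F_def
    using holomorphic_on_subset[OF holomorphic_deriv[OF holxi S(1)], of "S - pz"] holomorphic_on_subset[OF holxi, of "S - pz"]
      holomorphic_on_subset[OF holh, of "S - pz"]
    by (intro holomorphic_on_divide holomorphic_on_mult) (auto simp: pz_def)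
  hence cont: "continuous_on (path_image g) F"
    by (rule holomorphic_on_imp_continuous_on[OF holomorphic_on_subset]) (rule img)
  define h1 h2 where "h1 = contour_integral (linepath (Complex (-1/4) (-T)) (Complex (5/4) (-T))) F"
    and "h2 = contour_integral (linepath (Complex (-1/4) T) (Complex (5/4) T)) F"
  define I where "I = integral {-T..T} (\<lambda>t. F (Complex (5/4) t))"
  have ci: "contour_integral g F = \<i> * I - \<i> * integral {-T..T} (\<lambda>t. F (Complex (-1/4) t)) + (h1 - h2)"
    unfolding I_def h1_def h2_def g_def
    by (rule contour_integral_rectpath) (use T cont in \<open>auto simp: g_def\<close>)
  \<comment> \<open>Under s -> 1 - s the derivative of the completed function changes sign while the
    function and the kernel do not.\<close>
  have Fodd: "F (Complex (-1/4) t) = - F (Complex (5/4) (- t))" for t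
  proof -
    have c: "Complex (-1/4) t = 1 - Complex (5/4) (- t)" by (simp add: complex_eq_iff)
    have "deriv xi_fun (1 - Complex (5/4) (- t)) = - deriv xi_fun (Complex (5/4) (- t))" by (rule deriv_xi_fun_reflect) auto
    moreover have "xi_fun (1 - Complex (5/4) (- t)) = xi_fun (Complex (5/4) (- t))" by (rule xi_fun_reflection[symmetric]) auto
    moreover have "h (1 - Complex (5/4) (- t)) = h (Complex (5/4) (- t))"
      using odd_kernel_even[of z "Complex (5/4) (- t) - 1/2"] by (simp add: h_def)
    ultimately show ?thesis unfolding c F_def by simp
  qed
  have "integral {-T..T} (\<lambda>t. F (Complex (-1/4) t)) = - integral {-T..T} (\<lambda>t. F (Complex (5/4) (- t)))"
    unfolding Fodd by (rule integral_neg)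
  also have "integral {-T..T} (\<lambda>t. F (Complex (5/4) (- t))) = I"
    unfolding I_def using Henstock_Kurzweil_Integration.integral_reflect_real[of T "-T" "\<lambda>t. F (Complex (5/4) t)"] by simp
  finally have "2 * pi * \<i> * (2 * \<Sigma>) = 2 * \<i> * I + (h1 - h2)" using ap ci by (simp add: \<Sigma>_def mult.assoc)
  hence "4 * pi * \<i> * (\<Sigma> - I / (2 * pi)) = h1 - h2"
  proof -
    have "4 * pi * \<i> * (\<Sigma> - I / (2 * pi)) = 2 * pi * \<i> * (2 * \<Sigma>) - 2 * \<i> * I" by (simp add: field_simps)
    thus ?thesis using \<open>2 * pi * \<i> * (2 * \<Sigma>) = 2 * \<i> * I + (h1 - h2)\<close> by simp
  qed
  hence "norm (4 * pi * \<i> * (\<Sigma> - I / (2 * pi))) = norm (h1 - h2)" by simp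
  hence n: "4 * pi * norm (\<Sigma> - I / (2 * pi)) = norm (h1 - h2)" by (simp add: norm_mult)
  have seg: "closed_segment (Complex (-1/4) T') (Complex (5/4) T') \<subseteq> path_image g" if "T' \<in> {T, -T}" for T'
    using that T by (auto simp: pim closed_segment_same_Im closed_segment_eq_real_ivl)
  have hb: "norm (F (Complex x T')) \<le> B" if "-1/4 \<le> x" "x \<le> 5/4" "T' \<in> {T, -T}" for x T'
    using B[of "Complex x T'"] that T by (auto simp: F_def h_def)
  have b1: "norm h1 \<le> B * (5/4 - (-1/4))" unfolding h1_def
    by (intro horizontal_integral_bound continuous_on_subset[OF cont] seg hb) auto
  have b2: "norm h2 \<le> B * (5/4 - (-1/4))" unfolding h2_def
    by (intro horizontal_integral_bound continuous_on_subset[OF cont] seg hb) auto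
  \<comment> \<open>Each horizontal side has length 3/2. The difference is later divided by 4 pi >
    12, so B leaves ample room.\<close>
  have "norm (h1 - h2) \<le> 3 * B" using norm_triangle_ineq4[of h1 h2] b1 b2 by simp
  hence "4 * pi * norm (\<Sigma> - I / (2 * pi)) \<le> 3 * B" unfolding n .
  moreover have "4 * 3 * norm (\<Sigma> - I / (2 * pi)) \<le> 4 * pi * norm (\<Sigma> - I / (2 * pi))"
    using pi_gt3 by (intro mult_right_mono mult_left_mono) auto
  moreover have "norm (\<Sigma> - I / (2 * pi)) \<ge> 0" by simp
  ultimately have "norm (\<Sigma> - I / (2 * pi)) \<le> B" by argo
  thus "norm ((\<Sum>\<rho>\<in>{\<rho>\<in>zeta_zeros_upper. Im \<rho> < T}. of_int (zorder riemann_zeta \<rho>) * odd_kernel z (\<rho> - 1/2))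
       - integral {-T..T} (\<lambda>t. deriv xi_fun (Complex (5/4) t) * odd_kernel z (Complex (5/4) t - 1/2) / xi_fun (Complex (5/4) t)) / (2 * pi)) \<le> B"
    by (simp add: \<Sigma>_def P_def I_def F_def h_def)
qed

text \<open>Termwise integration: the term for m has modulus \<Lambda>(m) m^(-5/4) times that of the
  kernel, with 5/4 = 1/2 + 3/4, and these coefficients are summable.\<close>

lemma line_integral_mangoldt_series:
  fixes y :: complex assumes y: "y \<notin> \<real>\<^sub>\<le>\<^sub>0"
  shows "integrable lborel (\<lambda>t. mangoldt_series (1/2 + Complex (3/4) t) * mellin_kernel y (Complex (3/4) t))"
    and "line_integral (\<lambda>w. mangoldt_series (1/2 + w)) (3/4) y =
      (\<Sum>n. mangoldt (Suc n) * y / (pi * csqrt (of_nat (Suc n)) * (y + of_nat (Suc n))))"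
proof -
  define k where "k = (\<lambda>t. mellin_kernel y (Complex (3/4) t))"
  define c :: "nat \<Rightarrow> complex" where "c = (\<lambda>n. mangoldt (Suc n) * of_nat (Suc n) powr (- (1/2)))"
  define f where "f = (\<lambda>n t. c n * of_nat (Suc n) powr (- Complex (3/4) t) * k t)"
  define a where "a = (\<lambda>n. norm (mangoldt (Suc n) * of_nat (Suc n) powr (- (5/4)) :: complex))"
  have a: "summable a" unfolding a_def by (rule mangoldt_series_summable) simp
  have intk: "integrable lborel k"
    using integrable_three_quarters[OF y, of "\<lambda>_. 1" 1] by (simp add: k_def)
  have nf: "norm (f n t) = a n * norm (k t)" for n t
  proof -
    have "real (Suc n) powr (- (1/2)) * real (Suc n) powr (- (3/4)) = real (Suc n) powr (- (5/4))"
      by (simp flip: powr_add)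
    thus ?thesis
      unfolding f_def c_def a_def norm_mult norm_of_nat_Suc_powr by (simp add: mult.assoc del: of_nat_Suc)
  qed
  have intf: "integrable lborel (f n)" for n
    unfolding f_def k_def
  proof (rule integrable_three_quarters[OF y, where f = "\<lambda>w. c n * of_nat (Suc n) powr (- w)" and K = "norm (c n)"])
    show "(\<lambda>w. c n * of_nat (Suc n) powr (- w)) holomorphic_on {w. Re w > 1/2}"
      by (intro holomorphic_intros)
    fix w :: complex assume w: "Re w = 3/4"
    have "real (Suc n) powr (- (3/4)) \<le> real (Suc n) powr 0" by (intro powr_mono) auto
    hence "norm (c n) * real (Suc n) powr (- (3/4)) \<le> norm (c n) * 1" by (intro mult_left_mono) auto
    also have "\<dots> \<le> norm (c n) * (1 + \<bar>Im w\<bar>)\<^sup>2" by (intro mult_left_mono) auto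
    finally show "norm (c n * of_nat (Suc n) powr (- w)) \<le> norm (c n) * (1 + \<bar>Im w\<bar>)\<^sup>2"
      unfolding norm_mult norm_of_nat_Suc_powr using w by (simp only: uminus_complex.sel)
  qed
  have s1: "AE t in lborel. summable (\<lambda>n. norm (f n t))"
    unfolding nf using a by (intro AE_I2 summable_mult2)
  have s2: "summable (\<lambda>n. LINT t|lborel. norm (f n t))"
    unfolding nf using a by (simp add: summable_mult2)
  have eq: "(\<Sum>n. f n t) = mangoldt_series (1/2 + Complex (3/4) t) * k t" for t
  proof -
    have "summable (\<lambda>n. mangoldt (Suc n) * of_nat (Suc n) powr (- (1/2 + Complex (3/4) t)) :: complex)"
      by (rule summable_norm_cancel, rule mangoldt_series_summable) simp
    moreover have "f n t = mangoldt (Suc n) * of_nat (Suc n) powr (- (1/2 + Complex (3/4) t)) * k t" for n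
    proof -
      have "of_nat (Suc n) powr (- (1/2 + Complex (3/4) t)) = of_nat (Suc n) powr (- (1/2)) * of_nat (Suc n) powr (- Complex (3/4) t)"
        unfolding powr_add[symmetric] by simp
      thus ?thesis unfolding f_def c_def by (simp add: mult.assoc)
    qed
    ultimately show ?thesis unfolding mangoldt_series_def by (simp only: suminf_mult2)
  qed
  show "integrable lborel (\<lambda>t. mangoldt_series (1/2 + Complex (3/4) t) * mellin_kernel y (Complex (3/4) t))"
    using integrable_suminf[OF intf s1 s2] unfolding eq by (simp add: k_def)
  have "(\<lambda>n. (LINT t|lborel. f n t) / (2 * pi)) sums ((LINT t|lborel. (\<Sum>n. f n t)) / (2 * pi))"
    by (intro sums_divide sums_integral[OF intf s1 s2])
  moreover have "(LINT t|lborel. f n t) / (2 * pi) =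
     mangoldt (Suc n) * y / (pi * csqrt (of_nat (Suc n)) * (y + of_nat (Suc n)))" for n
  proof -
    have "(LINT t|lborel. f n t) / (2 * pi) = line_integral (\<lambda>w. c n * of_nat (Suc n) powr (- w)) (3/4) y"
      by (simp add: line_integral_def f_def k_def)
    also have "\<dots> = c n * (y / (pi * (y + of_nat (Suc n))))"
      unfolding line_integral_cmult using line_integral_nat_powr[OF y, of "Suc n"] by simp
    also have "c n = mangoldt (Suc n) / csqrt (of_nat (Suc n))"
      unfolding c_def csqrt_conv_powr powr_minus by (rule divide_inverse[symmetric])
    finally show ?thesis by (simp add: mult_ac)
  qed
  ultimately have "(\<lambda>n. mangoldt (Suc n) * y / (pi * csqrt (of_nat (Suc n)) * (y + of_nat (Suc n)))) sums
     ((LINT t|lborel. (\<Sum>n. f n t)) / (2 * pi))" by simp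
  from sums_unique[OF this] show "line_integral (\<lambda>w. mangoldt_series (1/2 + w)) (3/4) y =
      (\<Sum>n. mangoldt (Suc n) * y / (pi * csqrt (of_nat (Suc n)) * (y + of_nat (Suc n))))"
    unfolding line_integral_def eq by (simp add: k_def)
qed

section \<open>Passage to the limit along the chosen heights\<close>

lemma xi_fun_good_heights:
  obtains K where "K \<ge> 0"
    "\<And>n::nat. \<exists>T. real n \<le> T \<and> T \<le> real n + 1 \<and> (\<forall>s. \<bar>Im s\<bar> = T \<and> -1/4 \<le> Re s \<and> Re s \<le> 5/4 \<longrightarrow>
        xi_fun s \<noteq> 0 \<and> norm (deriv xi_fun s / xi_fun s) \<le> K * (1 + real n)\<^sup>2)"
proof -
  obtain K where K: "K \<ge> 1"
    "\<And>n::nat. \<exists>T. real n \<le> T \<and> T \<le> real n + 1 \<and> (\<forall>s. \<bar>Im s\<bar> = T \<and> -1/4 \<le> Re s \<and> Re s \<le> 5/4 \<longrightarrow>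
        zeta_aux s \<noteq> 0 \<and> norm (deriv zeta_aux s / zeta_aux s) \<le> K * (1 + real n) ^ 2)"
    by (fact zeta_aux_good_heights)
  have main: "xi_fun s \<noteq> 0 \<and> norm (deriv xi_fun s / xi_fun s) \<le> (K + 40) * (1 + real n)\<^sup>2"
    if z: "zeta_aux s \<noteq> 0" and l: "norm (deriv zeta_aux s / zeta_aux s) \<le> K * (1 + real n) ^ 2"
      and s: "\<bar>Im s\<bar> \<le> real n + 1" "-1/4 \<le> Re s" "Re s \<le> 5/4" for s n
  proof -
    have "norm s \<le> \<bar>Re s\<bar> + \<bar>Im s\<bar>" by (rule cmod_le)
    also have "\<dots> \<le> 5/4 + (real n + 1)" using s by linarith
    finally have "norm s \<le> 5/4 + (real n + 1)" .
    moreover have "norm (s / 2 + 1) \<le> norm s / 2 + 1"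
      using norm_triangle_ineq[of "s / 2" 1] by (simp add: norm_divide)
    ultimately have "norm (s / 2 + 1) \<le> 3 + real n" by linarith
    moreover have "norm (Digamma (s / 2 + 1)) \<le> 15 * (1 + norm (s / 2 + 1))"
      by (rule Digamma_norm_le) (use s in simp)
    ultimately have D: "norm (Digamma (s / 2 + 1)) \<le> 60 * (1 + real n)" by simp
    have lp: "\<bar>ln pi\<bar> \<le> 4" using ln_le_minus_one[of pi] pi_less_4 ln_ge_zero[of pi] pi_ge_two by simp
    have n2: "1 + real n \<le> (1 + real n)\<^sup>2" by (simp add: power2_eq_square)
    have xi: "deriv xi_fun s / xi_fun s = deriv zeta_aux s / zeta_aux s - of_real (ln pi) / 2 + Digamma (s / 2 + 1) / 2"
      using z s by (intro xi_fun_log_derivative(2)) auto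
    have "norm (deriv xi_fun s / xi_fun s) \<le>
        norm (deriv zeta_aux s / zeta_aux s) + norm (complex_of_real (ln pi) / 2) + norm (Digamma (s / 2 + 1) / 2)"
      unfolding xi by (intro norm_triangle_mono norm_triangle_ineq4 order_refl)
    also have "\<dots> = norm (deriv zeta_aux s / zeta_aux s) + \<bar>ln pi\<bar> / 2 + norm (Digamma (s / 2 + 1)) / 2"
      by (simp add: norm_divide)
    also have "\<dots> \<le> K * (1 + real n)\<^sup>2 + 2 + 30 * (1 + real n)"
      using l D lp by argo
    also have "\<dots> \<le> K * (1 + real n)\<^sup>2 + 40 * (1 + real n)" by simp
    also have "\<dots> \<le> K * (1 + real n)\<^sup>2 + 40 * (1 + real n)\<^sup>2" using n2 by (intro add_left_mono mult_left_mono) auto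
    finally have "norm (deriv xi_fun s / xi_fun s) \<le> (K + 40) * (1 + real n)\<^sup>2" by (simp add: ring_distribs)
    moreover have "xi_fun s \<noteq> 0" using z s by (intro xi_fun_log_derivative(1)) auto
    ultimately show ?thesis by blast
  qed
  show ?thesis
  proof (rule that[of "K + 40"])
    fix n
    obtain T where T: "real n \<le> T" "T \<le> real n + 1"
      "\<And>s. \<bar>Im s\<bar> = T \<Longrightarrow> -1/4 \<le> Re s \<Longrightarrow> Re s \<le> 5/4 \<Longrightarrow>
        zeta_aux s \<noteq> 0 \<and> norm (deriv zeta_aux s / zeta_aux s) \<le> K * (1 + real n) ^ 2"
      using K(2)[of n] by blast
    have "xi_fun s \<noteq> 0 \<and> norm (deriv xi_fun s / xi_fun s) \<le> (K + 40) * (1 + real n)\<^sup>2"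
      if "\<bar>Im s\<bar> = T" "-1/4 \<le> Re s" "Re s \<le> 5/4" for s
      using main[of s n] T(2) T(3)[OF that] that by simp
    thus "\<exists>T. real n \<le> T \<and> T \<le> real n + 1 \<and> (\<forall>s. \<bar>Im s\<bar> = T \<and> -1/4 \<le> Re s \<and> Re s \<le> 5/4 \<longrightarrow>
        xi_fun s \<noteq> 0 \<and> norm (deriv xi_fun s / xi_fun s) \<le> (K + 40) * (1 + real n)\<^sup>2)"
      using T by blast
  qed (use K in simp)
qed

lemma quadratic_exp_tendsto_0:
  fixes \<delta> :: real assumes "\<delta> > 0"
  shows "(\<lambda>n. (1 + real n)\<^sup>2 * exp (- \<delta> * real n)) \<longlonglongrightarrow> 0"
proof (rule Lim_null_comparison)
  show "\<forall>\<^sub>F n in sequentially. norm ((1 + real n)\<^sup>2 * exp (- \<delta> * real n)) \<le> exp (\<delta> / 2) * (4 / \<delta>)\<^sup>2 * exp (- (\<delta> / 2)) ^ n"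
  proof (intro always_eventually allI)
    fix n :: nat
    have "exp (- (\<delta> / 2)) ^ n = exp (- (\<delta> / 2) * real n)"
      using exp_of_nat_mult[of n "- (\<delta> / 2)"] by (simp add: mult.commute)
    thus "norm ((1 + real n)\<^sup>2 * exp (- \<delta> * real n)) \<le> exp (\<delta> / 2) * (4 / \<delta>)\<^sup>2 * exp (- (\<delta> / 2)) ^ n"
      using poly_exp_le[OF assms, of "real n"] by (simp add: abs_mult)
  qed
  show "(\<lambda>n. exp (\<delta> / 2) * (4 / \<delta>)\<^sup>2 * exp (- (\<delta> / 2)) ^ n) \<longlonglongrightarrow> 0"
    using assms by (intro tendsto_mult_right_zero LIMSEQ_realpow_zero) auto
qed

text \<open>\<open>has_sum\<close> is a limit over the finite subsets of A. The truncations by g are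
  finite and eventually contain any given finite subset, so an unordered sum may be computed in
  order of increasing height.\<close>

lemma has_sum_imp_tendsto_exhaustion:
  fixes g :: "'a \<Rightarrow> real"
  assumes "(f has_sum S) A" "filterlim T at_top sequentially" "\<And>n. finite {x\<in>A. g x < T n}"
  shows "(\<lambda>n. sum f {x\<in>A. g x < T n}) \<longlonglongrightarrow> S"
proof -
  have "filterlim (\<lambda>n. {x\<in>A. g x < T n}) (finite_subsets_at_top A) sequentially"
    unfolding filterlim_iff eventually_finite_subsets_at_top
  proof (intro allI impI, elim exE conjE)
    fix P X assume X: "finite X" "X \<subseteq> A" and P: "\<forall>Y. finite Y \<and> X \<subseteq> Y \<and> Y \<subseteq> A \<longrightarrow> P Y"
    have "\<forall>\<^sub>F n in sequentially. \<forall>x\<in>X. g x < T n"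
      using assms(2) X by (intro eventually_ball_finite ballI) (auto simp: filterlim_at_top_dense)
    thus "\<forall>\<^sub>F n in sequentially. P {x\<in>A. g x < T n}"
    proof (rule eventually_mono)
      fix n assume "\<forall>x\<in>X. g x < T n"
      hence "X \<subseteq> {x\<in>A. g x < T n}" using X by auto
      with P assms(3)[of n] show "P {x\<in>A. g x < T n}" by (metis (no_types, lifting) mem_Collect_eq subsetI)
    qed
  qed
  with assms(1)[unfolded has_sum_def] show ?thesis by (rule filterlim_compose)
qed

text \<open>Along the heights T n the truncated sums have two limits: the unordered sum, because the
  terms are summable, and the full line integral, because the horizontal error is O(n^2
  exp(-\<delta> n)). On the line Re w = 3/4 the kernel splits into its values for z and for
  1/z.\<close>

lemma zero_sum_eq_line_integrals:
  assumes z: "z \<notin> \<real>\<^sub>\<le>\<^sub>0"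
  shows "(\<Sum>\<^sub>\<infinity>\<rho>\<in>zeta_zeros_upper. of_int (zorder riemann_zeta \<rho>) * odd_kernel z (\<rho> - 1/2)) =
    (line_integral archimedean_factor (3/4) z - line_integral archimedean_factor (3/4) (1 / z)) -
    (line_integral (\<lambda>w. mangoldt_series (1/2 + w)) (3/4) z - line_integral (\<lambda>w. mangoldt_series (1/2 + w)) (3/4) (1 / z))"
    (is "?S = ?R")
proof -
  have z0: "z \<noteq> 0" using z by auto
  have zi: "1 / z \<notin> \<real>\<^sub>\<le>\<^sub>0" using z by (metis inverse_eq_divide nonpos_Reals_inverse_iff)
  define \<delta> where "\<delta> = pi - \<bar>Arg z\<bar>"
  have \<delta>: "\<delta> > 0" using Arg_less_pi[OF z] by (simp add: \<delta>_def)
  obtain C where C: "C \<ge> 0" "\<And>w. \<bar>Re w\<bar> \<le> 3/4 \<Longrightarrow> norm (odd_kernel z w) \<le> C * exp (- (pi - \<bar>Arg z\<bar>) * \<bar>Im w\<bar>)"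
    by (fact odd_kernel_bound[OF z])
  obtain K where K: "K \<ge> 0"
    "\<And>n::nat. \<exists>T. real n \<le> T \<and> T \<le> real n + 1 \<and> (\<forall>s. \<bar>Im s\<bar> = T \<and> -1/4 \<le> Re s \<and> Re s \<le> 5/4 \<longrightarrow>
        xi_fun s \<noteq> 0 \<and> norm (deriv xi_fun s / xi_fun s) \<le> K * (1 + real n)\<^sup>2)"
    by (fact xi_fun_good_heights)
  \<comment> \<open>Starting from \<open>Suc n\<close> makes every height positive, as
    \<open>zero_sum_contour\<close> requires.\<close>
  have "\<exists>T. \<forall>n. real (Suc n) \<le> T n \<and> T n \<le> real (Suc n) + 1 \<and> (\<forall>s. \<bar>Im s\<bar> = T n \<and> -1/4 \<le> Re s \<and> Re s \<le> 5/4 \<longrightarrow>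
        xi_fun s \<noteq> 0 \<and> norm (deriv xi_fun s / xi_fun s) \<le> K * (1 + real (Suc n))\<^sup>2)"
    by (intro choice allI K(2))
  then obtain T where T: "\<And>n. real (Suc n) \<le> T n"
    "\<And>n s. \<bar>Im s\<bar> = T n \<Longrightarrow> -1/4 \<le> Re s \<Longrightarrow> Re s \<le> 5/4 \<Longrightarrow>
       xi_fun s \<noteq> 0 \<and> norm (deriv xi_fun s / xi_fun s) \<le> K * (1 + real (Suc n))\<^sup>2"
    by blast
  have T0: "T n > 0" for n using T(1)[of n] by simp
  have Tlim: "filterlim T at_top sequentially"
  proof (rule filterlim_at_top_mono[OF filterlim_real_sequentially])
    show "\<forall>\<^sub>F n in sequentially. real n \<le> T n"
      using T(1) by (intro always_eventually allI) (metis of_nat_Suc add_increasing2 le_add_same_cancel1 order_trans zero_le_one add.commute)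
  qed
  define G where "G = (\<lambda>t. deriv xi_fun (Complex (5/4) t) * odd_kernel z (Complex (5/4) t - 1/2) / xi_fun (Complex (5/4) t))"
  define B where "B = (\<lambda>n. K * C * ((1 + real (Suc n))\<^sup>2 * exp (- \<delta> * real (Suc n))))"
  have B: "xi_fun s \<noteq> 0 \<and> norm (deriv xi_fun s * odd_kernel z (s - 1/2) / xi_fun s) \<le> B n"
    if s: "\<bar>Im s\<bar> = T n" "-1/4 \<le> Re s" "Re s \<le> 5/4" for s n
  proof -
    have "Re (s - 1/2) = Re s - 1/2" by simp
    hence "\<bar>Re (s - 1/2)\<bar> \<le> 3/4" using s by linarith
    hence "norm (odd_kernel z (s - 1/2)) \<le> C * exp (- \<delta> * T n)"
      using C(2)[of "s - 1/2"] s by (simp add: \<delta>_def)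
    also have "\<dots> \<le> C * exp (- \<delta> * real (Suc n))" using T(1)[of n] \<delta> C(1) by (intro mult_left_mono) auto
    finally have o: "norm (odd_kernel z (s - 1/2)) \<le> C * exp (- \<delta> * real (Suc n))" .
    have "norm (deriv xi_fun s * odd_kernel z (s - 1/2) / xi_fun s) = norm (deriv xi_fun s / xi_fun s) * norm (odd_kernel z (s - 1/2))"
      by (simp add: norm_mult norm_divide)
    also have "\<dots> \<le> (K * (1 + real (Suc n))\<^sup>2) * (C * exp (- \<delta> * real (Suc n)))"
      by (rule mult_mono) (use T(2)[OF s] o K(1) in auto)
    finally show ?thesis using T(2)[OF s] by (simp add: B_def mult_ac)
  qed
  have Blim: "B \<longlonglongrightarrow> 0"
    unfolding B_def using LIMSEQ_Suc[OF quadratic_exp_tendsto_0[OF \<delta>]] by (rule tendsto_mult_right_zero)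
  define Z where "Z = (\<lambda>n. \<Sum>\<rho>\<in>{\<rho>\<in>zeta_zeros_upper. Im \<rho> < T n}. of_int (zorder riemann_zeta \<rho>) * odd_kernel z (\<rho> - 1/2))"
  have fin: "finite {\<rho>\<in>zeta_zeros_upper. Im \<rho> < T n}" for n
    by (rule zero_sum_contour(1)[OF z0 T0]) (rule B)
  have diff: "norm (Z n - integral {-T n..T n} G / (2 * pi)) \<le> B n" for n
    unfolding Z_def G_def by (rule zero_sum_contour(2)[OF z0 T0]) (rule B)
  have summ: "(\<lambda>\<rho>. of_int (zorder riemann_zeta \<rho>) * odd_kernel z (\<rho> - 1/2)) summable_on zeta_zeros_upper"
  proof (rule zeta_zeros_summable[OF \<delta>])
    fix \<rho> assume "\<rho> \<in> zeta_zeros_upper"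
    hence r: "Im \<rho> > 0" "-1 < Re \<rho>" "Re \<rho> < 2" "xi_fun \<rho> = 0" by (simp_all add: zeta_zeros_upper_iff)
    have "0 \<le> Re \<rho> \<and> Re \<rho> \<le> 1" using xi_fun_zero_strip[OF r(2,3,4)] by blast
    moreover have "Re (\<rho> - 1/2) = Re \<rho> - 1/2" by simp
    ultimately have "\<bar>Re (\<rho> - 1/2)\<bar> \<le> 3/4" by linarith
    thus "norm (odd_kernel z (\<rho> - 1/2)) \<le> C * exp (- \<delta> * Im \<rho>)"
      using C(2)[of "\<rho> - 1/2"] r(1) by (simp add: \<delta>_def)
  qed
  have "Z \<longlonglongrightarrow> ?S" unfolding Z_def
    by (rule has_sum_imp_tendsto_exhaustion[OF has_sum_infsum[OF summ] Tlim fin])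
  moreover have "Z \<longlonglongrightarrow> ?R"
  proof -
    note ia = line_integral_archimedean(2)[OF z] line_integral_archimedean(2)[OF zi]
      line_integral_mangoldt_series(1)[OF z] line_integral_mangoldt_series(1)[OF zi]
    have G_eq: "G = (\<lambda>t. (archimedean_factor (Complex (3/4) t) * mellin_kernel z (Complex (3/4) t) -
        archimedean_factor (Complex (3/4) t) * mellin_kernel (1 / z) (Complex (3/4) t)) -
        (mangoldt_series (1/2 + Complex (3/4) t) * mellin_kernel z (Complex (3/4) t) -
         mangoldt_series (1/2 + Complex (3/4) t) * mellin_kernel (1 / z) (Complex (3/4) t)))"
    proof
      fix t
      define w where "w = Complex (3/4) t"
      have w: "Complex (5/4) t = 1/2 + w" "w \<noteq> 0" "Re w = 3/4" by (simp_all add: w_def complex_eq_iff)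
      have "G t = (deriv xi_fun (1/2 + w) / xi_fun (1/2 + w)) * odd_kernel z w" by (simp add: G_def w(1))
      also have "\<dots> = (archimedean_factor w - mangoldt_series (1/2 + w)) * (mellin_kernel z w - mellin_kernel (1 / z) w)"
        unfolding xi_log_derivative_line[OF w(3)] odd_kernel_eq[OF z w(2)] ..
      finally show "G t = (archimedean_factor (Complex (3/4) t) * mellin_kernel z (Complex (3/4) t) -
        archimedean_factor (Complex (3/4) t) * mellin_kernel (1 / z) (Complex (3/4) t)) -
        (mangoldt_series (1/2 + Complex (3/4) t) * mellin_kernel z (Complex (3/4) t) -
         mangoldt_series (1/2 + Complex (3/4) t) * mellin_kernel (1 / z) (Complex (3/4) t))"
        unfolding w_def[symmetric] by (simp add: algebra_simps)
    qed
    have intG: "integrable lborel G" unfolding G_eq by (intro Bochner_Integration.integrable_diff ia)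
    have "(LINT t|lborel. G t) / (2 * pi) = ?R"
      unfolding G_eq line_integral_def using ia by (simp add: diff_divide_distrib)
    moreover have "(\<lambda>n. integral {-T n..T n} G / (2 * pi)) \<longlonglongrightarrow> (LINT t|lborel. G t) / (2 * pi)"
      by (intro tendsto_divide tendsto_const filterlim_compose[OF truncated_integral_tendsto[OF intG] Tlim]) simp
    moreover have "(\<lambda>n. Z n - integral {-T n..T n} G / (2 * pi)) \<longlonglongrightarrow> 0"
      by (rule Lim_null_comparison[OF always_eventually Blim]) (use diff in blast)
    ultimately have "(\<lambda>n. (Z n - integral {-T n..T n} G / (2 * pi)) + integral {-T n..T n} G / (2 * pi)) \<longlonglongrightarrow> 0 + ?R"
      by (intro tendsto_add) simp_all
    thus ?thesis by simp
  qed
  ultimately show ?thesis by (rule LIMSEQ_unique)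
qed

text \<open>All integrals are known explicitly except the digamma ones N and N', which are known
  only after multiplication by q = z^2 - 1. Both sides are therefore multiplied by 2 P s q, nonzero
  as z \<noteq> 1, and compared as polynomials; \<open>Arctan_inverse\<close> expresses the
  arctangent belonging to 1/z through A.\<close>

lemma archimedean_difference:
  assumes z: "z \<notin> \<real>\<^sub>\<le>\<^sub>0" and z1: "z \<noteq> 1"
  shows "line_integral archimedean_factor (3/4) z - line_integral archimedean_factor (3/4) (1 / z) =
    csqrt z - deriv riemann_zeta (1/2) / riemann_zeta (1/2) / pi + h0 z"
proof -
  define s where "s = csqrt z"
  define A where "A = Arctan s"
  define D where "D = Digamma (1/4 :: complex)"
  define P where "P = complex_of_real pi"
  define L where "L = complex_of_real (ln pi)"
  define M where "M = line_integral (\<lambda>w. 1 / (w + 1/2)) (3/4) z"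
  define M' where "M' = line_integral (\<lambda>w. 1 / (w + 1/2)) (3/4) (1 / z)"
  define N where "N = line_integral (\<lambda>w. Digamma (5/4 + w / 2) / 2) (3/4) z"
  define N' where "N' = line_integral (\<lambda>w. Digamma (5/4 + w / 2) / 2) (3/4) (1 / z)"
  have z0: "z \<noteq> 0" using z by auto
  have zi: "1 / z \<notin> \<real>\<^sub>\<le>\<^sub>0" using z by (metis inverse_eq_divide nonpos_Reals_inverse_iff)
  have zs: "z = s * s" using power2_csqrt[of z] by (simp add: s_def power2_eq_square)
  have s0: "s \<noteq> 0" using z0 zs by auto
  have zp: "1 + z \<noteq> 0" using one_plus_nonzero[OF z] .
  have P0: "P \<noteq> 0" by (simp add: P_def)
  have si: "csqrt (1 / z) = 1 / s" using csqrt_inverse[OF z] by (simp add: s_def inverse_eq_divide)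
  have Ai: "Arctan (1 / s) = P / 2 - A"
    using Arctan_inverse[of s] csqrt_Re_pos[OF z] by (simp add: s_def A_def P_def)
  define q where "q = z\<^sup>2 - 1"
  have qf: "q = (z - 1) * (z + 1)" by (simp add: q_def power2_eq_square algebra_simps)
  have q0: "q \<noteq> 0" unfolding qf using z1 zp by (auto simp: add.commute)
  have M: "s * P * M = 2 * s - 2 * A"
  proof -
    have "z * M = 2 * z / P - 2 / P * s * A"
      using line_integral_pole_minus_half[OF z] by (simp add: M_def s_def A_def P_def)
    hence "s * (s * P * M) = s * (2 * s - 2 * A)" using P0 unfolding zs by (simp add: field_simps)
    thus ?thesis using s0 mult_left_cancel by blast
  qed
  have M': "P * M' = 2 - 2 * s * (P / 2 - A)"
  proof -
    have "1 / z * M' = 2 * (1 / z) / P - 2 / P * (1 / s) * (P / 2 - A)"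
      using line_integral_pole_minus_half[OF zi] unfolding si Ai by (simp add: M'_def P_def)
    thus ?thesis using P0 s0 unfolding zs by (simp add: field_simps)
  qed
  have N: "2 * P * q * N = - 2 * P * M - z * (D + P) + z\<^sup>2 * (D + 4)"
  proof -
    have "q * N = - M - z * (D + P) / (2 * P) + z\<^sup>2 * (D / 2 + 2) / P"
      using line_integral_Digamma[OF z] by (simp add: M_def N_def D_def P_def q_def)
    hence "2 * P * (q * N) = 2 * P * (- M - z * (D + P) / (2 * P) + z\<^sup>2 * (D / 2 + 2) / P)" by simp
    also have "\<dots> = - 2 * P * M - z * (D + P) + z\<^sup>2 * (D + 4)"
      using P0 by (simp add: field_simps power2_eq_square)
    finally show ?thesis by (simp add: mult.assoc)
  qed
  have N': "2 * P * q * N' = 2 * P * M' * z\<^sup>2 + z * (D + P) - (D + 4)"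
  proof -
    have e: "(1 / z)\<^sup>2 - 1 = - q / z\<^sup>2" using z0 by (simp add: q_def field_simps)
    have "- q / z\<^sup>2 * N' = - M' - 1 / z * (D + P) / (2 * P) + (1 / z)\<^sup>2 * (D / 2 + 2) / P"
      using line_integral_Digamma[OF zi] unfolding e by (simp add: M'_def N'_def D_def P_def)
    hence e1: "2 * P * z\<^sup>2 * (- q / z\<^sup>2 * N') = 2 * P * z\<^sup>2 * (- M' - 1 / z * (D + P) / (2 * P) + (1 / z)\<^sup>2 * (D / 2 + 2) / P)"
      by simp
    have e2: "2 * P * z\<^sup>2 * (- q / z\<^sup>2 * N') = - (2 * P * q * N')" using z0 by simp
    have e3: "2 * P * z\<^sup>2 * (- M' - 1 / z * (D + P) / (2 * P) + (1 / z)\<^sup>2 * (D / 2 + 2) / P) =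
        - (2 * P * M' * z\<^sup>2) - z * (D + P) + (D + 4)"
      using z0 P0 by (simp add: field_simps power2_eq_square)
    show ?thesis using arg_cong[OF trans[OF trans[OF e2[symmetric] e1] e3], of uminus] by (simp add: algebra_simps)
  qed
  define X where "X = line_integral archimedean_factor (3/4) z - line_integral archimedean_factor (3/4) (1 / z)"
  define Y where "Y = s - (L / 2 - D / 2) / P + h0 z"
  have X: "X = 2 / P * s * A - L / 2 * (z / (P * (1 + z))) + N - (2 / P * (1 / s) * (P / 2 - A) - L / 2 * (1 / (P * (1 + z))) + N')"
  proof -
    have e: "1 / z / (P * (1 + 1 / z)) = 1 / (P * (1 + z))" using z0 zp P0 by (simp add: divide_simps add.commute)
    have "line_integral archimedean_factor (3/4) z = 2 / P * s * A - L / 2 * (z / (P * (1 + z))) + N"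
      unfolding line_integral_archimedean(1)[OF z] line_integral_pole_half[OF z]
      by (simp add: s_def A_def P_def L_def N_def)
    moreover have "line_integral archimedean_factor (3/4) (1 / z) = 2 / P * (1 / s) * (P / 2 - A) - L / 2 * (1 / (P * (1 + z))) + N'"
      unfolding line_integral_archimedean(1)[OF zi] line_integral_pole_half[OF zi] si Ai P_def[symmetric] L_def[symmetric] N'_def[symmetric] e
      by (simp add: P_def)
    ultimately show ?thesis unfolding X_def by simp
  qed
  have "- D = complex_of_real (euler_mascheroni + 3 * ln 2 + pi / 2)" unfolding D_def Digamma_quarter by simp
  moreover have "ln (8 * pi) = 3 * ln 2 + ln pi"
    using ln_realpow[of 2 3] by (simp add: ln_mult)
  ultimately have g: "complex_of_real (ln (8 * pi) + euler_mascheroni) = L - D - P / 2"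
    by (simp add: L_def P_def)
  have tp: "complex_of_real (2 / pi) = 2 / P" by (simp add: P_def)
  have h0: "h0 z = 1 / (s * q) - 1 / (2 * z - 2) + ((L - D - P / 2) / P) * (1 / (z + 1)) - (2 / P) * (s / (z + 1)) * (P / 2 - A)"
    unfolding h0_def tp g s_def[symmetric] Ai q_def[symmetric] P_def[symmetric] ..
  \<comment> \<open>The reciprocals become opaque symbols bound only by the relations
    \<open>inv\<close>, so the comparison is ring algebra without symbolic denominators. The terms
    below are grouped into the products that occur in \<open>inv\<close>.\<close>
  define p i r v t where "p = 1 / P" and "i = 1 / s" and "r = 1 / (z + 1)" and "v = 1 / q" and "t = 1 / (2 * z - 2)"
  have inv: "P * p = 1" "s * i = 1" "q * v = 1" "q * r = z - 1" "q * t = (z + 1) / 2"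
    using P0 s0 q0 zp z1 unfolding p_def i_def r_def v_def t_def by (simp_all add: qf field_simps)
  have Xi: "X = 2 * p * s * A - L / 2 * z * p * r + N - (2 * p * i * (P / 2 - A) - L / 2 * p * r + N')"
    unfolding X p_def i_def r_def by (simp add: add.commute mult.assoc)
  have Yi: "Y = s - (L / 2 - D / 2) * p + (i * v - t + (L - D - P / 2) * p * r - 2 * p * s * r * (P / 2 - A))"
    unfolding Y_def h0 p_def i_def r_def v_def t_def by (simp add: mult.assoc)
  have "2 * P * s * q * X = 4 * (s * s) * A * q * (P * p) - L * s * z * (q * r) * (P * p) + s * (2 * P * q * N)
      - 4 * (P / 2 - A) * q * (P * p) * (s * i) + L * s * (q * r) * (P * p) - s * (2 * P * q * N')"
    unfolding Xi by (simp add: algebra_simps)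
  also have "\<dots> = 4 * (s * s) * A * q - L * s * z * (z - 1) - 2 * (s * P * M) - s * z * (D + P) + s * z\<^sup>2 * (D + 4)
      - 4 * (P / 2 - A) * q + L * s * (z - 1) - s * (2 * (P * M') * z\<^sup>2 + z * (D + P) - (D + 4))"
    unfolding N N' inv by (simp add: algebra_simps)
  also have "\<dots> = 2 * P * (s * s) * q - s * (L - D) * q + 2 * P - P * s * (z + 1)
      + 2 * s * (L - D - P / 2) * (z - 1) - 4 * (s * s) * (z - 1) * (P / 2 - A)"
    unfolding M M' qf zs by (simp add: algebra_simps power2_eq_square)
  \<comment> \<open>The relations \<open>inv\<close> are now read from right to left, to reassemble
    the terms of Y.\<close>
  also have "\<dots> = 2 * P * (s * s) * q - s * (L - D) * q * (P * p) + 2 * P * (s * i) * (q * v) - 2 * P * s * (q * t)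
      + 2 * s * (L - D - P / 2) * (q * r) * (P * p) - 4 * (s * s) * (q * r) * (P * p) * (P / 2 - A)"
    unfolding inv by simp
  also have "\<dots> = 2 * P * s * q * Y"
    unfolding Yi by (simp add: algebra_simps)
  finally have "X = Y" using P0 s0 q0 by simp
  thus ?thesis unfolding X_def Y_def zeta_log_derivative_half by (simp add: s_def L_def D_def P_def)
qed

text \<open>In s = sqrt z the two polar terms combine over (s - 1)(s + 1)(s^2 + 1), and the
  numerator 2 - s (s^2 + 1) = -(s - 1)(s^2 + s + 2) cancels the pole. At s = 1 this part equals -1/2
  and the arctangent term -1/4.\<close>

lemma h0_tendsto_1: "(h0 \<longlongrightarrow> - (3/4) + of_real (ln (8 * pi) + euler_mascheroni) / (2 * pi)) (at 1)"
proof -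
  define g where "g = (\<lambda>z. - ((csqrt z)\<^sup>2 + csqrt z + 2) / (2 * csqrt z * (csqrt z + 1) * ((csqrt z)\<^sup>2 + 1))
     + (complex_of_real (ln (8 * pi) + euler_mascheroni) / pi) * (1 / (z + 1))
     - (2 / pi) * (csqrt z / (z + 1)) * Arctan (1 / csqrt z))"
  have "(1 :: complex) \<notin> \<real>\<^sub>\<le>\<^sub>0" by simp
  hence c: "(csqrt \<longlongrightarrow> 1) (at 1)" using continuous_at_csqrt[of 1] by (simp add: isCont_def)
  have "((\<lambda>z. Arctan (1 / csqrt z)) \<longlongrightarrow> Arctan 1) (at 1)"
  proof (rule isCont_tendsto_compose[of 1 Arctan])
    show "isCont Arctan 1" by (rule continuous_at_Arctan) simp
    show "((\<lambda>z. 1 / csqrt z) \<longlongrightarrow> 1) (at 1)" using tendsto_divide[OF tendsto_const c, of 1] by simp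
  qed
  moreover have "Arctan 1 = complex_of_real (pi / 4)" using Arctan_of_real[of 1] by simp
  ultimately have a: "((\<lambda>z. Arctan (1 / csqrt z)) \<longlongrightarrow> complex_of_real (pi / 4)) (at 1)" by simp
  define l where "l = - (1\<^sup>2 + 1 + 2) / (2 * 1 * (1 + 1) * (1\<^sup>2 + 1))
     + (complex_of_real (ln (8 * pi) + euler_mascheroni) / pi) * (1 / (1 + 1))
     - (2 / pi) * (1 / (1 + 1 :: complex)) * complex_of_real (pi / 4)"
  have "(g \<longlongrightarrow> l) (at 1)"
    unfolding g_def l_def by (intro tendsto_add tendsto_diff tendsto_mult tendsto_divide tendsto_power tendsto_minus tendsto_const tendsto_ident_at c a) simp_all
  moreover have "l = - (3/4) + of_real (ln (8 * pi) + euler_mascheroni) / (2 * pi)"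
    unfolding l_def by (simp add: field_simps)
  ultimately have "(g \<longlongrightarrow> - (3/4) + of_real (ln (8 * pi) + euler_mascheroni) / (2 * pi)) (at 1)"
    by (simp only:)
  moreover have "\<forall>\<^sub>F z in at 1. g z = h0 z"
  proof -
    have "\<forall>\<^sub>F z in nhds (1::complex). z \<in> {z. Re z > 0}"
      by (intro eventually_nhds_in_open open_halfspace_Re_gt) simp
    hence "\<forall>\<^sub>F z in at (1::complex). Re z > 0 \<and> z \<noteq> 1"
      by (auto simp: eventually_at_filter elim: eventually_mono)
    thus ?thesis
    proof eventually_elim
      case (elim z)
      hence z: "z \<notin> \<real>\<^sub>\<le>\<^sub>0" by (auto simp: complex_nonpos_Reals_iff)
      define s where "s = csqrt z"
      have zs: "z = s\<^sup>2" by (simp add: s_def)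
      have "Re s > 0" using csqrt_Re_pos[OF z] by (simp add: s_def)
      hence "s \<noteq> 0" "Re (s + 1) > 0" by auto
      moreover have "s - 1 \<noteq> 0" using elim zs by auto
      moreover have "s\<^sup>2 + 1 \<noteq> 0" using one_plus_nonzero[OF z] by (simp add: zs add.commute)
      ultimately have s: "s \<noteq> 0" "s - 1 \<noteq> 0" "s + 1 \<noteq> 0" "s\<^sup>2 + 1 \<noteq> 0"
        by (auto simp del: plus_complex.sel)
      have "1 / (s * (z\<^sup>2 - 1)) - 1 / (2 * z - 2) = (2 - s * (s\<^sup>2 + 1)) / (2 * s * ((s - 1) * (s + 1) * (s\<^sup>2 + 1)))"
      proof -
        have e: "z\<^sup>2 - 1 = (s - 1) * (s + 1) * (s\<^sup>2 + 1)" "2 * z - 2 = 2 * ((s - 1) * (s + 1))"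
          unfolding zs by (simp_all add: algebra_simps power2_eq_square)
        show ?thesis unfolding e using s by (simp add: divide_simps) (simp add: algebra_simps)
      qed
      also have "2 - s * (s\<^sup>2 + 1) = (s - 1) * (- (s\<^sup>2 + s + 2))" by (simp add: algebra_simps power2_eq_square)
      also have "(s - 1) * (- (s\<^sup>2 + s + 2)) / (2 * s * ((s - 1) * (s + 1) * (s\<^sup>2 + 1))) =
          - (s\<^sup>2 + s + 2) / (2 * s * (s + 1) * (s\<^sup>2 + 1))"
        using s by (simp add: divide_simps)
      finally show "g z = h0 z" by (simp add: g_def h0_def s_def)
    qed
  qed
  ultimately show ?thesis using Lim_transform_eventually by blast
qed

theorem theorem1:
  fixes z :: complex
  assumes "z \<notin> {x. Im x = 0 \<and> Re x \<le> 0}"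
  shows "(\<Sum>n. mangoldt (Suc n) * z / (pi * csqrt (of_nat (Suc n)) * (z + of_nat (Suc n))))
       - (\<Sum>n. mangoldt (Suc n) / (pi * csqrt (of_nat (Suc n)) * (1 + of_nat (Suc n) * z)))
     = csqrt z - deriv riemann_zeta (1/2) / (pi * riemann_zeta (1/2))
       - 2 * (\<Sum>\<^sub>\<infinity>\<rho>\<in>zeta_zeros_upper.
               of_int (zorder riemann_zeta \<rho>) *
               (let \<alpha> = - \<i> * (\<rho> - 1/2) in sin (\<alpha> * Ln z) / sinh (pi * \<alpha>)))
       + hfun z"
proof (cases "z = 1")
  case True
  have "ln (8 * pi) = 3 * ln 2 + ln pi"
    using ln_realpow[of 2 3] by (simp add: ln_mult)
  moreover have "Lim (at 1) h0 = - (3/4) + of_real (ln (8 * pi) + euler_mascheroni) / (2 * pi)"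
    by (rule tendsto_Lim[OF _ h0_tendsto_1]) simp
  moreover have "deriv riemann_zeta (1/2) / (pi * riemann_zeta (1/2)) =
      (of_real (ln pi) + of_real (euler_mascheroni + 3 * ln 2 + pi / 2)) / 2 / pi"
  proof -
    have "deriv riemann_zeta (1/2) / (pi * riemann_zeta (1/2)) = deriv riemann_zeta (1/2) / riemann_zeta (1/2) / pi"
      by (simp add: mult.commute)
    thus ?thesis unfolding zeta_log_derivative_half Digamma_quarter by (simp add: field_simps)
  qed
  \<comment> \<open>At z = 1 the two prime series coincide and every sin(\<alpha> Ln z) is 0, so the
    claim reduces to this relation between constants; the summand 1 is
    \<open>csqrt 1\<close>.\<close>
  ultimately have "deriv riemann_zeta (1/2) / (pi * riemann_zeta (1/2)) = 1 + Lim (at 1) h0"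
    by (simp only:) (simp add: field_simps)
  thus ?thesis using True by (simp add: hfun_def)
next
  case False
  have z: "z \<notin> \<real>\<^sub>\<le>\<^sub>0" using assms by (auto simp: complex_nonpos_Reals_iff)
  have z0: "z \<noteq> 0" using z by auto
  have zi: "1 / z \<notin> \<real>\<^sub>\<le>\<^sub>0" using z by (metis inverse_eq_divide nonpos_Reals_inverse_iff)
  have "2 * (\<Sum>\<^sub>\<infinity>\<rho>\<in>zeta_zeros_upper. of_int (zorder riemann_zeta \<rho>) *
           (let \<alpha> = - \<i> * (\<rho> - 1/2) in sin (\<alpha> * Ln z) / sinh (pi * \<alpha>)))
      = (\<Sum>\<^sub>\<infinity>\<rho>\<in>zeta_zeros_upper. 2 * (of_int (zorder riemann_zeta \<rho>) *
           (let \<alpha> = - \<i> * (\<rho> - 1/2) in sin (\<alpha> * Ln z) / sinh (pi * \<alpha>))))"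
    by (rule infsum_cmult_right'[symmetric])
  also have "\<dots> = (\<Sum>\<^sub>\<infinity>\<rho>\<in>zeta_zeros_upper. of_int (zorder riemann_zeta \<rho>) * odd_kernel z (\<rho> - 1/2))"
  proof (rule infsum_cong)
    fix \<rho> assume "\<rho> \<in> zeta_zeros_upper"
    hence "Im (\<rho> - 1/2) \<noteq> 0" by (simp add: zeta_zeros_upper_def)
    hence "\<rho> - 1/2 \<noteq> 0" by (metis zero_complex.sel(2))
    from sin_div_sinh_eq_odd_kernel[OF z0 this refl]
    show "2 * (of_int (zorder riemann_zeta \<rho>) *
           (let \<alpha> = - \<i> * (\<rho> - 1/2) in sin (\<alpha> * Ln z) / sinh (pi * \<alpha>))) =
         of_int (zorder riemann_zeta \<rho>) * odd_kernel z (\<rho> - 1/2)"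
      unfolding Let_def by (simp only:) simp
  qed
  also note zero_sum_eq_line_integrals[OF z]
  finally have main: "2 * (\<Sum>\<^sub>\<infinity>\<rho>\<in>zeta_zeros_upper. of_int (zorder riemann_zeta \<rho>) *
           (let \<alpha> = - \<i> * (\<rho> - 1/2) in sin (\<alpha> * Ln z) / sinh (pi * \<alpha>))) =
     (csqrt z - deriv riemann_zeta (1/2) / riemann_zeta (1/2) / pi + h0 z) -
     (line_integral (\<lambda>w. mangoldt_series (1/2 + w)) (3/4) z - line_integral (\<lambda>w. mangoldt_series (1/2 + w)) (3/4) (1 / z))"
    unfolding archimedean_difference[OF z False] .
  \<comment> \<open>The second prime series is the first one taken at 1/z, with the inner fractions
    cleared.\<close>
  have "mangoldt (Suc n) * (1 / z) / (pi * csqrt (of_nat (Suc n)) * (1 / z + of_nat (Suc n))) =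
      mangoldt (Suc n) / (pi * csqrt (of_nat (Suc n)) * (1 + of_nat (Suc n) * z))" for n
  proof -
    have "1 + of_nat (Suc n) * z = z * (1 / z + of_nat (Suc n))" using z0 by (simp add: field_simps)
    thus ?thesis by (simp add: mult_ac)
  qed
  hence "line_integral (\<lambda>w. mangoldt_series (1/2 + w)) (3/4) (1 / z) =
     (\<Sum>n. mangoldt (Suc n) / (pi * csqrt (of_nat (Suc n)) * (1 + of_nat (Suc n) * z)))"
    unfolding line_integral_mangoldt_series(2)[OF zi] by (simp only:)
  thus ?thesis
    unfolding main line_integral_mangoldt_series(2)[OF z, symmetric] using False
    by (simp add: hfun_def mult.commute)
qed

end
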